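(* Let $X$ be a (possibly infinite) vertex-transitive graph on which the simple random walk has a unique stationary distribution $\rho$, and let $p=\Pr_{\mathbf G\sim\mathsf{RR}_n(X)}[(i,j)\in E(\mathbf G)]$ be the marginal edge probability of an $n$-vertex random restriction of $X$. Suppose there exist $C\ge1$ and $\lambda\in[(np)^{-1/2},1]$ such that for every $k\in\mathbb N$ and every distribution $\alpha$ on $V(X)$, \[d_{TV}(X^k\alpha,\rho)\le C\lambda^k,\] where $X^k$ denotes the $k$-step random walk operator on $X$, and suppose furthermore that $pn\gg C^6\log^4 n$. Then for any constant $\gamma>0$, \[\Pr_{\mathbf G\sim\mathsf{RR}_n(X)}\Bigl[\,|\lambda_2(\widehat A_{\mathbf G})|,\ |\lambda_n(\widehat A_{\mathbf G})|\le(1+o(1))\cdot\max\Bigl(\lambda,\frac{\log^4 n}{\sqrt{pn}}\Bigr)\Bigr]\ge 1-n^{-\gamma},\] where $\widehat A_{\mathbf G}$ is the normalized adjacency matrix of $\mathbf G$.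
   Context: An $n$-vertex random restriction $\mathbf G\sim\mathsf{RR}_n(X)$ is sampled by drawing $n$ vertices $\mathbf s_1,\dots,\mathbf s_n$ of $X$ independently according to $\rho$ and letting $\mathbf G$ be the graph on $[n]$ with $i\sim j$ iff $\mathbf s_i$ and $\mathbf s_j$ are adjacent in $X$ (the induced graph on the sample). The normalized adjacency matrix is $D^{-1/2}AD^{-1/2}$ where $A$ is the adjacency matrix and $D$ the diagonal degree matrix; $\lambda_1\ge\dots\ge\lambda_n$ are its eigenvalues. Asymptotic notation refers to $n\to\infty$. *)

theory Defs
  imports "HOL-Probability.Probability" "HOL-Library.Landau_Symbols"
    "Jordan_Normal_Form.Char_Poly"
begin

text \<open>
  A possibly infinite graph is a set of vertices \<^term>\<open>space M\<close> with a simple undirected adjacency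
  relation \<open>E\<close>. ``A uniformly random neighbour'' of a vertex of infinite degree only makes sense
  relative to a measure of volume, so the vertex set carries one: counting measure for finite
  graphs, surface measure for geometric graphs on a sphere. The volume of the neighbourhood of a
  vertex plays the role of its degree.
\<close>

locale measured_graph = sigma_finite_measure M for M :: "'v measure" +
  fixes E :: "'v rel"
  assumes E_sets: "E \<in> sets (M \<Otimes>\<^sub>M M)"
    and E_sym: "sym E"
    and E_irrefl: "irrefl E"
    and degree_pos: "\<And>x. x \<in> space M \<Longrightarrow> emeasure M (E `` {x}) > 0"
    and degree_finite: "\<And>x. x \<in> space M \<Longrightarrow> emeasure M (E `` {x}) < \<infinity>"

text \<open>
  An automorphism respects the whole structure, including the volume. If \<open>M\<close> is the counting
  measure on a set, these are exactly the graph automorphisms.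
\<close>

definition graph_automorphism :: "'v measure \<Rightarrow> 'v rel \<Rightarrow> ('v \<Rightarrow> 'v) \<Rightarrow> bool" where
  "graph_automorphism M E \<phi> \<longleftrightarrow>
     \<phi> \<in> M \<rightarrow>\<^sub>M M \<and> bij_betw \<phi> (space M) (space M) \<and>
     the_inv_into (space M) \<phi> \<in> M \<rightarrow>\<^sub>M M \<and> distr M M \<phi> = M \<and>
     (\<forall>x\<in>space M. \<forall>y\<in>space M. (\<phi> x, \<phi> y) \<in> E \<longleftrightarrow> (x, y) \<in> E)"

definition vertex_transitive :: "'v measure \<Rightarrow> 'v rel \<Rightarrow> bool" where
  "vertex_transitive M E \<longleftrightarrow>
     (\<forall>x\<in>space M. \<forall>y\<in>space M. \<exists>\<phi>. graph_automorphism M E \<phi> \<and> \<phi> x = y)"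

definition walk_kernel :: "'v measure \<Rightarrow> 'v rel \<Rightarrow> 'v \<Rightarrow> 'v measure" where
  "walk_kernel M E x = uniform_measure M (E `` {x})"

definition walk :: "'v measure \<Rightarrow> 'v rel \<Rightarrow> 'v measure \<Rightarrow> 'v measure" where
  "walk M E \<alpha> = \<alpha> \<bind> walk_kernel M E"

definition stationary :: "'v measure \<Rightarrow> 'v rel \<Rightarrow> 'v measure \<Rightarrow> bool" where
  "stationary M E \<rho> \<longleftrightarrow> \<rho> \<in> space (prob_algebra M) \<and> walk M E \<rho> = \<rho>"

definition unique_stationary :: "'v measure \<Rightarrow> 'v rel \<Rightarrow> 'v measure \<Rightarrow> bool" where
  "unique_stationary M E \<rho> \<longleftrightarrow> stationary M E \<rho> \<and> (\<forall>\<rho>'. stationary M E \<rho>' \<longrightarrow> \<rho>' = \<rho>)"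

text \<open>For probability measures on the same \<open>\<sigma>\<close>-algebra.\<close>

definition tv_dist :: "'v measure \<Rightarrow> 'v measure \<Rightarrow> real" where
  "tv_dist \<mu> \<nu> = (SUP A\<in>sets \<mu>. \<bar>measure \<mu> A - measure \<nu> A\<bar>)"

text \<open>
  A graph on the \<open>n\<close> vertices \<open>0, \<dots>, n - 1\<close> is represented by its symmetric edge relation.
\<close>

definition sample_graph :: "nat \<Rightarrow> 'v rel \<Rightarrow> (nat \<Rightarrow> 'v) \<Rightarrow> nat rel" where
  "sample_graph n E s = {(i, j). i < n \<and> j < n \<and> i \<noteq> j \<and> (s i, s j) \<in> E}"

definition random_restriction :: "nat \<Rightarrow> 'v rel \<Rightarrow> 'v measure \<Rightarrow> nat rel measure" where
  "random_restriction n E \<rho> =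
     distr (\<Pi>\<^sub>M i\<in>{..<n}. \<rho>) (count_space (Pow ({..<n} \<times> {..<n}))) (sample_graph n E)"

definition adj_mat :: "nat \<Rightarrow> nat rel \<Rightarrow> real mat" where
  "adj_mat n G = mat n n (\<lambda>(i, j). if (i, j) \<in> G then 1 else 0)"

text \<open>
  Since \<open>0 powr a = 0\<close>, isolated vertices give zero rows and columns of the normalized
  adjacency matrix.
\<close>

definition inv_sqrt_deg_mat :: "nat \<Rightarrow> nat rel \<Rightarrow> real mat" where
  "inv_sqrt_deg_mat n G = mat_diag n (\<lambda>i. real (card (G `` {i})) powr (- 1 / 2))"

definition normalized_adj_mat :: "nat \<Rightarrow> nat rel \<Rightarrow> real mat" where
  "normalized_adj_mat n G = inv_sqrt_deg_mat n G * adj_mat n G * inv_sqrt_deg_mat n G"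

text \<open>
  The \<open>k\<close>-th largest eigenvalue, counted from \<open>k = 1\<close> and with multiplicity. It is meant for
  symmetric matrices, whose characteristic polynomial splits over the reals.
\<close>

definition nth_eigenvalue :: "real mat \<Rightarrow> nat \<Rightarrow> real" where
  "nth_eigenvalue A k = rev (sorted_list_of_multiset (proots (char_poly A))) ! (k - 1)"

text \<open>The walk and the random restriction are well defined.\<close>

lemma (in measured_graph) walk_kernel_measurable:
  "walk_kernel M E \<in> M \<rightarrow>\<^sub>M prob_algebra M"
proof (rule measurable_prob_algebraI)
  have nb: "E `` {x} = Pair x -` E" for x by auto
  have nbs: "E `` {x} \<in> sets M" for x
    unfolding nb by (rule sets_Pair1[OF E_sets])
  show P: "prob_space (walk_kernel M E x)" if "x \<in> space M" for x
    unfolding walk_kernel_def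
    using degree_pos[OF that] degree_finite[OF that] by (intro prob_space_uniform_measure) auto
  show "walk_kernel M E \<in> M \<rightarrow>\<^sub>M subprob_algebra M"
  proof (rule measurable_subprob_algebra)
    show "subprob_space (walk_kernel M E x)" if "x \<in> space M" for x
      using P[OF that] by (rule prob_space_imp_subprob_space)
    show "sets (walk_kernel M E x) = sets M" for x
      by (simp add: walk_kernel_def)
    fix A assume A: "A \<in> sets M"
    have eq: "emeasure (walk_kernel M E x) A =
        emeasure M (Pair x -` (E \<inter> (space M \<times> A))) / emeasure M (Pair x -` E)"
      if "x \<in> space M" for x
    proof -
      have "E `` {x} \<inter> A = Pair x -` (E \<inter> (space M \<times> A))" using that by auto
      then show ?thesis
        unfolding walk_kernel_def using emeasure_uniform_measure[OF nbs A] by (simp add: nb)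
    qed
    have "E \<inter> (space M \<times> A) \<in> sets (M \<Otimes>\<^sub>M M)" using E_sets A by auto
    from measurable_emeasure_Pair[OF this] measurable_emeasure_Pair[OF E_sets]
    have "(\<lambda>x. emeasure M (Pair x -` (E \<inter> (space M \<times> A))) / emeasure M (Pair x -` E))
        \<in> borel_measurable M"
      by (rule borel_measurable_divide_ennreal)
    then show "(\<lambda>x. emeasure (walk_kernel M E x) A) \<in> borel_measurable M"
      using eq by (subst measurable_cong) auto
  qed
qed

lemma (in measured_graph) walk_in_prob_algebra:
  assumes "\<alpha> \<in> space (prob_algebra M)"
  shows "walk M E \<alpha> \<in> space (prob_algebra M)"
proof -
  have s: "sets \<alpha> = sets M" and p: "prob_space \<alpha>"
    using assms by (auto simp: space_prob_algebra)
  have k: "walk_kernel M E \<in> \<alpha> \<rightarrow>\<^sub>M prob_algebra M"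
    using walk_kernel_measurable measurable_cong_sets[OF s refl] by blast
  have k': "walk_kernel M E \<in> \<alpha> \<rightarrow>\<^sub>M subprob_algebra M"
    by (rule measurable_prob_algebraD[OF k])
  have "prob_space (walk M E \<alpha>)"
    unfolding walk_def
    by (rule prob_space.prob_space_bind[OF p _ k'])
       (use measurable_space[OF k] in \<open>auto simp: space_prob_algebra\<close>)
  moreover have "sets (walk M E \<alpha>) = sets M"
    unfolding walk_def by (rule sets_bind[OF sets_kernel[OF k'] prob_space.not_empty[OF p]])
  ultimately show ?thesis by (simp add: space_prob_algebra)
qed

lemma (in measured_graph) prob_space_random_restriction:
  assumes "\<rho> \<in> space (prob_algebra M)"
  shows "prob_space (random_restriction n E \<rho>)"
proof -
  have s: "sets \<rho> = sets M" and p: "prob_space \<rho>"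
    using assms by (auto simp: space_prob_algebra)
  interpret P: product_prob_space "\<lambda>_. \<rho>" "{..<n}" by (simp add: p product_prob_spaceI)
  have E: "E \<in> sets (\<rho> \<Otimes>\<^sub>M \<rho>)"
    using E_sets by (simp add: sets_pair_measure_cong[OF s s])
  have pair: "{s \<in> space (\<Pi>\<^sub>M i\<in>{..<n}. \<rho>). (s i, s j) \<in> E} \<in> sets (\<Pi>\<^sub>M i\<in>{..<n}. \<rho>)"
    if "i < n" "j < n" for i j
  proof -
    have "(\<lambda>s. (s i, s j)) \<in> (\<Pi>\<^sub>M i\<in>{..<n}. \<rho>) \<rightarrow>\<^sub>M \<rho> \<Otimes>\<^sub>M \<rho>"
      using that by (intro measurable_Pair measurable_component_singleton) auto
    from measurable_sets[OF this E] show ?thesis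
      by (simp add: vimage_def Int_def conj_commute)
  qed
  have "sample_graph n E \<in> (\<Pi>\<^sub>M i\<in>{..<n}. \<rho>) \<rightarrow>\<^sub>M count_space (Pow ({..<n} \<times> {..<n}))"
  proof (subst measurable_count_space_eq2, simp, intro conjI ballI)
    show "sample_graph n E \<in> space (\<Pi>\<^sub>M i\<in>{..<n}. \<rho>) \<rightarrow> Pow ({..<n} \<times> {..<n})"
      by (auto simp: sample_graph_def)
    fix G :: "nat rel" assume G: "G \<in> Pow ({..<n} \<times> {..<n})"
    let ?S = "\<lambda>i j. {s \<in> space (\<Pi>\<^sub>M i\<in>{..<n}. \<rho>). (i, j) \<in> sample_graph n E s \<longleftrightarrow> (i, j) \<in> G}"
    have "?S i j \<in> sets (\<Pi>\<^sub>M i\<in>{..<n}. \<rho>)" if ij: "i < n" "j < n" for i j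
    proof -
      have "{s \<in> space (\<Pi>\<^sub>M i\<in>{..<n}. \<rho>). (i \<noteq> j \<and> (s i, s j) \<in> E) \<longleftrightarrow> (i, j) \<in> G}
          \<in> sets (\<Pi>\<^sub>M i\<in>{..<n}. \<rho>)"
        using pair[OF ij] by measurable
      moreover have "(i, j) \<in> sample_graph n E s \<longleftrightarrow> i \<noteq> j \<and> (s i, s j) \<in> E" for s
        using ij by (simp add: sample_graph_def)
      ultimately show ?thesis by (simp only:)
    qed
    then have "{s \<in> space (\<Pi>\<^sub>M i\<in>{..<n}. \<rho>). \<forall>i\<in>{..<n}. \<forall>j\<in>{..<n}.
        (i, j) \<in> sample_graph n E s \<longleftrightarrow> (i, j) \<in> G} \<in> sets (\<Pi>\<^sub>M i\<in>{..<n}. \<rho>)"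
      by (intro sets.sets_Collect_finite_All finite_lessThan) (simp only: lessThan_iff)
    also have "{s \<in> space (\<Pi>\<^sub>M i\<in>{..<n}. \<rho>). \<forall>i\<in>{..<n}. \<forall>j\<in>{..<n}.
        (i, j) \<in> sample_graph n E s \<longleftrightarrow> (i, j) \<in> G}
        = sample_graph n E -` {G} \<inter> space (\<Pi>\<^sub>M i\<in>{..<n}. \<rho>)"
    proof -
      have "H = G \<longleftrightarrow> (\<forall>i\<in>{..<n}. \<forall>j\<in>{..<n}. (i, j) \<in> H \<longleftrightarrow> (i, j) \<in> G)"
        if H: "H \<subseteq> {..<n} \<times> {..<n}" for H
      proof
        assume *: "\<forall>i\<in>{..<n}. \<forall>j\<in>{..<n}. (i, j) \<in> H \<longleftrightarrow> (i, j) \<in> G"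
        show "H = G"
        proof (intro equalityI subsetI)
          fix e assume "e \<in> H" with * H show "e \<in> G" by (cases e) fastforce
        next
          fix e assume "e \<in> G" with * G show "e \<in> H" by (cases e) fastforce
        qed
      qed simp
      moreover have "sample_graph n E s \<subseteq> {..<n} \<times> {..<n}" for s
        by (auto simp: sample_graph_def)
      ultimately have "sample_graph n E s = G \<longleftrightarrow>
          (\<forall>i\<in>{..<n}. \<forall>j\<in>{..<n}. (i, j) \<in> sample_graph n E s \<longleftrightarrow> (i, j) \<in> G)" for s
        by blast
      then show ?thesis by blast
    qed
    finally show "sample_graph n E -` {G} \<inter> space (\<Pi>\<^sub>M i\<in>{..<n}. \<rho>) \<in> sets (\<Pi>\<^sub>M i\<in>{..<n}. \<rho>)" .
  qed
  then show ?thesis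
    unfolding random_restriction_def by (rule P.prob_space_distr)
qed

end

theory Submission
  imports Defs "HOL-Real_Asymp.Real_Asymp"
begin

text \<open>
  By transitivity and uniqueness, \<open>\<rho>\<close> is a multiple of the volume and every neighbourhood has
  \<open>\<rho>\<close>-measure \<open>p\<close>. With \<open>K = 1\<^sub>E / p - 1\<close>, the decay in total variation gives
  \<open>\<parallel>K\<parallel> \<le> \<lambda>\<close> on the span of the functions \<open>K(s, -)\<close> in \<open>L\<^sup>2(\<rho>)\<close>, the constant \<open>C\<close> being lost in
  a limit of powers.

  Let \<open>N = (K(s\<^sub>i, s\<^sub>j))\<close> off the diagonal, and let \<open>G = (K\<^sup>2(s\<^sub>i, s\<^sub>j))\<close>, the Gram matrix of the
  functions \<open>K(s\<^sub>i, -)\<close>. Write \<open>'\<close> for the removal of the index \<open>i\<close> and \<open>v\<close> for the \<open>i\<close>-th column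
  of \<open>N\<close>. Closed walks at \<open>i\<close> decompose by their returns into factors \<open>f\<^sub>j = v\<^sup>T N'\<^sup>j v\<close>, and
  log-convexity merges a product of these factors into \<open>f\<^sub>0\<^sup>r\<close> times a single \<open>f\<^sub>j\<close>. Since \<open>N'\<close> does not
  depend on \<open>s\<^sub>i\<close>, averaging over \<open>s\<^sub>i\<close> turns \<open>f\<^sub>2\<^sub>j\<close> into \<open>tr (N'\<^sup>2\<^sup>j G') \<le> \<parallel>G'\<parallel> tr N'\<^sup>2\<^sup>j\<close>. This is a
  recursion for \<open>E tr N\<^sup>2\<^sup>k\<close> giving \<open>\<parallel>N\<parallel>\<^sup>2 \<lesssim> n \<parallel>G\<parallel>\<close> up to lower order terms, and the same
  argument for \<open>G\<close> gives \<open>\<parallel>G\<parallel> \<lesssim> n \<lambda>\<^sup>2\<close>. Concentration of the degrees transfers the bound on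
  \<open>\<parallel>N\<parallel> / n\<close> to the normalized adjacency matrix.
\<close>

section \<open>Log-convex sequences and first-return decompositions\<close>

text \<open>Two obstacles shape the argument. The recursion must close on itself: deleting an index
  leaves a trace over \<open>S - {i}\<close>, so every bound is proved for all subsets of the sample
  at once. Moreover, the bound on \<open>G\<close> holds only with high probability, and restricting
  to an event must not tie \<open>N'\<close> to the resampled point; hence the event for
  \<open>S\<close> is relaxed to the event for \<open>S - {i}\<close>, which ignores
  \<open>s_i\<close>. The constants come from one trade-off. A return costs a row norm
  \<open>R\<close>, and allowing for any number of returns in a walk of length \<open>m\<close>
  costs a factor \<open>exp (m R / y)\<close>, which is at most \<open>exp \<delta>\<close> once
  \<open>y\<close> is at least \<open>m R / \<delta>\<close>. Markov's inequality spends another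
  \<open>exp \<delta>\<close> to leave a failure probability of \<open>n exp (- k \<delta>)\<close>.
  With \<open>\<delta> = 1 / ln n\<close> the losses are \<open>1 + o(1)\<close>, with
  \<open>k\<close> about \<open>ln^3 n\<close> the failure is below any power of
  \<open>1 / n\<close>, and the price \<open>k / \<delta>\<close>, about \<open>ln^4 n\<close>,
  stands over \<open>p n\<close> under a square root, within the allowed
  \<open>ln^4 n / sqrt (p n)\<close>.\<close>

definition log_convex :: "(nat \<Rightarrow> real) \<Rightarrow> bool" where
  "log_convex f \<longleftrightarrow> (\<forall>k. 0 \<le> f k) \<and> (\<forall>k. (f (Suc k))\<^sup>2 \<le> f k * f (Suc (Suc k)))"

text \<open>Consecutive ratios increase; the cross-multiplied form admits zeros. A zero at
  \<open>b\<close> forces one at \<open>Suc b\<close>, which settles the degenerate step.\<close>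

lemma log_convex_shift:
  assumes "log_convex f" "a \<le> b"
  shows "f (Suc a) * f b \<le> f a * f (Suc b)"
  using assms(2)
proof (induction b rule: dec_induct)
  case base
  then show ?case by (simp add: mult.commute)
next
  case (step b)
  have nn: "\<And>k. 0 \<le> f k" and lc: "(f (Suc b))\<^sup>2 \<le> f b * f (Suc (Suc b))"
    using assms(1) by (auto simp: log_convex_def)
  show ?case
  proof (cases "f b = 0")
    case True
    then have "f (Suc b) = 0" using lc by simp
    then show ?thesis by (simp add: nn)
  next
    case False
    have "f b * (f (Suc a) * f (Suc b)) = (f (Suc a) * f b) * f (Suc b)" by simp
    also have "\<dots> \<le> (f a * f (Suc b)) * f (Suc b)"
      using step.IH nn by (intro mult_right_mono) auto
    also have "\<dots> = f a * (f (Suc b))\<^sup>2" by (simp add: power2_eq_square)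
    also have "\<dots> \<le> f a * (f b * f (Suc (Suc b)))" using lc nn by (intro mult_left_mono) auto
    also have "\<dots> = f b * (f a * f (Suc (Suc b)))" by simp
    finally show ?thesis
      using False nn[of b] by (simp add: mult_le_cancel_left)
  qed
qed

text \<open>Shifting units from the smaller index to the larger never decreases the product. This is
  what merges the factors of several returns into one.\<close>

lemma log_convex_mult:
  assumes f: "log_convex f"
  shows "f a * f b \<le> f 0 * f (a + b)"
proof -
  have *: "f a * f b \<le> f 0 * f (a + b)" if "a \<le> b" for a b
    using that
  proof (induction a arbitrary: b)
    case (Suc a)
    have "f (Suc a) * f b \<le> f a * f (Suc b)" using log_convex_shift[OF f] Suc.prems by simp
    also have "\<dots> \<le> f 0 * f (a + Suc b)" using Suc.prems by (intro Suc.IH) simp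
    finally show ?case by simp
  qed simp
  show ?thesis
    using *[of a b] *[of b a] by (cases "a \<le> b") (auto simp: ac_simps)
qed

text \<open>Convexity of \<open>ln f\<close> at the points 0, 1 and \<open>Suc k\<close>, without
  logarithms.\<close>

lemma log_convex_power:
  assumes f: "log_convex f"
  shows "f 1 ^ Suc k \<le> f 0 ^ k * f (Suc k)"
proof (induction k)
  case (Suc k)
  have nn: "\<And>k. 0 \<le> f k" using f by (auto simp: log_convex_def)
  have "f 1 ^ Suc (Suc k) = f 1 ^ Suc k * f 1" by simp
  also have "\<dots> \<le> f 0 ^ k * f (Suc k) * f 1" using Suc nn by (intro mult_right_mono) auto
  also have "\<dots> = f 0 ^ k * (f (Suc k) * f 1)" by simp
  also have "\<dots> \<le> f 0 ^ k * (f 0 * f (Suc k + 1))"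
    using log_convex_mult[OF f, of "Suc k" 1] nn by (intro mult_left_mono) auto
  finally show ?case by (simp add: mult_ac)
qed simp

text \<open>The first ratio is the smallest one, so if it exceeded \<open>r\<close>, the sequence
  would outgrow \<open>B * r ^ k\<close> for every \<open>B\<close>. This is how multiplicative
  constants disappear.\<close>

lemma log_convex_growth:
  assumes f: "log_convex f" and r: "0 \<le> r" and bd: "\<And>k. f k \<le> B * r ^ k"
  shows "f 1 \<le> r * f 0"
proof (rule ccontr)
  assume "\<not> f 1 \<le> r * f 0"
  then have gt: "r * f 0 < f 1" by simp
  have nn: "\<And>k. 0 \<le> f k" using f by (auto simp: log_convex_def)
  have f0: "f 0 > 0"
  proof (rule ccontr)
    assume "\<not> f 0 > 0"
    then have "f 0 = 0" using nn[of 0] by simp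
    moreover have "(f 1)\<^sup>2 \<le> f 0 * f 2"
      using f by (simp add: log_convex_def numeral_2_eq_2)
    ultimately show False using gt by simp
  qed
  have rpos: "r > 0"
  proof (rule ccontr)
    assume "\<not> r > 0"
    then have "r = 0" using r by simp
    then show False using bd[of 1] gt by simp
  qed
  define s where "s = f 1 / (r * f 0)"
  have "s > 1" using gt f0 rpos by (simp add: s_def)
  have "s ^ Suc k \<le> B / f 0" for k
  proof -
    have "f 1 ^ Suc k \<le> f 0 ^ k * (B * r ^ Suc k)"
      using log_convex_power[OF f, of k] bd[of "Suc k"] f0
      by (meson mult_left_mono order_trans zero_le_power less_imp_le)
    then show ?thesis
      using f0 rpos by (simp add: s_def power_divide power_mult_distrib field_simps)
  qed
  moreover obtain k where "B / f 0 < s ^ k" using real_arch_pow[OF \<open>s > 1\<close>] by blast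
  moreover have "s ^ k \<le> s ^ Suc k" using \<open>s > 1\<close> by (intro power_increasing) auto
  ultimately show False by (meson less_le_trans not_less)
qed

text \<open>Discrete form of the integral of \<open>x^r\<close> over \<open>[0, k]\<close>; it turns
  \<open>1 / fact r\<close> into \<open>1 / fact (Suc r)\<close> in the induction below.\<close>

lemma sum_power_le: "real (Suc r) * (\<Sum>j<k. real j ^ r) \<le> real k ^ Suc r"
proof (induction k)
  case (Suc k)
  have *: "real k ^ Suc r + real (Suc r) * real k ^ r \<le> real (Suc k) ^ Suc r"
  proof (induction r)
    case (Suc r)
    have "real k ^ Suc (Suc r) + real (Suc (Suc r)) * real k ^ Suc r
      \<le> real (Suc k) * (real k ^ Suc r + real (Suc r) * real k ^ r)"
      by (simp add: algebra_simps)
    also have "\<dots> \<le> real (Suc k) * real (Suc k) ^ Suc r" using Suc by (intro mult_left_mono) auto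
    finally show ?case by simp
  qed simp
  then show ?case using Suc by (simp add: algebra_simps)
qed simp

text \<open>Unrolling the recursion gives a sum over compositions of \<open>k\<close> into
  \<open>r + 1\<close> return lengths, each at least \<open>d\<close>. There are at most
  \<open>k^r / r!\<close> of them, and log-convexity bounds each product by \<open>F 0 ^ r\<close>
  times one value of \<open>F\<close>. Matrices with a diagonal need \<open>d = 1\<close>, those
  without loops allow \<open>d = 2\<close>.\<close>

lemma renewal_bound:
  fixes c F :: "nat \<Rightarrow> real"
  assumes F: "log_convex F" and d: "1 \<le> d" and c0: "c 0 = 1"
    and c: "\<And>k. 1 \<le> k \<Longrightarrow> \<bar>c k\<bar> \<le> (\<Sum>l\<in>{d..k}. F (l - d) * \<bar>c (k - l)\<bar>)"
    and "1 \<le> k"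
  shows "\<bar>c k\<bar> \<le> (\<Sum>r<k. real k ^ r / fact r * F 0 ^ r * (if d * Suc r \<le> k then F (k - d * Suc r) else 0))"
  using \<open>1 \<le> k\<close>
proof (induction k rule: less_induct)
  case (less k)
  define G where "G k r = (if d * Suc r \<le> k then F (k - d * Suc r) else 0)" for k r
  have nn: "\<And>k. 0 \<le> F k" using F by (auto simp: log_convex_def)
  have Gnn: "0 \<le> G k r" for k r by (simp add: G_def nn)
  have IH: "\<bar>c j\<bar> \<le> (\<Sum>r<j. real j ^ r / fact r * F 0 ^ r * G j r)" if "j < k" "1 \<le> j" for j
    using less.IH[OF that] by (simp add: G_def)
  have FG: "F (l - d) * G (k - l) r \<le> F 0 * G k (Suc r)" if "l \<in> {d..<k}" for l r
  proof (cases "d * Suc r \<le> k - l")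
    case True
    have "l - d + (k - l - d * Suc r) = k - d * Suc (Suc r)" and "d * Suc (Suc r) \<le> k"
      using True that d by (auto simp: algebra_simps)
    then show ?thesis
      using True log_convex_mult[OF F, of "l - d" "k - l - d * Suc r"] by (simp add: G_def)
  next
    case False
    then show ?thesis by (simp add: G_def nn)
  qed
  \<comment> \<open>The summand \<open>l = k\<close> is a single return and becomes the term
    \<open>r = 0\<close>; all others raise \<open>r\<close> by one.\<close>
  have split: "{d..k} = (if d \<le> k then insert k {d..<k} else {d..<k})" by auto
  have "\<bar>c k\<bar> \<le> (\<Sum>l\<in>{d..k}. F (l - d) * \<bar>c (k - l)\<bar>)" using c less.prems by simp
  also have "\<dots> = G k 0 + (\<Sum>l\<in>{d..<k}. F (l - d) * \<bar>c (k - l)\<bar>)"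
    unfolding split by (auto simp: G_def c0)
  also have "(\<Sum>l\<in>{d..<k}. F (l - d) * \<bar>c (k - l)\<bar>)
      \<le> (\<Sum>l\<in>{d..<k}. \<Sum>r<k-1. real (k - l) ^ r / fact r * F 0 ^ Suc r * G k (Suc r))"
  proof (rule sum_mono)
    fix l assume l: "l \<in> {d..<k}"
    then have l': "k - l < k" "1 \<le> k - l" using d by auto
    have "F (l - d) * \<bar>c (k - l)\<bar>
        \<le> F (l - d) * (\<Sum>r<k-l. real (k - l) ^ r / fact r * F 0 ^ r * G (k - l) r)"
      using IH[OF l'] nn by (intro mult_left_mono) auto
    also have "\<dots> = (\<Sum>r<k-l. (real (k - l) ^ r / fact r * F 0 ^ r) * (F (l - d) * G (k - l) r))"
      by (simp add: sum_distrib_left mult_ac)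
    also have "\<dots> \<le> (\<Sum>r<k-l. (real (k - l) ^ r / fact r * F 0 ^ r) * (F 0 * G k (Suc r)))"
      using FG[OF l] nn by (intro sum_mono mult_left_mono) auto
    also have "\<dots> \<le> (\<Sum>r<k-1. (real (k - l) ^ r / fact r * F 0 ^ r) * (F 0 * G k (Suc r)))"
      using l d nn Gnn by (intro sum_mono2) auto
    finally show "F (l - d) * \<bar>c (k - l)\<bar>
        \<le> (\<Sum>r<k-1. real (k - l) ^ r / fact r * F 0 ^ Suc r * G k (Suc r))"
      by (simp add: mult_ac)
  qed
  also have "\<dots> = (\<Sum>r<k-1. F 0 ^ Suc r * G k (Suc r) * ((\<Sum>l\<in>{d..<k}. real (k - l) ^ r) / fact r))"
    by (subst sum.swap) (simp add: sum_distrib_left sum_divide_distrib mult_ac)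
  also have "\<dots> \<le> (\<Sum>r<k-1. F 0 ^ Suc r * G k (Suc r) * (real k ^ Suc r / fact (Suc r)))"
  proof (intro sum_mono mult_left_mono)
    fix r
    have "(\<Sum>l\<in>{d..<k}. real (k - l) ^ r) \<le> (\<Sum>l\<in>{1..k}. real (k - l) ^ r)"
      using d by (intro sum_mono2) auto
    also have "\<dots> = (\<Sum>j<k. real j ^ r)"
      by (rule sum.reindex_bij_witness[where i="\<lambda>j. k - j" and j="\<lambda>l. k - l"]) auto
    finally have "real (Suc r) * (\<Sum>l\<in>{d..<k}. real (k - l) ^ r) \<le> real k ^ Suc r"
      using sum_power_le[of r k] by (meson mult_left_mono of_nat_0_le_iff order_trans)
    then show "(\<Sum>l\<in>{d..<k}. real (k - l) ^ r) / fact r \<le> real k ^ Suc r / fact (Suc r)"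
      by (simp only: fact_Suc of_nat_mult) (simp add: divide_simps mult_ac)
  qed (use nn Gnn in auto)
  also have "G k 0 + \<dots> = (\<Sum>r<Suc (k - 1). real k ^ r / fact r * F 0 ^ r * G k r)"
    unfolding sum.lessThan_Suc_shift by (simp add: mult_ac)
  finally show ?case using less.prems by (simp add: G_def)
qed

text \<open>The case \<open>c = 0\<close> is included, since a linear function bounded below is
  constant; so degenerate semidefinite forms are covered.\<close>

lemma quadratic_discriminant:
  fixes a b c :: real
  assumes "\<And>t. 0 \<le> a + 2 * b * t + c * t\<^sup>2"
  shows "b\<^sup>2 \<le> a * c"
proof (cases "c = 0")
  case True
  have "b = 0"
  proof (rule ccontr)
    assume "b \<noteq> 0"
    then show False using assms[of "- (a + 1) / (2 * b)"] True by (simp add: field_simps)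
  qed
  then show ?thesis using True by simp
next
  case False
  have "c > 0"
  proof (rule ccontr)
    assume "\<not> c > 0"
    then have "c < 0" using False by simp
    have "0 \<le> a + c * t\<^sup>2" for t using assms[of t] assms[of "- t"] by simp
    from this[of "sqrt ((a + 1) / (- c))"] this[of 0] show False using \<open>c < 0\<close>
      by (auto simp: field_simps)
  qed
  then show ?thesis using assms[of "- b / c"] by (simp add: field_simps power2_eq_square)
qed

section \<open>Finite real matrices as functions on an index set\<close>

definition ip :: "'i set \<Rightarrow> ('i \<Rightarrow> real) \<Rightarrow> ('i \<Rightarrow> real) \<Rightarrow> real" where
  "ip S x y = (\<Sum>a\<in>S. x a * y a)"

text \<open>Only the summation index is confined to \<open>S\<close>. The result also makes sense
  outside \<open>S\<close>, which lets walks through \<open>S - {i}\<close> begin at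
  \<open>i\<close>.\<close>

definition app :: "('i \<Rightarrow> 'i \<Rightarrow> real) \<Rightarrow> 'i set \<Rightarrow> ('i \<Rightarrow> real) \<Rightarrow> 'i \<Rightarrow> real" where
  "app A S x = (\<lambda>a. \<Sum>b\<in>S. A a b * x b)"

definition pw :: "('i \<Rightarrow> 'i \<Rightarrow> real) \<Rightarrow> 'i set \<Rightarrow> nat \<Rightarrow> 'i \<Rightarrow> 'i \<Rightarrow> real" where
  "pw A S k a b = (app A S ^^ k) (\<lambda>i. of_bool (i = b)) a"

definition tr :: "('i \<Rightarrow> 'i \<Rightarrow> real) \<Rightarrow> 'i set \<Rightarrow> nat \<Rightarrow> real" where
  "tr A S k = (\<Sum>a\<in>S. pw A S k a a)"

definition mom :: "('i \<Rightarrow> 'i \<Rightarrow> real) \<Rightarrow> 'i set \<Rightarrow> ('i \<Rightarrow> real) \<Rightarrow> nat \<Rightarrow> real" where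
  "mom A S x k = ip S x ((app A S ^^ k) x)"

definition psd :: "('i \<Rightarrow> 'i \<Rightarrow> real) \<Rightarrow> 'i set \<Rightarrow> bool" where
  "psd A S \<longleftrightarrow> (\<forall>x. 0 \<le> ip S x (app A S x))"

text \<open>A bound on the operator norm in squared form, free of suprema and roots.\<close>

definition norm_le :: "('i \<Rightarrow> 'i \<Rightarrow> real) \<Rightarrow> 'i set \<Rightarrow> real \<Rightarrow> bool" where
  "norm_le A S t \<longleftrightarrow> (\<forall>x. ip S (app A S x) (app A S x) \<le> t\<^sup>2 * ip S x x)"

lemma ip_commute: "ip S x y = ip S y x"
  by (simp add: ip_def mult.commute)

lemma ip_self_nonneg: "0 \<le> ip S x x"
  by (simp add: ip_def sum_nonneg)

lemma ip_CS: "(ip S x y)\<^sup>2 \<le> ip S x x * ip S y y"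
  by (rule quadratic_discriminant[THEN order_trans[rotated]]; (rule order_refl)?)
    (use ip_self_nonneg[of S "\<lambda>a. x a + _ * y a"] in
      \<open>simp add: ip_def algebra_simps power2_eq_square sum.distrib sum_distrib_left\<close>)

lemma ip_cong: "(\<And>a. a \<in> S \<Longrightarrow> x a = x' a) \<Longrightarrow> (\<And>a. a \<in> S \<Longrightarrow> y a = y' a) \<Longrightarrow> ip S x y = ip S x' y'"
  by (simp add: ip_def)

lemma ip_unit: "finite S \<Longrightarrow> i \<in> S \<Longrightarrow> ip S (\<lambda>a. of_bool (a = i)) y = y i"
  by (simp add: ip_def if_distrib[of "\<lambda>x. x * _"] of_bool_def cong: if_cong)

lemma ip_app: "ip S x (app A S y) = (\<Sum>a\<in>S. \<Sum>b\<in>S. A a b * (x a * y b))"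
  by (simp add: ip_def app_def sum_distrib_left mult_ac)

lemma ip_app_swap:
  assumes "\<And>a b. A a b = A b a"
  shows "ip S (app A S x) y = ip S x (app A S y)"
proof -
  have "ip S (app A S x) y = ip S y (app A S x)" by (rule ip_commute)
  also have "\<dots> = ip S x (app A S y)"
    unfolding ip_app by (subst sum.swap) (simp add: assms mult_ac)
  finally show ?thesis .
qed

lemma ip_funpow:
  assumes "\<And>a b. A a b = A b a"
  shows "ip S ((app A S ^^ j) x) ((app A S ^^ k) y) = ip S x ((app A S ^^ (j + k)) y)"
proof (induction j arbitrary: k)
  case (Suc j)
  have "ip S ((app A S ^^ Suc j) x) ((app A S ^^ k) y)
      = ip S ((app A S ^^ j) x) ((app A S ^^ Suc k) y)"
    by (simp add: ip_app_swap[of A, OF assms])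
  also have "\<dots> = ip S x ((app A S ^^ (j + Suc k)) y)" by (rule Suc)
  finally show ?case by simp
qed simp

lemma mom_add:
  assumes "\<And>a b. A a b = A b a"
  shows "mom A S x (j + k) = ip S ((app A S ^^ j) x) ((app A S ^^ k) x)"
  by (simp add: mom_def ip_funpow[of A, OF assms])

lemma mom_even_nonneg:
  assumes "\<And>a b. A a b = A b a"
  shows "0 \<le> mom A S x (2 * k)"
  using mom_add[of A S x k k, OF assms] ip_self_nonneg by (simp add: mult_2)

lemma mom_CS:
  assumes "\<And>a b. A a b = A b a"
  shows "(mom A S x (j + k))\<^sup>2 \<le> mom A S x (2 * j) * mom A S x (2 * k)"
  using ip_CS[of S "(app A S ^^ j) x" "(app A S ^^ k) x"] by (simp add: mom_add[of A, OF assms] mult_2)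

lemma log_convex_mom_even:
  assumes "\<And>a b. A a b = A b a"
  shows "log_convex (\<lambda>k. mom A S x (2 * k))"
  unfolding log_convex_def
proof (intro conjI allI)
  fix k
  show "(mom A S x (2 * Suc k))\<^sup>2 \<le> mom A S x (2 * k) * mom A S x (2 * Suc (Suc k))"
    using mom_CS[of A S x k "Suc (Suc k)", OF assms] by (simp add: mult_2)
qed (rule mom_even_nonneg[OF assms])

text \<open>Odd moments of an indefinite matrix can have any sign. Replacing them by geometric means
  of the neighbouring even moments gives a log-convex majorant of the whole sequence.\<close>

lemma log_convex_abs_mom:
  fixes A :: "'i \<Rightarrow> 'i \<Rightarrow> real" and S x
  assumes "\<And>a b. A a b = A b a"
  defines "F \<equiv> \<lambda>k. if even k then mom A S x k else sqrt (mom A S x (k - 1) * mom A S x (k + 1))"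
  shows "log_convex F" "\<bar>mom A S x k\<bar> \<le> F k"
proof -
  have nn: "0 \<le> mom A S x k" if "even k" for k
    using mom_even_nonneg[of A S x "k div 2", OF assms(1)] that by simp
  have Fnn: "0 \<le> F k" for k using nn by (auto simp: F_def)
  have 1: "(mom A S x (Suc k))\<^sup>2 \<le> mom A S x k * mom A S x (Suc (Suc k))" if "even k" for k
  proof -
    obtain j where "k = 2 * j" using \<open>even k\<close> by blast
    then show ?thesis using mom_CS[of A S x j "Suc j", OF assms(1)] by (simp add: mult_2)
  qed
  have 2: "(mom A S x (Suc (Suc k)))\<^sup>2 \<le> mom A S x k * mom A S x (Suc (Suc (Suc (Suc k))))" if "even k" for k
  proof -
    obtain j where "k = 2 * j" using \<open>even k\<close> by blast
    then show ?thesis using mom_CS[of A S x j "Suc (Suc j)", OF assms(1)] by (simp add: mult_2)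
  qed
  show "\<bar>mom A S x k\<bar> \<le> F k"
  proof (cases "even k")
    case False
    then obtain j where k: "k = Suc j" "even j" by (cases k) auto
    have "\<bar>mom A S x k\<bar> \<le> sqrt (mom A S x j * mom A S x (Suc (Suc j)))"
      using 1[OF k(2)] k by (intro real_le_rsqrt) auto
    then show ?thesis using k by (simp add: F_def)
  qed (simp add: F_def nn)
  have "(F (Suc k))\<^sup>2 \<le> F k * F (Suc (Suc k))" for k
  proof (cases "even k")
    case True
    then show ?thesis using nn[of k] nn[of "Suc (Suc k)"] by (simp add: F_def)
  next
    case False
    then obtain j where k: "k = Suc j" "even j" by (cases k) auto
    let ?m = "mom A S x"
    have n3: "0 \<le> ?m j" "0 \<le> ?m (Suc (Suc j))" "0 \<le> ?m (Suc (Suc (Suc (Suc j))))"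
      using nn k by auto
    have "(F (Suc k))\<^sup>2 = ?m (Suc (Suc j)) * ?m (Suc (Suc j))" using k by (simp add: F_def power2_eq_square)
    also have "\<dots> = ?m (Suc (Suc j)) * sqrt ((?m (Suc (Suc j)))\<^sup>2)" using n3 by simp
    also have "\<dots> \<le> ?m (Suc (Suc j)) * sqrt (?m j * ?m (Suc (Suc (Suc (Suc j)))))"
      using 2[OF k(2)] n3 by (intro mult_left_mono real_sqrt_le_mono) auto
    also have "\<dots> = sqrt (?m j) * sqrt (?m (Suc (Suc (Suc (Suc j))))) * (sqrt (?m (Suc (Suc j))) * sqrt (?m (Suc (Suc j))))"
      using n3 by (simp add: real_sqrt_mult)
    also have "\<dots> = F k * F (Suc (Suc k))" using k by (simp add: F_def real_sqrt_mult)
    finally show ?thesis .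
  qed
  then show "log_convex F" using Fnn by (simp add: log_convex_def)
qed

lemma psd_CS:
  assumes sym: "\<And>a b. A a b = A b a" and "psd A S"
  shows "(ip S x (app A S y))\<^sup>2 \<le> ip S x (app A S x) * ip S y (app A S y)"
proof (rule quadratic_discriminant)
  fix t
  have lin: "app A S (\<lambda>a. x a + t * y a) = (\<lambda>a. app A S x a + t * app A S y a)"
    by (auto simp: app_def algebra_simps sum.distrib sum_distrib_left)
  have "0 \<le> ip S (\<lambda>a. x a + t * y a) (app A S (\<lambda>a. x a + t * y a))"
    using assms by (simp add: psd_def)
  also have "\<dots> = ip S x (app A S x) + t * ip S x (app A S y) + t * ip S y (app A S x) + t\<^sup>2 * ip S y (app A S y)"
    unfolding lin by (simp add: ip_def algebra_simps sum.distrib sum_distrib_left power2_eq_square)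
  also have "ip S y (app A S x) = ip S x (app A S y)"
    using ip_app_swap[of A S x y, OF sym] by (simp add: ip_commute)
  finally show "0 \<le> ip S x (app A S x) + 2 * ip S x (app A S y) * t + ip S y (app A S y) * t\<^sup>2"
    by (simp add: algebra_simps)
qed

text \<open>For a semidefinite matrix the odd moments are values of its form at iterates of
  \<open>x\<close>, and Cauchy-Schwarz for that form supplies the inequalities centred at even
  moments.\<close>

lemma log_convex_mom_psd:
  assumes sym: "\<And>a b. A a b = A b a" and psd: "psd A S"
  shows "log_convex (mom A S x)"
proof -
  have e: "mom A S x (Suc (j + k)) = ip S ((app A S ^^ j) x) (app A S ((app A S ^^ k) x))" for j k
    using mom_add[of A S x j "Suc k", OF sym] by simp
  have "0 \<le> mom A S x k" for k
  proof (cases "even k")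
    case True
    then show ?thesis using mom_even_nonneg[of A S x "k div 2", OF sym] by simp
  next
    case False
    then obtain j where "k = Suc (j + j)" by (metis mult_2 oddE Suc_eq_plus1)
    then show ?thesis using psd by (simp only: e) (simp add: psd_def)
  qed
  moreover have "(mom A S x (Suc k))\<^sup>2 \<le> mom A S x k * mom A S x (Suc (Suc k))" for k
  proof (cases "even k")
    case True
    then obtain j where "k = 2 * j" by blast
    then show ?thesis using mom_CS[of A S x j "Suc j", OF sym] by (simp add: mult_2)
  next
    case False
    then obtain j where k: "k = Suc (j + j)" by (metis mult_2 oddE Suc_eq_plus1)
    have "Suc k = Suc (j + Suc j)" "Suc (Suc k) = Suc (Suc j + Suc j)" using k by auto
    then show ?thesis using k psd_CS[of A S, OF sym psd] by (simp only: e)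
  qed
  ultimately show ?thesis by (simp add: log_convex_def)
qed

section \<open>Closed walks decomposed by their returns\<close>

lemma app_remove:
  assumes "finite S" "i \<in> S"
  shows "app A S x a = A a i * x i + app A (S - {i}) x a"
  using assms by (simp add: app_def sum.remove)

text \<open>A walk from \<open>a\<close> to \<open>i\<close> is cut at its first arrival in
  \<open>i\<close> after the start, which happens at step \<open>l + 1\<close> with the
  \<open>l\<close> points in between in \<open>S - {i}\<close>. For \<open>a = i\<close> this is a
  renewal equation.\<close>

lemma first_return:
  assumes S: "finite S" "i \<in> S"
  shows "pw A S (Suc k) a i = (\<Sum>l\<le>k. (app A (S - {i}) ^^ l) (\<lambda>a. A a i) a * pw A S (k - l) i i)"
proof (induction k arbitrary: a)
  case 0
  have "app A (S - {i}) (\<lambda>j. of_bool (j = i)) a = 0" by (auto simp: app_def intro!: sum.neutral)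
  then show ?case using S by (simp add: pw_def app_remove)
next
  case (Suc k)
  let ?L = "app A (S - {i})" and ?v = "\<lambda>a. A a i"
  have "pw A S (Suc (Suc k)) a i = app A S (\<lambda>b. pw A S (Suc k) b i) a" by (simp add: pw_def)
  also have "\<dots> = A a i * pw A S (Suc k) i i + ?L (\<lambda>b. pw A S (Suc k) b i) a"
    using S by (rule app_remove)
  also have "?L (\<lambda>b. pw A S (Suc k) b i) a
      = (\<Sum>l\<le>k. (?L ^^ Suc l) ?v a * pw A S (k - l) i i)"
    unfolding Suc app_def
    by (simp add: app_def[abs_def] sum_distrib_left sum_distrib_right) (subst sum.swap, simp add: mult_ac)
  also have "A a i * pw A S (Suc k) i i + \<dots>
      = (\<Sum>l\<le>Suc k. (?L ^^ l) ?v a * pw A S (Suc k - l) i i)"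
    by (subst sum.atMost_Suc_shift) simp
  finally show ?case .
qed

text \<open>Extension by zero; it passes semidefiniteness and norm bounds on to principal
  submatrices.\<close>

lemma app_extend:
  assumes "finite S" "T \<subseteq> S"
  shows "app A S (\<lambda>a. if a \<in> T then x a else 0) = app A T x"
proof
  fix a
  have "app A S (\<lambda>a. if a \<in> T then x a else 0) a = (\<Sum>b\<in>S. if b \<in> T then A a b * x b else 0)"
    unfolding app_def by (intro sum.cong) auto
  also have "\<dots> = (\<Sum>b\<in>S \<inter> T. A a b * x b)" using assms by (simp add: sum.If_cases)
  finally show "app A S (\<lambda>a. if a \<in> T then x a else 0) a = app A T x a"
    using assms by (simp add: app_def Int_absorb1)
qed

lemma ip_extend:
  assumes "finite S" "T \<subseteq> S"
  shows "ip S (\<lambda>a. if a \<in> T then x a else 0) y = ip T x y"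
proof -
  have "ip S (\<lambda>a. if a \<in> T then x a else 0) y = (\<Sum>b\<in>S. if b \<in> T then x b * y b else 0)"
    unfolding ip_def by (intro sum.cong) auto
  also have "\<dots> = (\<Sum>b\<in>S \<inter> T. x b * y b)" using assms by (simp add: sum.If_cases)
  finally show ?thesis using assms by (simp add: ip_def Int_absorb1)
qed

lemma psd_subset:
  assumes "psd A S" "finite S" "T \<subseteq> S"
  shows "psd A T"
  unfolding psd_def
proof
  fix x :: "'a \<Rightarrow> real"
  have "0 \<le> ip S (\<lambda>a. if a \<in> T then x a else 0) (app A S (\<lambda>a. if a \<in> T then x a else 0))"
    using assms(1) by (simp add: psd_def)
  then show "0 \<le> ip T x (app A T x)"
    using assms by (simp add: app_extend ip_extend)
qed

lemma norm_le_subset: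
  assumes "norm_le A S t" "finite S" "T \<subseteq> S"
  shows "norm_le A T t"
  unfolding norm_le_def
proof
  fix x :: "'a \<Rightarrow> real"
  let ?y = "\<lambda>a. if a \<in> T then x a else 0"
  have "ip T (app A T x) (app A T x) \<le> ip S (app A T x) (app A T x)"
    unfolding ip_def using assms by (intro sum_mono2) auto
  also have "\<dots> = ip S (app A S ?y) (app A S ?y)" using assms by (simp add: app_extend)
  also have "\<dots> \<le> t\<^sup>2 * ip S ?y ?y" using assms(1) unfolding norm_le_def by blast
  also have "ip S ?y ?y = ip T x x"
    unfolding ip_extend[OF assms(2,3)] by (rule ip_cong) auto
  finally show "ip T (app A T x) (app A T x) \<le> t\<^sup>2 * ip T x x" .
qed

text \<open>A return of length 1 is the loop \<open>A i i\<close>, one of length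
  \<open>j + 2\<close> is the \<open>j\<close>-th moment of the column at \<open>i\<close>. Together
  they form one log-convex sequence, so \<open>renewal_bound\<close> applies with
  \<open>d = 1\<close>.\<close>

lemma pw_diag_psd_bound:
  fixes A :: "'i \<Rightarrow> 'i \<Rightarrow> real" and S i
  assumes sym: "\<And>a b. A a b = A b a" and psd: "psd A S" and S: "finite S" "i \<in> S"
  defines "f \<equiv> \<lambda>j. case j of 0 \<Rightarrow> A i i | Suc j \<Rightarrow> mom A (S - {i}) (A i) j"
  shows "pw A S (Suc k) i i \<le> (\<Sum>r\<le>k. real (Suc k) ^ r / fact r * A i i ^ r * f (k - r))"
proof -
  let ?T = "S - {i}" and ?v = "\<lambda>a. A a i"
  have v: "?v = A i" using sym by auto
  have psdT: "psd A ?T" using psd S by (rule_tac psd_subset) auto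
  have w: "(app A ?T ^^ l) ?v i = f l" for l
    by (cases l) (auto simp: f_def mom_def v app_def ip_def)
  have Aii: "0 \<le> A i i" 
    using psd[unfolded psd_def, rule_format, of "\<lambda>a. of_bool (a = i)"] S
    by (simp add: ip_unit) (simp add: app_def sum.remove[of S i] if_distrib of_bool_def cong: if_cong)
  have lcm: "log_convex (mom A ?T (A i))" by (rule log_convex_mom_psd[OF sym psdT])
  have unitS: "app A S (\<lambda>a. of_bool (a = i)) = A i"
    using S by (intro ext) (simp add: app_def sum.remove[of S i] of_bool_def if_distrib sym[of _ i] cong: if_cong)
  \<comment> \<open>The inequality where the loop meets the moments is Cauchy-Schwarz for the form
    of \<open>A\<close> on \<open>S\<close>, between the unit vector at \<open>i\<close> and the
    column extended by zero.\<close>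
  let ?y = "\<lambda>a. if a \<in> ?T then A i a else 0"
  have "(ip S (\<lambda>a. of_bool (a = i)) (app A S ?y))\<^sup>2
      \<le> ip S (\<lambda>a. of_bool (a = i)) (app A S (\<lambda>a. of_bool (a = i))) * ip S ?y (app A S ?y)"
    by (rule psd_CS[OF sym psd])
  moreover have "ip S (\<lambda>a. of_bool (a = i)) (app A S ?y) = mom A ?T (A i) 0"
    using S by (subst app_extend) (auto simp: ip_unit mom_def app_def ip_def)
  moreover have "ip S ?y (app A S ?y) = mom A ?T (A i) 1"
    using S by (subst app_extend, simp, blast, subst ip_extend) (auto simp: mom_def)
  ultimately have "(mom A ?T (A i) 0)\<^sup>2 \<le> A i i * mom A ?T (A i) 1"
    unfolding unitS by (simp add: ip_unit S)
  then have lc: "log_convex f"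
    using lcm Aii by (auto simp: log_convex_def f_def split: nat.split)
  define c where "c k = pw A S k i i" for k
  have c0: "c 0 = 1" by (simp add: c_def pw_def)
  have fnn: "0 \<le> f k" for k using lc by (simp add: log_convex_def)
  have rec: "\<bar>c k\<bar> \<le> (\<Sum>l\<in>{1..k}. f (l - 1) * \<bar>c (k - l)\<bar>)" if k: "1 \<le> k" for k
  proof -
    obtain m where m: "k = Suc m" using k by (cases k) auto
    have "c k = (\<Sum>l\<le>m. f l * c (m - l))"
      unfolding c_def m first_return[OF S] w ..
    then have "\<bar>c k\<bar> \<le> (\<Sum>l\<le>m. \<bar>f l * c (m - l)\<bar>)" by (simp add: sum_abs)
    also have "\<dots> = (\<Sum>l\<le>m. f l * \<bar>c (m - l)\<bar>)" by (simp add: abs_mult fnn)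
    also have "\<dots> = (\<Sum>l\<in>{1..k}. f (l - 1) * \<bar>c (k - l)\<bar>)"
      by (rule sum.reindex_bij_witness[where i="\<lambda>l. l - 1" and j=Suc]) (auto simp: m)
    finally show ?thesis .
  qed
  have f0: "f 0 = A i i" by (simp add: f_def)
  have "\<bar>c (Suc k)\<bar> \<le> (\<Sum>r<Suc k. real (Suc k) ^ r / fact r * f 0 ^ r
      * (if 1 * Suc r \<le> Suc k then f (Suc k - 1 * Suc r) else 0))"
    by (rule renewal_bound[where c=c and F=f, OF lc order_refl c0 rec]) auto
  also have "\<dots> = (\<Sum>r\<le>k. real (Suc k) ^ r / fact r * A i i ^ r * f (k - r))"
    by (intro sum.cong) (auto simp: f0)
  finally show ?thesis by (simp add: c_def)
qed

text \<open>Without a loop every return has length at least 2, so \<open>d = 2\<close>. As the total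
  power is even, the majorant is evaluated at even arguments only, where it is a genuine
  moment.\<close>

lemma pw_diag_even_bound:
  assumes sym: "\<And>a b. A a b = A b a" and S: "finite S" "i \<in> S" and Aii: "A i i = 0"
  shows "pw A S (2 * Suc k) i i
    \<le> (\<Sum>r\<le>k. (2 * real (Suc k)) ^ r / fact r * ip (S - {i}) (A i) (A i) ^ r * mom A (S - {i}) (A i) (2 * (k - r)))"
proof -
  let ?T = "S - {i}" and ?v = "\<lambda>a. A a i"
  have v: "?v = A i" using sym by auto
  define F where "F k = (if even k then mom A ?T (A i) k else sqrt (mom A ?T (A i) (k - 1) * mom A ?T (A i) (k + 1)))" for k
  have lc: "log_convex F" and Fge: "\<bar>mom A ?T (A i) k\<bar> \<le> F k" for k
    using log_convex_abs_mom[of A ?T "A i", OF sym] by (simp_all add: F_def[abs_def])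
  have w: "(app A ?T ^^ Suc l) ?v i = mom A ?T (A i) l" for l
    by (auto simp: mom_def v app_def ip_def)
  define c where "c k = pw A S k i i" for k
  have c0: "c 0 = 1" by (simp add: c_def pw_def)
  have rec: "\<bar>c k\<bar> \<le> (\<Sum>l\<in>{2..k}. F (l - 2) * \<bar>c (k - l)\<bar>)" if k: "1 \<le> k" for k
  proof -
    obtain m where m: "k = Suc m" using k by (cases k) auto
    have "c k = (\<Sum>l\<le>m. (app A ?T ^^ l) ?v i * c (m - l))"
      unfolding c_def m first_return[OF S] ..
    then have "\<bar>c k\<bar> \<le> (\<Sum>l\<le>m. \<bar>(app A ?T ^^ l) ?v i * c (m - l)\<bar>)" by (simp only: sum_abs)
    \<comment> \<open>The summand \<open>l = 0\<close> is the loop at \<open>i\<close>, which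
      vanishes.\<close>
    also have "\<dots> = (\<Sum>l\<in>{1..m}. \<bar>(app A ?T ^^ l) ?v i * c (m - l)\<bar>)"
      by (rule sum.mono_neutral_right) (auto simp: Aii not_less_eq_eq Suc_le_eq)
    also have "\<dots> = (\<Sum>l\<in>{2..k}. \<bar>(app A ?T ^^ (l - 1)) ?v i * c (k - l)\<bar>)"
      by (rule sum.reindex_bij_witness[where i="\<lambda>l. l - 1" and j=Suc]) (auto simp: m)
    also have "\<dots> \<le> (\<Sum>l\<in>{2..k}. F (l - 2) * \<bar>c (k - l)\<bar>)"
    proof (rule sum_mono)
      fix l assume "l \<in> {2..k}"
      then have "l - 1 = Suc (l - 2)" by auto
      then have "(app A ?T ^^ (l - 1)) ?v i = mom A ?T (A i) (l - 2)" using w[of "l - 2"] by simp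
      then show "\<bar>(app A ?T ^^ (l - 1)) ?v i * c (k - l)\<bar> \<le> F (l - 2) * \<bar>c (k - l)\<bar>"
        using Fge[of "l - 2"] by (simp add: abs_mult mult_right_mono)
    qed
    finally show ?thesis .
  qed
  let ?n = "2 * Suc k"
  have "\<bar>c ?n\<bar> \<le> (\<Sum>r<?n. real ?n ^ r / fact r * F 0 ^ r
      * (if 2 * Suc r \<le> ?n then F (?n - 2 * Suc r) else 0))"
    by (rule renewal_bound[where c=c and F=F, OF lc _ c0 rec]) auto
  also have "\<dots> = (\<Sum>r\<le>k. real ?n ^ r / fact r * F 0 ^ r
      * (if 2 * Suc r \<le> ?n then F (?n - 2 * Suc r) else 0))"
    by (rule sum.mono_neutral_right) auto
  also have "\<dots> = (\<Sum>r\<le>k. (2 * real (Suc k)) ^ r / fact r * ip ?T (A i) (A i) ^ r * mom A ?T (A i) (2 * (k - r)))"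
  proof (intro sum.cong refl)
    fix r assume r: "r \<in> {..k}"
    then have "?n - 2 * Suc r = 2 * (k - r)" by auto
    then show "real ?n ^ r / fact r * F 0 ^ r * (if 2 * Suc r \<le> ?n then F (?n - 2 * Suc r) else 0)
      = (2 * real (Suc k)) ^ r / fact r * ip ?T (A i) (A i) ^ r * mom A ?T (A i) (2 * (k - r))"
      using r by (simp add: F_def) (simp add: mom_def)
  qed
  finally show ?thesis by (simp add: c_def)
qed

section \<open>Positive semidefinite matrices, norms and traces\<close>

lemma app_apply: "app A S x a = (\<Sum>b\<in>S. A a b * x b)"
  by (simp add: app_def)

lemma funpow_app_eq_pw:
  assumes "a \<in> S" "finite S"
  shows "(app A S ^^ k) x a = app (pw A S k) S x a"
  using assms(1)
proof (induction k arbitrary: a)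
  case 0
  then show ?case using \<open>finite S\<close> by (simp add: app_def pw_def of_bool_def if_distribR if_distrib[of "\<lambda>y. y * _"] cong: if_cong)
next
  case (Suc k)
  have "(app A S ^^ Suc k) x a = (\<Sum>c\<in>S. A a c * (\<Sum>b\<in>S. pw A S k c b * x b))"
    by (simp add: app_apply[of A] Suc.IH app_apply[of "pw A S k"])
  also have "\<dots> = (\<Sum>b\<in>S. (\<Sum>c\<in>S. A a c * pw A S k c b) * x b)"
    unfolding sum_distrib_left sum_distrib_right by (subst sum.swap) (simp add: mult_ac)
  also have "\<dots> = app (pw A S (Suc k)) S x a"
    by (simp add: app_apply pw_def)
  finally show ?case .
qed

lemma mom_eq_pw:
  assumes "finite S"
  shows "mom A S x k = ip S x (app (pw A S k) S x)"
  unfolding mom_def using assms by (intro ip_cong) (simp_all add: funpow_app_eq_pw)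

lemma pw_commute:
  assumes sym: "\<And>a b. A a b = A b a" and S: "finite S" "a \<in> S" "b \<in> S"
  shows "pw A S k a b = pw A S k b a"
proof -
  have "pw A S k a b = ip S (\<lambda>i. of_bool (i = a)) ((app A S ^^ k) (\<lambda>i. of_bool (i = b)))"
    using S by (simp add: ip_unit pw_def)
  also have "\<dots> = ip S ((app A S ^^ k) (\<lambda>i. of_bool (i = a))) (\<lambda>i. of_bool (i = b))"
    using ip_funpow[of A S k "\<lambda>i. of_bool (i = a)" 0 "\<lambda>i. of_bool (i = b)", OF sym] by simp
  also have "\<dots> = pw A S k b a"
    using S by (subst ip_commute) (simp add: ip_unit pw_def)
  finally show ?thesis .
qed

lemma pw_diag_eq_mom:
  assumes "finite S" "i \<in> S"
  shows "pw A S k i i = mom A S (\<lambda>a. of_bool (a = i)) k"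
  using assms by (simp add: mom_def ip_unit pw_def)

lemma pw_even_diag_nonneg:
  assumes "\<And>a b. A a b = A b a" "finite S" "i \<in> S"
  shows "0 \<le> pw A S (2 * k) i i"
  using assms by (simp add: pw_diag_eq_mom mom_even_nonneg)

lemma tr_even_nonneg:
  assumes "\<And>a b. A a b = A b a" "finite S"
  shows "0 \<le> tr A S (2 * k)"
  unfolding tr_def using assms by (intro sum_nonneg pw_even_diag_nonneg)

lemma psd_pw_even:
  assumes "\<And>a b. A a b = A b a" "finite S"
  shows "psd (pw A S (2 * k)) S"
  unfolding psd_def using mom_even_nonneg[of A S _ k, OF assms(1)] assms(2) by (simp add: mom_eq_pw)

lemma psd_pw:
  assumes "\<And>a b. A a b = A b a" "finite S" "psd A S"
  shows "psd (pw A S k) S"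
  unfolding psd_def using log_convex_mom_psd[of A S, OF assms(1,3)] assms(2)
  by (simp add: mom_eq_pw log_convex_def)

lemma tr_Suc: "tr A S (Suc k) = (\<Sum>a\<in>S. \<Sum>b\<in>S. pw A S k b a * A a b)"
  by (simp add: tr_def pw_def app_apply mult_ac)

lemma ip_app_rank_one:
  "ip T x (app (\<lambda>a b. P a b - v a * v b / d) T x) = ip T x (app P T x) - (\<Sum>b\<in>T. v b * x b)\<^sup>2 / d"
proof -
  have "(\<Sum>b\<in>T. v b * x b)\<^sup>2 / d = (\<Sum>a\<in>T. \<Sum>b\<in>T. v a * v b / d * (x a * x b))"
    by (simp add: power2_eq_square sum_product sum_divide_distrib mult_ac)
  then show ?thesis
    by (simp add: ip_app left_diff_distrib sum_subtractf)
qed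

lemma ip_app_diff:
  "ip S x (app (\<lambda>a b. c * A a b - B a b) S y) = c * ip S x (app A S y) - ip S x (app B S y)"
  unfolding ip_app sum_distrib_left sum_subtractf[symmetric]
  by (intro sum.cong refl) (simp add: algebra_simps)

lemma ip_app_delta: "finite S \<Longrightarrow> ip S x (app (\<lambda>a b. of_bool (a = b)) S y) = ip S x y"
  unfolding ip_def app_def by (intro sum.cong refl) (simp add: of_bool_def if_distribR if_distrib[of "\<lambda>y. y * _"] cong: if_cong)

text \<open>One Cholesky step per index: \<open>P\<close> is a rank-one matrix plus a Schur
  complement \<open>Q\<close> that vanishes in row and column \<open>i\<close>. The rank-one part
  pairs with \<open>H\<close> to a value of its form, and \<open>Q\<close> lives on the smaller set.
  With a power for \<open>P\<close> and a difference of two forms for \<open>H\<close> this compares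
  traces.\<close>

lemma psd_hadamard_nonneg:
  assumes "finite S"
    and "\<And>a b. a \<in> S \<Longrightarrow> b \<in> S \<Longrightarrow> P a b = P b a" "psd P S" "psd H S"
  shows "0 \<le> (\<Sum>a\<in>S. \<Sum>b\<in>S. P a b * H a b)"
  using assms
proof (induction S arbitrary: P rule: finite_induct)
  case empty
  then show ?case by simp
next
  case (insert i S)
  let ?T = "insert i S"
  \<comment> \<open>Cut off outside the index set, because \<open>psd_CS\<close> asks for symmetry
    everywhere.\<close>
  define P0 where "P0 a b = (if a \<in> ?T \<and> b \<in> ?T then P a b else 0)" for a b
  have P0sym: "P0 a b = P0 b a" for a b using insert.prems(1) by (auto simp: P0_def)
  have "app P0 ?T x a = app P ?T x a" if "a \<in> ?T" for x a
    unfolding app_def by (intro sum.cong) (use that in \<open>auto simp: P0_def\<close>)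
  then have "ip ?T y (app P0 ?T x) = ip ?T y (app P ?T x)" for x y by (intro ip_cong) auto
  then have P0: "psd P0 ?T" using insert.prems(2) by (simp add: psd_def)
  have T: "finite ?T" "i \<in> ?T" using insert by auto
  define v where "v a = P0 a i" for a
  define Q where "Q a b = P0 a b - v a * v b / P0 i i" for a b
  have Qsym: "Q a b = Q b a" for a b by (simp add: Q_def P0sym[of a b] mult.commute)
  have unit: "ip ?T (\<lambda>a. of_bool (a = c)) (app P0 ?T (\<lambda>a. of_bool (a = d))) = P0 c d" if "c \<in> ?T" "d \<in> ?T" for c d
  proof -
    have "app P0 ?T (\<lambda>a. of_bool (a = d)) c = (\<Sum>b\<in>?T. if b = d then P0 c b else 0)"
      unfolding app_def by (intro sum.cong) auto
    then show ?thesis using that T by (simp add: ip_unit del: sum.insert)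
  qed
  have CS: "(ip ?T (\<lambda>a. of_bool (a = i)) (app P0 ?T x))\<^sup>2 \<le> P0 i i * ip ?T x (app P0 ?T x)" for x
    using psd_CS[of P0 ?T "\<lambda>a. of_bool (a = i)" x, OF P0sym P0] unit[OF T(2) T(2)] by simp
  have Pii: "0 \<le> P0 i i"
    using P0 unit[OF T(2) T(2)] unfolding psd_def by metis
  have Qi: "Q a i = 0" if "a \<in> ?T" for a
  proof (cases "P0 i i = 0")
    case True
    \<comment> \<open>At a zero pivot the quotient in \<open>Q\<close> is 0, so
      \<open>Q = P0\<close>; Cauchy-Schwarz then makes the whole column vanish.\<close>
    then have "(P0 i a)\<^sup>2 \<le> 0"
      using CS[of "\<lambda>b. of_bool (b = a)"] unit[OF T(2) that] by simp
    then have "P0 a i = 0" using P0sym[of a i] by simp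
    then show ?thesis by (simp add: Q_def True)
  qed (simp add: Q_def v_def)
  then have Qi': "Q i a = 0" if "a \<in> ?T" for a
    using that Qsym[of i a] by simp
  have v_app: "(\<Sum>b\<in>?T. v b * x b) = app P0 ?T x i" for x
    unfolding app_def v_def by (intro sum.cong refl) (use P0sym in auto)
  have "0 \<le> ip ?T x (app Q ?T x)" for x
  proof -
    have *: "ip ?T x (app Q ?T x) = ip ?T x (app P0 ?T x) - (app P0 ?T x i)\<^sup>2 / P0 i i"
      unfolding Q_def[abs_def] ip_app_rank_one v_app ..
    have "(app P0 ?T x i)\<^sup>2 \<le> P0 i i * ip ?T x (app P0 ?T x)"
      using CS[of x] T by (simp add: ip_unit del: sum.insert)
    moreover have "0 \<le> ip ?T x (app P0 ?T x)" using P0 by (simp add: psd_def)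
    ultimately show ?thesis
      unfolding * using Pii by (cases "P0 i i = 0") (auto simp: pos_divide_le_eq mult.commute)
  qed
  then have "psd Q ?T" by (simp add: psd_def)
  then have psdQ: "psd Q S" using T by (rule_tac psd_subset[of Q ?T]) auto
  have psdH: "psd H S" using insert.prems(3) T by (rule_tac psd_subset[of _ ?T]) auto
  have "(\<Sum>a\<in>?T. \<Sum>b\<in>?T. P a b * H a b) = (\<Sum>a\<in>?T. \<Sum>b\<in>?T. P0 a b * H a b)"
    by (intro sum.cong refl) (auto simp: P0_def)
  also have "\<dots> = (\<Sum>a\<in>?T. \<Sum>b\<in>?T. Q a b * H a b)
      + (\<Sum>a\<in>?T. \<Sum>b\<in>?T. H a b * (v a * v b)) / P0 i i"
    unfolding sum_divide_distrib sum.distrib[symmetric]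
    by (intro sum.cong refl) (simp add: Q_def left_diff_distrib)
  also have "(\<Sum>a\<in>?T. \<Sum>b\<in>?T. H a b * (v a * v b)) = ip ?T v (app H ?T v)"
    by (simp only: ip_app)
  also have "(\<Sum>a\<in>?T. \<Sum>b\<in>?T. Q a b * H a b) = (\<Sum>a\<in>S. \<Sum>b\<in>S. Q a b * H a b)"
    using insert.hyps Qi Qi' by simp
  finally have eq: "(\<Sum>a\<in>?T. \<Sum>b\<in>?T. P a b * H a b)
      = (\<Sum>a\<in>S. \<Sum>b\<in>S. Q a b * H a b) + ip ?T v (app H ?T v) / P0 i i" .
  have "0 \<le> ip ?T v (app H ?T v) / P0 i i"
    using insert.prems(3) Pii unfolding psd_def by (intro divide_nonneg_nonneg) auto
  moreover have "0 \<le> (\<Sum>a\<in>S. \<Sum>b\<in>S. Q a b * H a b)"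
    by (rule insert.IH[OF Qsym psdQ psdH])
  ultimately show ?case unfolding eq by (rule add_nonneg_nonneg[rotated])
qed

lemma log_convex_norm_sequence:
  assumes "\<And>a b. A a b = A b a"
  shows "log_convex (\<lambda>k. ip S ((app A S ^^ k) x) ((app A S ^^ k) x))"
  using log_convex_mom_even[of A S x, OF assms] by (simp add: mult_2 mom_add[of A, OF assms])

text \<open>Coordinatewise Cauchy-Schwarz against the \<open>k\<close>-th iterates of the unit
  vectors, whose squared norms are the diagonal entries of the power \<open>2 * k\<close>.\<close>

lemma norm_funpow_le_tr:
  assumes sym: "\<And>a b. A a b = A b a" and S: "finite S"
  shows "ip S ((app A S ^^ k) x) ((app A S ^^ k) x) \<le> ip S x x * tr A S (2 * k)"
proof -
  have "ip S ((app A S ^^ k) x) ((app A S ^^ k) x) = (\<Sum>a\<in>S. ((app A S ^^ k) x a)\<^sup>2)"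
    by (simp add: ip_def power2_eq_square)
  also have "\<dots> \<le> (\<Sum>a\<in>S. pw A S (2 * k) a a * ip S x x)"
  proof (rule sum_mono)
    fix a assume a: "a \<in> S"
    let ?e = "\<lambda>i. of_bool (i = a)"
    have "(app A S ^^ k) x a = ip S ((app A S ^^ k) ?e) x"
      using a S ip_funpow[of A S 0 ?e k x, OF sym] ip_funpow[of A S k ?e 0 x, OF sym] by (simp add: ip_unit)
    then have "((app A S ^^ k) x a)\<^sup>2 \<le> ip S ((app A S ^^ k) ?e) ((app A S ^^ k) ?e) * ip S x x"
      using ip_CS by metis
    then show "((app A S ^^ k) x a)\<^sup>2 \<le> pw A S (2 * k) a a * ip S x x"
      using a S by (simp add: pw_diag_eq_mom mult_2 mom_add[of A, OF sym])
  qed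
  also have "\<dots> = ip S x x * tr A S (2 * k)" by (simp add: tr_def sum_distrib_left mult.commute)
  finally show ?thesis .
qed

lemma norm_le_tr_even:
  assumes sym: "\<And>a b. A a b = A b a" and S: "finite S" and t: "norm_le A S t"
  shows "tr A S (2 * k) \<le> real (card S) * t ^ (2 * k)"
proof -
  have *: "ip S ((app A S ^^ k) x) ((app A S ^^ k) x) \<le> t ^ (2 * k) * ip S x x" for x
  proof (induction k)
    case (Suc k)
    have "ip S ((app A S ^^ Suc k) x) ((app A S ^^ Suc k) x)
        \<le> t\<^sup>2 * ip S ((app A S ^^ k) x) ((app A S ^^ k) x)"
      using t by (simp add: norm_le_def)
    also have "\<dots> \<le> t\<^sup>2 * (t ^ (2 * k) * ip S x x)" using Suc by (intro mult_left_mono) auto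
    finally show ?case by (simp add: power2_eq_square mult_ac)
  qed simp
  have "tr A S (2 * k) \<le> (\<Sum>a\<in>S. t ^ (2 * k))"
    unfolding tr_def
  proof (rule sum_mono)
    fix a assume a: "a \<in> S"
    then show "pw A S (2 * k) a a \<le> t ^ (2 * k)"
      using *[of "\<lambda>i. of_bool (i = a)"] S
      by (simp add: pw_diag_eq_mom mult_2 mom_add[of A, OF sym] ip_unit)
  qed
  then show ?thesis by simp
qed

text \<open>As all powers are available, \<open>log_convex_growth\<close> removes the factor
  \<open>n\<close>. Together with \<open>norm_le_tr_even\<close> this expresses the norm by
  countably many traces, which keeps events measurable.\<close>

lemma norm_le_if_tr:
  assumes sym: "\<And>a b. A a b = A b a" and S: "finite S" and n: "\<And>k. tr A S (2 * k) \<le> n * t ^ (2 * k)"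
  shows "norm_le A S t"
  unfolding norm_le_def
proof
  fix x :: "'a \<Rightarrow> real"
  have "ip S ((app A S ^^ 1) x) ((app A S ^^ 1) x) \<le> t\<^sup>2 * ip S ((app A S ^^ 0) x) ((app A S ^^ 0) x)"
  proof (rule log_convex_growth[OF log_convex_norm_sequence[OF sym]])
    fix k
    have "ip S ((app A S ^^ k) x) ((app A S ^^ k) x) \<le> ip S x x * tr A S (2 * k)"
      by (rule norm_funpow_le_tr[OF sym S])
    also have "\<dots> \<le> ip S x x * (n * t ^ (2 * k))" using n ip_self_nonneg by (intro mult_left_mono) auto
    finally show "ip S ((app A S ^^ k) x) ((app A S ^^ k) x) \<le> (ip S x x * n) * t\<^sup>2 ^ k"
      by (simp add: power_mult)
  qed simp
  then show "ip S (app A S x) (app A S x) \<le> t\<^sup>2 * ip S x x" by simp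
qed

text \<open>A single power suffices if no factor stands on the right. Markov's inequality yields
  such a bound, the dimension going into the failure probability.\<close>

lemma norm_le_if_tr_power:
  assumes sym: "\<And>a b. A a b = A b a" and S: "finite S" and t: "tr A S (2 * Suc k) \<le> t ^ (2 * Suc k)"
  shows "norm_le A S t"
  unfolding norm_le_def
proof
  fix x :: "'a \<Rightarrow> real"
  let ?x = "ip S x x"
  have "ip S (app A S x) (app A S x) ^ Suc k \<le> ?x ^ k * ip S ((app A S ^^ Suc k) x) ((app A S ^^ Suc k) x)"
    using log_convex_power[OF log_convex_norm_sequence[of A S x, OF sym], of k] by simp
  also have "\<dots> \<le> ?x ^ k * (?x * tr A S (2 * Suc k))"
    by (intro mult_left_mono norm_funpow_le_tr sym S zero_le_power ip_self_nonneg)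
  also have "\<dots> \<le> ?x ^ k * (?x * t ^ (2 * Suc k))"
    using t by (intro mult_left_mono zero_le_power ip_self_nonneg)
  also have "\<dots> = (t\<^sup>2 * ?x) ^ Suc k"
    by (simp only: power_mult power_mult_distrib) simp
  finally show "ip S (app A S x) (app A S x) \<le> t\<^sup>2 * ?x"
    by (rule power_le_imp_le_base) (simp add: ip_self_nonneg)
qed

lemma norm_le_quadratic:
  assumes "norm_le A S t" "0 \<le> t"
  shows "\<bar>ip S x (app A S x)\<bar> \<le> t * ip S x x"
proof -
  have "(ip S x (app A S x))\<^sup>2 \<le> ip S x x * ip S (app A S x) (app A S x)" by (rule ip_CS)
  also have "\<dots> \<le> ip S x x * (t\<^sup>2 * ip S x x)"
    using assms by (intro mult_left_mono) (auto simp: norm_le_def ip_self_nonneg)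
  also have "\<dots> = (t * ip S x x)\<^sup>2" by (simp add: power2_eq_square)
  finally show ?thesis
    using assms ip_self_nonneg[of S x] by (simp add: abs_le_square_iff[symmetric])
qed

section \<open>Averaging over one sample point\<close>

lemmas lint_cong = Bochner_Integration.integral_cong[OF refl]

text \<open>Bounded measurable functions form an algebra that is stable under integration in one
  variable, so on a probability space everything built from the kernel is integrable.\<close>

definition bm :: "'a measure \<Rightarrow> ('a \<Rightarrow> real) set" where
  "bm M = {f \<in> borel_measurable M. \<exists>B. \<forall>x\<in>space M. \<bar>f x\<bar> \<le> B}"

lemma bmI: "f \<in> borel_measurable M \<Longrightarrow> (\<And>x. x \<in> space M \<Longrightarrow> \<bar>f x\<bar> \<le> B) \<Longrightarrow> f \<in> bm M"
  by (auto simp: bm_def)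

lemma bm_measurable: "f \<in> bm M \<Longrightarrow> f \<in> borel_measurable M"
  by (simp add: bm_def)

lemma bmE:
  assumes "f \<in> bm M"
  obtains B where "0 \<le> B" "\<And>x. x \<in> space M \<Longrightarrow> \<bar>f x\<bar> \<le> B"
proof -
  obtain B where "\<forall>x\<in>space M. \<bar>f x\<bar> \<le> B" using assms by (auto simp: bm_def)
  then have "\<bar>f x\<bar> \<le> max 0 B" if "x \<in> space M" for x using that by fastforce
  then show ?thesis by (intro that[of "max 0 B"]) auto
qed

lemma bm_const [intro]: "(\<lambda>x. c) \<in> bm M"
  by (intro bmI[where B="\<bar>c\<bar>"]) auto

lemma bm_add [intro]: "f \<in> bm M \<Longrightarrow> g \<in> bm M \<Longrightarrow> (\<lambda>x. f x + g x) \<in> bm M"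
proof -
  assume f: "f \<in> bm M" and g: "g \<in> bm M"
  obtain B where B: "\<And>x. x \<in> space M \<Longrightarrow> \<bar>f x\<bar> \<le> B" using bmE[OF f] by metis
  obtain C where C: "\<And>x. x \<in> space M \<Longrightarrow> \<bar>g x\<bar> \<le> C" using bmE[OF g] by metis
  show ?thesis
    using f g by (intro bmI[where B="B + C"]) (auto simp: bm_def intro: order_trans[OF abs_triangle_ineq add_mono[OF B C]])
qed

lemma bm_mult [intro]: "f \<in> bm M \<Longrightarrow> g \<in> bm M \<Longrightarrow> (\<lambda>x. f x * g x) \<in> bm M"
proof -
  assume f: "f \<in> bm M" and g: "g \<in> bm M"
  obtain B where "0 \<le> B" and B: "\<And>x. x \<in> space M \<Longrightarrow> \<bar>f x\<bar> \<le> B" using bmE[OF f] by metis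
  obtain C where C: "\<And>x. x \<in> space M \<Longrightarrow> \<bar>g x\<bar> \<le> C" using bmE[OF g] by metis
  show ?thesis
    using f g \<open>0 \<le> B\<close> by (intro bmI[where B="B * C"]) (auto simp: bm_def abs_mult intro: mult_mono[OF B C])
qed

lemma bm_diff [intro]: "f \<in> bm M \<Longrightarrow> g \<in> bm M \<Longrightarrow> (\<lambda>x. f x - g x) \<in> bm M"
  using bm_add[of f M "\<lambda>x. (-1) * g x"] bm_mult[OF bm_const[of "-1" M], of g] by simp

lemma bm_sum [intro]: "(\<And>i. i \<in> S \<Longrightarrow> f i \<in> bm M) \<Longrightarrow> (\<lambda>x. \<Sum>i\<in>S. f i x) \<in> bm M"
  by (induction S rule: infinite_finite_induct) auto

lemma bm_power [intro]: "f \<in> bm M \<Longrightarrow> (\<lambda>x. f x ^ k) \<in> bm M"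
  by (induction k) auto

lemma bm_of_bool: "{x \<in> space M. Q x} \<in> sets M \<Longrightarrow> (\<lambda>x. of_bool (Q x)) \<in> bm M"
proof (rule bmI[where B=1])
  assume "{x \<in> space M. Q x} \<in> sets M"
  then have "indicator {x \<in> space M. Q x} \<in> borel_measurable M" by simp
  then show "(\<lambda>x. of_bool (Q x)) \<in> borel_measurable M"
    by (rule measurable_cong[THEN iffD1, rotated]) (auto simp: indicator_def)
qed auto

lemma bm_compose: "g \<in> bm N \<Longrightarrow> f \<in> M \<rightarrow>\<^sub>M N \<Longrightarrow> (\<lambda>x. g (f x)) \<in> bm M"
proof -
  assume g: "g \<in> bm N" and f: "f \<in> M \<rightarrow>\<^sub>M N"
  obtain B where B: "\<And>x. x \<in> space N \<Longrightarrow> \<bar>g x\<bar> \<le> B" using bmE[OF g] by metis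
  show ?thesis
    using measurable_space[OF f] B g f by (intro bmI[where B=B]) (auto simp: bm_def)
qed

context prob_space
begin

lemma bm_integrable:
  assumes "f \<in> bm M"
  shows "integrable M f"
proof -
  obtain B where "\<And>x. x \<in> space M \<Longrightarrow> \<bar>f x\<bar> \<le> B" using bmE[OF assms] by metis
  then show ?thesis
    using bm_measurable[OF assms] by (intro integrable_const_bound[where B=B]) auto
qed

lemma bm_integral:
  assumes "(\<lambda>(x, y). f x y) \<in> bm (N \<Otimes>\<^sub>M M)"
  shows "(\<lambda>x. \<integral>y. f x y \<partial>M) \<in> bm N"
proof -
  obtain B where B: "\<And>z. z \<in> space (N \<Otimes>\<^sub>M M) \<Longrightarrow> \<bar>case z of (x, y) \<Rightarrow> f x y\<bar> \<le> B" using bmE[OF assms] by metis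
  show ?thesis
  proof (rule bmI[where B=B])
    show "(\<lambda>x. \<integral>y. f x y \<partial>M) \<in> borel_measurable N"
      by (rule borel_measurable_lebesgue_integral) (use assms in \<open>simp add: bm_def\<close>)
    fix x assume x: "x \<in> space N"
    have f: "f x \<in> bm M"
      using bm_compose[OF assms measurable_Pair1'[OF x]] by simp
    have "f x y \<le> B" "- B \<le> f x y" if "y \<in> space M" for y
      using B[of "(x, y)"] x that by (auto simp: space_pair_measure)
    then show "\<bar>\<integral>y. f x y \<partial>M\<bar> \<le> B"
      using integral_le_const[OF bm_integrable[OF f], of B] integral_ge_const[OF bm_integrable[OF f], of "- B"]
      by (auto intro!: abs_leI simp: AE_I2)
  qed
qed

text \<open>For symmetric \<open>k\<close> this is the kernel of the squared operator, and
  \<open>gram (gram k)\<close> belongs to its fourth power.\<close>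

definition gram :: "('a \<Rightarrow> 'a \<Rightarrow> real) \<Rightarrow> 'a \<Rightarrow> 'a \<Rightarrow> real" where
  "gram k x y = (\<integral>z. k x z * k y z \<partial>M)"

lemma gram_commute: "gram k x y = gram k y x"
  by (simp add: gram_def mult.commute)

lemma gram_bm:
  assumes "(\<lambda>(x, y). k x y) \<in> bm (M \<Otimes>\<^sub>M M)"
  shows "(\<lambda>(x, y). gram k x y) \<in> bm (M \<Otimes>\<^sub>M M)"
proof -
  let ?P = "(M \<Otimes>\<^sub>M M) \<Otimes>\<^sub>M M"
  have "(\<lambda>w. k (fst (fst w)) (snd w)) \<in> bm ?P"
    using bm_compose[OF assms, of "\<lambda>w. (fst (fst w), snd w)" ?P] by simp
  moreover have "(\<lambda>w. k (snd (fst w)) (snd w)) \<in> bm ?P"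
    using bm_compose[OF assms, of "\<lambda>w. (snd (fst w), snd w)" ?P] by simp
  ultimately have "(\<lambda>(u, z). k (fst u) z * k (snd u) z) \<in> bm ?P"
    unfolding case_prod_beta by (rule bm_mult)
  from bm_integral[OF this] show ?thesis by (simp add: gram_def case_prod_beta')
qed

lemma bm_section:
  assumes "(\<lambda>(x, y). k x y) \<in> bm (M \<Otimes>\<^sub>M M)" "x \<in> space M"
  shows "k x \<in> bm M"
  using bm_compose[OF assms(1) measurable_Pair1'[OF assms(2)]] by simp

lemma gram_form:
  assumes k: "(\<lambda>(x, y). k x y) \<in> bm (M \<Otimes>\<^sub>M M)" and s: "\<And>a. a \<in> S \<Longrightarrow> s a \<in> space M"
  shows "ip S c (app (\<lambda>a b. gram k (s a) (s b)) S c) = (\<integral>z. (\<Sum>a\<in>S. c a * k (s a) z)\<^sup>2 \<partial>M)"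
proof -
  have kb: "k (s a) \<in> bm M" if "a \<in> S" for a using bm_section[OF k s[OF that]] .
  have "(\<integral>z. (\<Sum>a\<in>S. c a * k (s a) z)\<^sup>2 \<partial>M)
      = (\<integral>z. (\<Sum>a\<in>S. \<Sum>b\<in>S. c a * c b * (k (s a) z * k (s b) z)) \<partial>M)"
    by (simp add: power2_eq_square sum_product mult_ac)
  also have "\<dots> = (\<Sum>a\<in>S. \<Sum>b\<in>S. c a * c b * gram k (s a) (s b))"
    unfolding gram_def
    by (subst Bochner_Integration.integral_sum, intro bm_integrable bm_sum bm_mult bm_const kb,
        assumption+, intro sum.cong refl,
        subst Bochner_Integration.integral_sum, intro bm_integrable bm_mult bm_const kb, assumption+) simp
  finally show ?thesis by (simp add: ip_app mult_ac)
qed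

lemma psd_gram:
  assumes k: "(\<lambda>(x, y). k x y) \<in> bm (M \<Otimes>\<^sub>M M)" and s: "\<And>a. a \<in> S \<Longrightarrow> s a \<in> space M"
  shows "psd (\<lambda>a b. gram k (s a) (s b)) S"
  by (simp add: psd_def gram_form[of k S s, OF k s])

lemma space_PiM_component: "X \<in> space (\<Pi>\<^sub>M i\<in>I. M) \<Longrightarrow> a \<in> I \<Longrightarrow> X a \<in> space M"
  by (auto simp: space_PiM)

lemma prob_space_PiM_const: "prob_space (\<Pi>\<^sub>M i\<in>I. M)"
  by (rule prob_space_PiM) (rule prob_space_axioms)

text \<open>On the right the old coordinate \<open>i\<close> is still integrated, as a dummy
  variable, so that the product space over \<open>I\<close> stays the same throughout the
  recursion.\<close>

lemma integral_resample:
  assumes I: "finite I" "i \<in> I" and h: "h \<in> bm (\<Pi>\<^sub>M i\<in>I. M)"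
  shows "(\<integral>X. h X \<partial>(\<Pi>\<^sub>M i\<in>I. M)) = (\<integral>X. (\<integral>x. h (X(i := x)) \<partial>M) \<partial>(\<Pi>\<^sub>M i\<in>I. M))"
proof -
  let ?P = "\<Pi>\<^sub>M i\<in>I. M"
  interpret PS: product_sigma_finite "\<lambda>_. M" ..
  interpret PI: prob_space ?P by (rule prob_space_PiM_const)
  define J where "J = I - {i}"
  have J: "finite J" "i \<notin> J" "insert i J = I" using I by (auto simp: J_def)
  have ins: "integral\<^sup>L ?P f = (\<integral>X. (\<integral>y. f (X(i := y)) \<partial>M) \<partial>Pi\<^sub>M J (\<lambda>_. M))" if "f \<in> bm ?P" for f
    using PS.product_integral_insert[OF J(1,2), of f] PI.bm_integrable[OF that] J(3) by simp
  have "(\<lambda>w. (fst w)(i := snd w)) \<in> ?P \<Otimes>\<^sub>M M \<rightarrow>\<^sub>M ?P"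
    using I by (intro measurable_fun_upd[where J=I]) auto
  from bm_compose[OF h this] have "(\<lambda>(X, x). h (X(i := x))) \<in> bm (?P \<Otimes>\<^sub>M M)"
    by (simp add: case_prod_beta')
  then have "(\<lambda>X. \<integral>x. h (X(i := x)) \<partial>M) \<in> bm ?P" by (rule bm_integral)
  from ins[OF this] show ?thesis
    using ins[OF h] by (simp add: prob_space)
qed

text \<open>Neither \<open>J\<close> nor \<open>Q\<close> sees \<open>X i\<close>, so only the two
  kernel factors are averaged. This is how independence of the sample enters the trace
  bounds.\<close>

lemma integral_quadratic_resample:
  assumes I: "finite I" "i \<in> I" "T \<subseteq> I - {i}"
    and k: "(\<lambda>(x, y). k x y) \<in> bm (M \<Otimes>\<^sub>M M)" and ksym: "\<And>x y. k x y = k y x"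
    and J: "J \<in> bm (\<Pi>\<^sub>M i\<in>I. M)" and Jupd: "\<And>X x. J (X(i := x)) = J X"
    and Q: "\<And>a b. a \<in> T \<Longrightarrow> b \<in> T \<Longrightarrow> (\<lambda>X. Q X a b) \<in> bm (\<Pi>\<^sub>M i\<in>I. M)"
    and Qupd: "\<And>X x a b. a \<in> T \<Longrightarrow> b \<in> T \<Longrightarrow> Q (X(i := x)) a b = Q X a b"
  shows "(\<integral>X. J X * (\<Sum>a\<in>T. \<Sum>b\<in>T. Q X a b * (k (X i) (X a) * k (X i) (X b))) \<partial>(\<Pi>\<^sub>M i\<in>I. M))
    = (\<integral>X. J X * (\<Sum>a\<in>T. \<Sum>b\<in>T. Q X a b * gram k (X a) (X b)) \<partial>(\<Pi>\<^sub>M i\<in>I. M))"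
proof -
  let ?P = "\<Pi>\<^sub>M i\<in>I. M"
  have kc: "(\<lambda>X. k (X a) (X b)) \<in> bm ?P" if "a \<in> I" "b \<in> I" for a b
    using bm_compose[OF k, of "\<lambda>X. (X a, X b)" ?P] that by simp
  have Tne: "a \<noteq> i" "a \<in> I" if "a \<in> T" for a using I that by auto
  let ?h = "\<lambda>X. J X * (\<Sum>a\<in>T. \<Sum>b\<in>T. Q X a b * (k (X i) (X a) * k (X i) (X b)))"
  have h: "?h \<in> bm ?P"
    using I Tne by (intro bm_mult bm_sum J Q kc) auto
  have "integral\<^sup>L ?P ?h = (\<integral>X. (\<integral>x. ?h (X(i := x)) \<partial>M) \<partial>?P)"
    by (rule integral_resample[OF I(1,2) h])
  also have "\<dots> = (\<integral>X. J X * (\<Sum>a\<in>T. \<Sum>b\<in>T. Q X a b * gram k (X a) (X b)) \<partial>?P)"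
  proof (rule lint_cong)
    fix X assume X: "X \<in> space ?P"
    have kb: "k (X a) \<in> bm M" if "a \<in> T" for a
      by (rule bm_section[OF k]) (use that Tne space_PiM_component[OF X] in auto)
    have "?h (X(i := x)) = J X * (\<Sum>a\<in>T. \<Sum>b\<in>T. Q X a b * (k (X a) x * k (X b) x))" for x
      unfolding Jupd by (intro arg_cong2[where f="(*)"] sum.cong refl) (auto simp: Qupd Tne ksym[of x])
    then have "(\<integral>x. ?h (X(i := x)) \<partial>M)
        = (\<integral>x. J X * (\<Sum>a\<in>T. \<Sum>b\<in>T. Q X a b * (k (X a) x * k (X b) x)) \<partial>M)" by simp
    also have "\<dots> = J X * (\<integral>x. (\<Sum>a\<in>T. \<Sum>b\<in>T. Q X a b * (k (X a) x * k (X b) x)) \<partial>M)" by simp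
    also have "(\<integral>x. (\<Sum>a\<in>T. \<Sum>b\<in>T. Q X a b * (k (X a) x * k (X b) x)) \<partial>M)
        = (\<Sum>a\<in>T. \<Sum>b\<in>T. Q X a b * gram k (X a) (X b))"
      unfolding gram_def
      by (subst Bochner_Integration.integral_sum, intro bm_integrable bm_sum bm_mult bm_const kb,
          assumption+, intro sum.cong refl,
          subst Bochner_Integration.integral_sum, intro bm_integrable bm_mult bm_const kb, assumption+) simp
    finally show "(\<integral>x. ?h (X(i := x)) \<partial>M) = J X * (\<Sum>a\<in>T. \<Sum>b\<in>T. Q X a b * gram k (X a) (X b))" .
  qed
  finally show ?thesis .
qed

end

text \<open>Inserting the guess \<open>card I * y ^ k\<close> produces a partial sum of the
  exponential series at \<open>B / y\<close>, so the guess reproduces itself under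
  \<open>yw\<close>. In the applications \<open>B\<close> contains the final power \<open>m\<close>,
  hence the recursion is required only below \<open>m\<close>.\<close>

lemma trace_recursion:
  fixes T :: "nat \<Rightarrow> 'i set \<Rightarrow> real" and B w y :: real
  assumes I: "finite I" and T0: "\<And>S. S \<subseteq> I \<Longrightarrow> T 0 S \<le> card I"
    and T: "\<And>k S. k < m \<Longrightarrow> S \<subseteq> I \<Longrightarrow> T (Suc k) S \<le> (\<Sum>i\<in>S. \<Sum>r\<le>k. B ^ r / fact r * (w * T (k - r) (S - {i})))"
    and y: "0 < y" "0 \<le> w" "0 \<le> B" and yw: "card I * w * exp (B / y) \<le> y"
  shows "S \<subseteq> I \<Longrightarrow> k \<le> m \<Longrightarrow> T k S \<le> card I * y ^ k"
proof (induction k arbitrary: S rule: less_induct)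
  case (less k)
  show ?case
  proof (cases k)
    case 0
    then show ?thesis using T0 less.prems by simp
  next
    case (Suc k')
    let ?n = "real (card I)"
    have exp_ge: "(\<Sum>r\<le>k'. (B / y) ^ r / fact r) \<le> exp (B / y)"
    proof -
      have "(\<Sum>r\<in>{..k'}. (B / y) ^ r /\<^sub>R fact r) \<le> (\<Sum>r. (B / y) ^ r /\<^sub>R fact r)"
        using y by (intro sum_le_suminf summable_exp_generic) auto
      then show ?thesis by (simp add: exp_def divide_inverse mult_ac)
    qed
    have "T k S \<le> (\<Sum>i\<in>S. \<Sum>r\<le>k'. B ^ r / fact r * (w * T (k' - r) (S - {i})))"
      using T[of k' S] less.prems Suc by simp
    also have "\<dots> \<le> (\<Sum>i\<in>S. \<Sum>r\<le>k'. B ^ r / fact r * (w * (?n * y ^ (k' - r))))"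
      using less.prems Suc y by (intro sum_mono mult_left_mono less.IH) auto
    also have "\<dots> = (\<Sum>i\<in>S. \<Sum>r\<le>k'. w * ?n * y ^ k' * ((B / y) ^ r / fact r))"
      using y by (intro sum.cong refl) (simp add: power_diff power_divide mult_ac)
    also have "\<dots> = card S * (w * ?n * y ^ k' * (\<Sum>r\<le>k'. (B / y) ^ r / fact r))"
      by (simp add: sum_distrib_left)
    also have "\<dots> \<le> ?n * (w * ?n * y ^ k' * exp (B / y))"
      using less.prems I y exp_ge
      by (intro mult_mono mult_left_mono) (auto intro!: card_mono mult_nonneg_nonneg sum_nonneg)
    also have "\<dots> = ?n * y ^ k' * (?n * w * exp (B / y))" by simp
    also have "\<dots> \<le> ?n * y ^ k' * y" using y yw by (intro mult_left_mono) auto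
    finally show ?thesis by (simp add: Suc mult_ac)
  qed
qed

lemma pw_cong:
  assumes "\<And>a b. a \<in> S \<Longrightarrow> b \<in> S \<Longrightarrow> A a b = A' a b" "a \<in> S"
  shows "pw A S k a b = pw A' S k a b"
  using assms(2) by (induction k arbitrary: a) (auto simp: pw_def app_apply assms(1) intro!: sum.cong)

lemma tr_cong:
  "(\<And>a b. a \<in> S \<Longrightarrow> b \<in> S \<Longrightarrow> A a b = A' a b) \<Longrightarrow> tr A S k = tr A' S k"
  unfolding tr_def by (intro sum.cong pw_cong) auto

lemma bm_pw:
  assumes "\<And>a b. a \<in> S \<Longrightarrow> b \<in> S \<Longrightarrow> (\<lambda>X. A X a b) \<in> bm M" "a \<in> S"
  shows "(\<lambda>X. pw (A X) S k a b) \<in> bm M"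
  using assms(2) by (induction k arbitrary: a) (auto simp: pw_def app_apply intro!: assms(1) bm_sum bm_mult)

lemma bm_tr:
  assumes "\<And>a b. a \<in> S \<Longrightarrow> b \<in> S \<Longrightarrow> (\<lambda>X. A X a b) \<in> bm M"
  shows "(\<lambda>X. tr (A X) S k) \<in> bm M"
  unfolding tr_def using assms by (intro bm_sum bm_pw) auto

section \<open>Trace recursions for sampled kernels\<close>

text \<open>In operator terms \<open>contraction\<close> reads \<open>K^4 \<le> lam^2 K^2\<close> on
  combinations of finitely many points; through it alone the mixing of the walk reaches the trace
  recursions.\<close>

locale sym_kernel = prob_space M for M :: "'v measure" +
  fixes K :: "'v \<Rightarrow> 'v \<Rightarrow> real" and lam R0 :: real
  assumes K_bm: "(\<lambda>(x, y). K x y) \<in> bm (M \<Otimes>\<^sub>M M)"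
    and K_commute: "K x y = K y x"
    and contraction: "finite S \<Longrightarrow> (\<And>a. a \<in> S \<Longrightarrow> s a \<in> space M) \<Longrightarrow>
      ip S c (app (\<lambda>a b. gram (gram K) (s a) (s b)) S c)
        \<le> lam\<^sup>2 * ip S (c :: nat \<Rightarrow> real) (app (\<lambda>a b. gram K (s a) (s b)) S c)"
    and gram_diag: "x \<in> space M \<Longrightarrow> gram K x x \<le> R0"
begin

definition G :: "(nat \<Rightarrow> 'v) \<Rightarrow> nat \<Rightarrow> nat \<Rightarrow> real" where
  "G X a b = gram K (X a) (X b)"

text \<open>Without the diagonal, as in a sampled graph without loops, every return takes at least
  two steps.\<close>

definition N :: "(nat \<Rightarrow> 'v) \<Rightarrow> nat \<Rightarrow> nat \<Rightarrow> real" where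
  "N X a b = (if a = b then 0 else K (X a) (X b))"

lemma G_commute: "G X a b = G X b a"
  by (simp add: G_def gram_commute)

lemma N_commute: "N X a b = N X b a"
  by (simp add: N_def K_commute)

lemma kernel_component_bm:
  assumes "(\<lambda>(x, y). k x y) \<in> bm (M \<Otimes>\<^sub>M M)" "a \<in> I" "b \<in> I"
  shows "(\<lambda>X. k (X a) (X b)) \<in> bm (\<Pi>\<^sub>M i\<in>I. M)"
  using bm_compose[OF assms(1), of "\<lambda>X. (X a, X b)" "\<Pi>\<^sub>M i\<in>I. M"] assms by simp

lemma G_bm: "a \<in> I \<Longrightarrow> b \<in> I \<Longrightarrow> (\<lambda>X. G X a b) \<in> bm (\<Pi>\<^sub>M i\<in>I. M)"
  unfolding G_def by (intro kernel_component_bm gram_bm K_bm)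

lemma N_bm: "a \<in> I \<Longrightarrow> b \<in> I \<Longrightarrow> (\<lambda>X. N X a b) \<in> bm (\<Pi>\<^sub>M i\<in>I. M)"
  unfolding N_def using kernel_component_bm[OF K_bm] by (cases "a = b") auto

lemma psd_G: "X \<in> space (\<Pi>\<^sub>M i\<in>I. M) \<Longrightarrow> S \<subseteq> I \<Longrightarrow> psd (G X) S"
  using psd_gram[OF K_bm, of S X] space_PiM_component[of X I] by (auto simp: G_def[abs_def])

text \<open>At power 0 the trace is replaced by \<open>card I\<close>, whatever \<open>S\<close> is:
  the term in which all returns are loops ends in \<open>G X i i\<close>, and
  \<open>R0 \<le> lam\<^sup>2 * card I\<close> pays for it even when \<open>S\<close> is
  small.\<close>

lemma gram_trace_step:
  fixes k m :: nat
  assumes I: "finite I" "S \<subseteq> I" and R0: "0 \<le> R0" "R0 \<le> lam\<^sup>2 * card I" and km: "k < m"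
  defines "T \<equiv> \<lambda>k S. if k = 0 then real (card I) else (\<integral>X. tr (G X) S k \<partial>(\<Pi>\<^sub>M i\<in>I. M))"
  shows "T (Suc k) S \<le> (\<Sum>i\<in>S. \<Sum>r\<le>k. (m * R0) ^ r / fact r * (lam\<^sup>2 * T (k - r) (S - {i})))"
proof -
  let ?P = "\<Pi>\<^sub>M i\<in>I. M"
  interpret P: prob_space ?P by (rule prob_space_PiM_const)
  have finS: "finite S" using I finite_subset by auto
  have "T (Suc k) S = (\<Sum>i\<in>S. \<integral>X. pw (G X) S (Suc k) i i \<partial>?P)"
    unfolding T_def tr_def using I
    by (simp del: funpow.simps) (intro Bochner_Integration.integral_sum P.bm_integrable bm_pw G_bm; auto)
  also have "\<dots> \<le> (\<Sum>i\<in>S. \<Sum>r\<le>k. (m * R0) ^ r / fact r * (lam\<^sup>2 * T (k - r) (S - {i})))"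
  proof (rule sum_mono)
    fix i assume i: "i \<in> S"
    let ?T = "S - {i}"
    have T: "finite ?T" "?T \<subseteq> I" "?T \<subseteq> I - {i}" using finS I by auto
    \<comment> \<open>The factor kept for averaging, with \<open>X i\<close> written out; a
      remaining loop is replaced by its bound \<open>R0\<close>.\<close>
    define h where "h r X = (case r of 0 \<Rightarrow> R0 | Suc j \<Rightarrow>
      (\<Sum>a\<in>?T. \<Sum>b\<in>?T. pw (G X) ?T j a b * (gram K (X i) (X a) * gram K (X i) (X b))))" for r X
    have h_bm: "h r \<in> bm ?P" for r
    proof (cases r)
      case (Suc j)
      show ?thesis
        unfolding h_def[abs_def] Suc using T I i
        by (auto intro!: bm_sum bm_mult bm_pw G_bm kernel_component_bm[OF gram_bm[OF K_bm]])
    qed (auto simp: h_def[abs_def])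
    have "pw (G X) S (Suc k) i i \<le> (\<Sum>r\<le>k. (m * R0) ^ r / fact r * h (k - r) X)" if X: "X \<in> space ?P" for X
    proof -
      let ?f = "\<lambda>j. case j of 0 \<Rightarrow> G X i i | Suc j \<Rightarrow> mom (G X) ?T (G X i) j"
      have psd: "psd (G X) S" "psd (G X) ?T" using psd_G[OF X] I(2) T(2) by auto
      have Gii: "0 \<le> G X i i" "G X i i \<le> R0"
        using gram_diag[of "X i"] space_PiM_component[OF X, of i] i I(2)
        by (auto simp: G_def) (auto simp: gram_def)
      have mom: "mom (G X) ?T (G X i) j = h (Suc j) X" for j
        using T by (simp add: h_def mom_eq_pw ip_app G_def[of X i])
      have mom0: "0 \<le> mom (G X) ?T (G X i) j" for j
        using log_convex_mom_psd[OF G_commute psd(2)] by (simp add: log_convex_def)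
      have fh: "?f j \<le> h j X" "0 \<le> ?f j" for j
        using Gii mom mom0 by (auto simp: h_def split: nat.split)
      have "pw (G X) S (Suc k) i i \<le> (\<Sum>r\<le>k. real (Suc k) ^ r / fact r * G X i i ^ r * ?f (k - r))"
        by (rule pw_diag_psd_bound[OF G_commute psd(1) finS i])
      also have "\<dots> \<le> (\<Sum>r\<le>k. (real m ^ r / fact r * R0 ^ r) * h (k - r) X)"
        using Gii fh km R0
        by (intro sum_mono mult_mono divide_right_mono power_mono mult_nonneg_nonneg) auto
      finally show ?thesis by (simp add: power_mult_distrib)
    qed
    then have "(\<integral>X. pw (G X) S (Suc k) i i \<partial>?P) \<le> (\<integral>X. (\<Sum>r\<le>k. (m * R0) ^ r / fact r * h (k - r) X) \<partial>?P)"
      using I(2) i by (intro integral_mono P.bm_integrable bm_pw bm_sum bm_mult bm_const h_bm G_bm) auto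
    also have "\<dots> = (\<Sum>r\<le>k. (m * R0) ^ r / fact r * (\<integral>X. h (k - r) X \<partial>?P))"
      by (subst Bochner_Integration.integral_sum, intro P.bm_integrable bm_mult bm_const h_bm) simp
    also have "\<dots> \<le> (\<Sum>r\<le>k. (m * R0) ^ r / fact r * (lam\<^sup>2 * T (k - r) ?T))"
    proof (intro sum_mono mult_left_mono)
      fix r
      show "(\<integral>X. h (k - r) X \<partial>?P) \<le> lam\<^sup>2 * T (k - r) ?T"
      proof (cases "k - r")
        case 0
        then show ?thesis using R0 by (simp add: h_def T_def P.prob_space)
      next
        case (Suc j)
        \<comment> \<open>Averaging over \<open>X i\<close> squares the kernel
          \<open>gram K\<close>. By contraction the result is at most \<open>lam\<^sup>2\<close>
          times \<open>gram K\<close>, which completes one more power of \<open>G X\<close> on the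
          smaller set.\<close>
        let ?q = "\<lambda>X. \<Sum>a\<in>?T. \<Sum>b\<in>?T. pw (G X) ?T j a b * gram (gram K) (X a) (X b)"
        have pw_upd: "pw (G (X(i := x))) ?T j a b = pw (G X) ?T j a b" if "a \<in> ?T" for X x a b
          by (rule pw_cong) (use that in \<open>auto simp: G_def\<close>)
        have "(\<integral>X. h (k - r) X \<partial>?P) = (\<integral>X. 1 * ?q X \<partial>?P)"
          unfolding h_def Suc nat.case
          using I i T G_bm
          by (subst integral_quadratic_resample[of I i ?T "gram K" "\<lambda>_. 1", symmetric])
            (auto intro!: gram_bm K_bm bm_pw G_bm simp: gram_commute pw_upd)
        also have "\<dots> \<le> (\<integral>X. lam\<^sup>2 * tr (G X) ?T (Suc j) \<partial>?P)"
        proof (intro integral_mono P.bm_integrable)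
          fix X assume X: "X \<in> space ?P"
          have s: "a \<in> ?T \<Longrightarrow> X a \<in> space M" for a using space_PiM_component[OF X] T by auto
          have psdT: "psd (G X) ?T" using psd_G[OF X] T by auto
          let ?H = "\<lambda>a b. lam\<^sup>2 * G X a b - gram (gram K) (X a) (X b)"
          have "psd ?H ?T"
            using contraction[OF T(1) s] by (simp add: psd_def ip_app_diff G_def[abs_def])
          then have "0 \<le> (\<Sum>a\<in>?T. \<Sum>b\<in>?T. pw (G X) ?T j a b * ?H a b)"
            using psdT T by (intro psd_hadamard_nonneg psd_pw pw_commute G_commute)
          also have "\<dots> = lam\<^sup>2 * tr (G X) ?T (Suc j) - ?q X"
            unfolding tr_Suc right_diff_distrib sum_subtractf sum_distrib_left
            by (subst sum.swap) (simp add: G_commute mult_ac)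
          finally show "1 * ?q X \<le> lam\<^sup>2 * tr (G X) ?T (Suc j)" by simp
        next
          show "(\<lambda>X. 1 * ?q X) \<in> bm ?P"
            using T by (auto intro!: bm_sum bm_mult bm_pw G_bm kernel_component_bm[OF gram_bm[OF gram_bm[OF K_bm]]])
          show "(\<lambda>X. lam\<^sup>2 * tr (G X) ?T (Suc j)) \<in> bm ?P"
            using T by (auto intro!: bm_mult bm_tr G_bm)
        qed
        finally show ?thesis by (simp add: T_def Suc)
      qed
    qed (use R0 in auto)
    finally show "(\<integral>X. pw (G X) S (Suc k) i i \<partial>?P) \<le> (\<Sum>r\<le>k. (m * R0) ^ r / fact r * (lam\<^sup>2 * T (k - r) ?T))" .
  qed
  finally show ?thesis .
qed

lemma gram_trace_bound:
  fixes m :: nat and y :: real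
  assumes I: "finite I" and R0: "0 \<le> R0" "R0 \<le> lam\<^sup>2 * card I"
    and y: "0 < y" "card I * lam\<^sup>2 * exp (m * R0 / y) \<le> y" and "0 < m"
  shows "(\<integral>X. tr (G X) I m \<partial>(\<Pi>\<^sub>M i\<in>I. M)) \<le> card I * y ^ m"
proof -
  let ?T = "\<lambda>k S. if k = 0 then real (card I) else (\<integral>X. tr (G X) S k \<partial>(\<Pi>\<^sub>M i\<in>I. M))"
  have "?T m I \<le> card I * y ^ m"
  proof (rule trace_recursion[of I ?T m "m * R0" "lam\<^sup>2" y, OF I])
    show "?T (Suc k) S \<le> (\<Sum>i\<in>S. \<Sum>r\<le>k. (m * R0) ^ r / fact r * (lam\<^sup>2 * ?T (k - r) (S - {i})))"
      if "k < m" "S \<subseteq> I" for k S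
      using gram_trace_step[OF I that(2) R0 that(1)] .
  qed (use R0 y in auto)
  then show ?thesis using \<open>0 < m\<close> by simp
qed

text \<open>The event on which the recursion for \<^term>\<open>N\<close> is run: it is inherited by subsets of the
  sample and bounds the operator norm of \<^term>\<open>G\<close> through countably many traces.\<close>

definition good :: "nat \<Rightarrow> real \<Rightarrow> real \<Rightarrow> nat set \<Rightarrow> (nat \<Rightarrow> 'v) \<Rightarrow> bool" where
  "good n \<tau> R S X \<longleftrightarrow> (\<forall>k. tr (G X) S (2 * k) \<le> n * \<tau> ^ (2 * k)) \<and>
     (\<forall>i\<in>S. (\<Sum>a\<in>S - {i}. (K (X i) (X a))\<^sup>2) \<le> R)"

lemma good_norm_le: "good n \<tau> R S X \<Longrightarrow> finite S \<Longrightarrow> norm_le (G X) S \<tau>"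
  unfolding good_def by (intro norm_le_if_tr[of _ _ n]) (auto simp: G_commute)

text \<open>The operator norm passes to principal submatrices, and it gives the traces back with the
  factor \<open>card T \<le> n\<close>.\<close>

lemma good_subset:
  assumes "good n \<tau> R S X" "finite S" "T \<subseteq> S" "card S \<le> n"
  shows "good n \<tau> R T X"
proof -
  have "norm_le (G X) T \<tau>"
    using norm_le_subset[OF good_norm_le] assms by blast
  then have "tr (G X) T (2 * k) \<le> card T * \<tau> ^ (2 * k)" for k
    using assms finite_subset by (intro norm_le_tr_even) (auto simp: G_commute)
  moreover have "card T * \<tau> ^ (2 * k) \<le> n * \<tau> ^ (2 * k)" for k
    using card_mono[OF assms(2,3)] assms(4) by (intro mult_right_mono) (auto simp: power_mult)
  ultimately have "\<forall>k. tr (G X) T (2 * k) \<le> n * \<tau> ^ (2 * k)" by (meson order_trans)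
  moreover have "(\<Sum>a\<in>T - {i}. (K (X i) (X a))\<^sup>2) \<le> R" if "i \<in> T" for i
  proof -
    have "(\<Sum>a\<in>T - {i}. (K (X i) (X a))\<^sup>2) \<le> (\<Sum>a\<in>S - {i}. (K (X i) (X a))\<^sup>2)"
      using assms by (intro sum_mono2) auto
    also have "\<dots> \<le> R" using assms that by (auto simp: good_def)
    finally show ?thesis .
  qed
  ultimately show ?thesis by (simp add: good_def)
qed

lemma good_bm:
  assumes "S \<subseteq> I" "finite S"
  shows "(\<lambda>X. of_bool (good n \<tau> R S X)) \<in> bm (\<Pi>\<^sub>M i\<in>I. M)"
proof (rule bm_of_bool)
  let ?P = "\<Pi>\<^sub>M i\<in>I. M"
  have [measurable]: "(\<lambda>X. tr (G X) S (2 * k)) \<in> borel_measurable ?P" for k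
    using assms by (intro bm_measurable bm_tr G_bm) auto
  have [measurable]: "(\<lambda>X. \<Sum>a\<in>S - {i}. (K (X i) (X a))\<^sup>2) \<in> borel_measurable ?P" if "i \<in> S" for i
    using assms that by (intro bm_measurable bm_sum bm_power kernel_component_bm K_bm) auto
  have 1: "{X \<in> space ?P. \<forall>k. tr (G X) S (2 * k) \<le> n * \<tau> ^ (2 * k)} \<in> sets ?P" by measurable
  have 2: "{X \<in> space ?P. \<forall>i\<in>S. (\<Sum>a\<in>S - {i}. (K (X i) (X a))\<^sup>2) \<le> R} \<in> sets ?P"
    using assms by (intro sets.sets_Collect_finite_All) auto
  show "{X \<in> space ?P. good n \<tau> R S X} \<in> sets ?P"
    unfolding good_def by (rule sets.sets_Collect_conj[OF 2 1])
qed

lemma good_upd: "i \<notin> S \<Longrightarrow> good n \<tau> R S (X(i := x)) = good n \<tau> R S X"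
proof -
  assume i: "i \<notin> S"
  then have "tr (G (X(i := x))) S k = tr (G X) S k" for k
    by (intro tr_cong) (auto simp: G_def)
  moreover have "(\<Sum>a\<in>S - {j}. (K ((X(i := x)) j) ((X(i := x)) a))\<^sup>2) = (\<Sum>a\<in>S - {j}. (K (X j) (X a))\<^sup>2)" if "j \<in> S" for j
    using i that by (intro sum.cong) auto
  ultimately show ?thesis unfolding good_def by auto
qed

text \<open>The indicator must survive averaging over \<open>X i\<close>. It is enlarged from the
  event for \<open>S\<close> to the one for \<open>S - {i}\<close>: the first implies the second,
  the extra contributions are nonnegative, and the second does not depend on
  \<open>X i\<close>.\<close>

lemma kernel_trace_step:
  fixes k m :: nat and \<tau> R :: real
  assumes I: "finite I" "S \<subseteq> I" and R: "0 \<le> R" and \<tau>: "0 \<le> \<tau>" and km: "k < m"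
  defines "T \<equiv> \<lambda>k S. (\<integral>X. of_bool (good (card I) \<tau> R S X) * tr (N X) S (2 * k) \<partial>(\<Pi>\<^sub>M i\<in>I. M))"
  shows "T (Suc k) S \<le> (\<Sum>i\<in>S. \<Sum>r\<le>k. (2 * m * R) ^ r / fact r * (\<tau> * T (k - r) (S - {i})))"
proof -
  let ?P = "\<Pi>\<^sub>M i\<in>I. M"
  let ?J = "\<lambda>S X. of_bool (good (card I) \<tau> R S X) :: real"
  interpret P: prob_space ?P by (rule prob_space_PiM_const)
  have finS: "finite S" using I finite_subset by auto
  have J_bm: "?J S \<in> bm ?P" if "S \<subseteq> I" for S
    using good_bm[OF that] I(1) finite_subset[OF that] by blast
  have "T (Suc k) S = (\<Sum>i\<in>S. \<integral>X. ?J S X * pw (N X) S (2 * Suc k) i i \<partial>?P)"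
    unfolding T_def tr_def sum_distrib_left using I
    by (intro Bochner_Integration.integral_sum P.bm_integrable bm_mult bm_pw N_bm J_bm) auto
  also have "\<dots> \<le> (\<Sum>i\<in>S. \<Sum>r\<le>k. (2 * m * R) ^ r / fact r * (\<tau> * T (k - r) (S - {i})))"
  proof (rule sum_mono)
    fix i assume i: "i \<in> S"
    let ?T = "S - {i}"
    have T: "finite ?T" "?T \<subseteq> I" "?T \<subseteq> I - {i}" using finS I by auto
    define h where "h r X = ?J ?T X *
      (\<Sum>a\<in>?T. \<Sum>b\<in>?T. pw (N X) ?T (2 * r) a b * (K (X i) (X a) * K (X i) (X b)))" for r X
    have h_bm: "h r \<in> bm ?P" for r
      unfolding h_def[abs_def] using T I i
      by (intro bm_sum bm_mult bm_pw N_bm kernel_component_bm[OF K_bm] J_bm) auto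
    have "?J S X * pw (N X) S (2 * Suc k) i i \<le> (\<Sum>r\<le>k. (2 * m * R) ^ r / fact r * h (k - r) X)" if X: "X \<in> space ?P" for X
    proof -
      have mom: "mom (N X) ?T (N X i) (2 * j) = (\<Sum>a\<in>?T. \<Sum>b\<in>?T. pw (N X) ?T (2 * j) a b * (K (X i) (X a) * K (X i) (X b)))" for j
        unfolding mom_eq_pw[OF T(1)] ip_app by (intro sum.cong refl) (auto simp: N_def)
      have mom0: "0 \<le> mom (N X) ?T (N X i) (2 * j)" for j
        by (rule mom_even_nonneg) (rule N_commute)
      have h_mom: "h j X = ?J ?T X * mom (N X) ?T (N X i) (2 * j)" for j
        by (simp only: h_def mom)
      have J0: "0 \<le> ?J ?T X" by (cases "good (card I) \<tau> R ?T X") simp_all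
      have h0: "0 \<le> h j X" for j
        unfolding h_mom by (rule mult_nonneg_nonneg[OF J0 mom0])
      show ?thesis
      proof (cases "good (card I) \<tau> R S X")
        case True
        have good': "good (card I) \<tau> R ?T X"
          by (rule good_subset[OF True finS Diff_subset card_mono[OF I]])
        have "ip ?T (N X i) (N X i) = (\<Sum>a\<in>?T. (K (X i) (X a))\<^sup>2)"
          unfolding ip_def by (intro sum.cong refl) (auto simp: N_def power2_eq_square)
        then have ipR: "ip ?T (N X i) (N X i) \<le> R"
          using True i by (simp add: good_def)
        have "pw (N X) S (2 * Suc k) i i
            \<le> (\<Sum>r\<le>k. (2 * real (Suc k)) ^ r / fact r * ip ?T (N X i) (N X i) ^ r * mom (N X) ?T (N X i) (2 * (k - r)))"
          by (rule pw_diag_even_bound[OF N_commute finS i]) (simp add: N_def)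
        also have "\<dots> \<le> (\<Sum>r\<le>k. ((2 * real m) ^ r / fact r * R ^ r) * mom (N X) ?T (N X i) (2 * (k - r)))"
          using ipR mom0 km R ip_self_nonneg
          by (intro sum_mono mult_mono divide_right_mono power_mono mult_nonneg_nonneg) auto
        finally show ?thesis using True good' unfolding h_mom by (simp add: power_mult_distrib)
      next
        case False
        then show ?thesis using h0 R by (simp add: sum_nonneg)
      qed
    qed
    then have "(\<integral>X. ?J S X * pw (N X) S (2 * Suc k) i i \<partial>?P) \<le> (\<integral>X. (\<Sum>r\<le>k. (2 * m * R) ^ r / fact r * h (k - r) X) \<partial>?P)"
      using I(2) i by (intro integral_mono P.bm_integrable bm_pw bm_sum bm_mult bm_const h_bm N_bm J_bm) auto
    also have "\<dots> = (\<Sum>r\<le>k. (2 * m * R) ^ r / fact r * (\<integral>X. h (k - r) X \<partial>?P))"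
      by (subst Bochner_Integration.integral_sum, intro P.bm_integrable bm_mult bm_const h_bm) simp
    also have "\<dots> \<le> (\<Sum>r\<le>k. (2 * m * R) ^ r / fact r * (\<tau> * T (k - r) ?T))"
    proof (intro sum_mono mult_left_mono)
      fix r
      define j where "j = 2 * (k - r)"
      let ?q = "\<lambda>X. \<Sum>a\<in>?T. \<Sum>b\<in>?T. pw (N X) ?T j a b * gram K (X a) (X b)"
      have pw_upd: "pw (N (X(i := x))) ?T j a b = pw (N X) ?T j a b" if "a \<in> ?T" for X x a b
        by (rule pw_cong) (use that in \<open>auto simp: N_def\<close>)
      have "(\<integral>X. h (k - r) X \<partial>?P) = (\<integral>X. ?J ?T X * ?q X \<partial>?P)"
        unfolding h_def j_def[symmetric]
        using I i T
        by (intro integral_quadratic_resample)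
          (auto intro!: K_bm K_commute J_bm bm_pw N_bm simp: pw_upd good_upd)
      also have "\<dots> \<le> (\<integral>X. \<tau> * (?J ?T X * tr (N X) ?T j) \<partial>?P)"
      proof (intro integral_mono P.bm_integrable)
        fix X assume X: "X \<in> space ?P"
        show "?J ?T X * ?q X \<le> \<tau> * (?J ?T X * tr (N X) ?T j)"
        proof (cases "good (card I) \<tau> R ?T X")
          case True
          \<comment> \<open>On the event the Gram matrix is at most \<open>\<tau>\<close> times the
            identity as a form, so the averaged factor costs \<open>\<tau>\<close> and leaves a
            plain trace.\<close>
          let ?H = "\<lambda>a b. \<tau> * of_bool (a = b) - G X a b"
          have norm: "norm_le (G X) ?T \<tau>" using good_norm_le[OF True] T by simp
          have delta: "(\<Sum>b\<in>?T. of_bool (a = b) * f b) = f a" if "a \<in> ?T" for a and f :: "nat \<Rightarrow> real"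
            using T(1) that by (simp add: of_bool_def if_distribR if_distrib[of "\<lambda>y. y * _"] cong: if_cong)
          have "ip ?T c (app ?H ?T c) = \<tau> * ip ?T c c - ip ?T c (app (G X) ?T c)" for c
            using T(1) by (simp add: ip_app_diff ip_app_delta)
          moreover have "ip ?T c (app (G X) ?T c) \<le> \<tau> * ip ?T c c" for c
            using norm_le_quadratic[OF norm \<tau>, of c] by simp
          ultimately have "psd ?H ?T" by (simp add: psd_def)
          then have "0 \<le> (\<Sum>a\<in>?T. \<Sum>b\<in>?T. pw (N X) ?T j a b * ?H a b)"
            using T unfolding j_def by (intro psd_hadamard_nonneg psd_pw_even pw_commute N_commute)
          also have "\<dots> = \<tau> * (\<Sum>a\<in>?T. \<Sum>b\<in>?T. of_bool (a = b) * pw (N X) ?T j a b)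
              - (\<Sum>a\<in>?T. \<Sum>b\<in>?T. pw (N X) ?T j a b * G X a b)"
            by (simp add: right_diff_distrib sum_subtractf sum_distrib_left mult_ac)
          also have "(\<Sum>a\<in>?T. \<Sum>b\<in>?T. of_bool (a = b) * pw (N X) ?T j a b) = tr (N X) ?T j"
            unfolding tr_def by (intro sum.cong refl delta)
          finally show ?thesis using True by (simp add: G_def)
        qed simp
      next
        show "(\<lambda>X. ?J ?T X * ?q X) \<in> bm ?P"
          using T by (intro bm_sum bm_mult bm_pw N_bm kernel_component_bm[OF gram_bm[OF K_bm]] J_bm) auto
        show "(\<lambda>X. \<tau> * (?J ?T X * tr (N X) ?T j)) \<in> bm ?P"
          using T by (intro bm_mult bm_tr N_bm J_bm bm_const) auto
      qed
      finally show "(\<integral>X. h (k - r) X \<partial>?P) \<le> \<tau> * T (k - r) ?T" by (simp add: T_def j_def)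
    qed (use R in auto)
    finally show "(\<integral>X. ?J S X * pw (N X) S (2 * Suc k) i i \<partial>?P)
      \<le> (\<Sum>r\<le>k. (2 * m * R) ^ r / fact r * (\<tau> * T (k - r) ?T))" .
  qed
  finally show ?thesis .
qed

lemma kernel_trace_bound:
  fixes m :: nat and y \<tau> R :: real
  assumes I: "finite I" and R: "0 \<le> R" and \<tau>: "0 \<le> \<tau>"
    and y: "0 < y" "card I * \<tau> * exp (2 * m * R / y) \<le> y"
  shows "(\<integral>X. of_bool (good (card I) \<tau> R I X) * tr (N X) I (2 * m) \<partial>(\<Pi>\<^sub>M i\<in>I. M)) \<le> card I * y ^ m"
proof -
  let ?P = "\<Pi>\<^sub>M i\<in>I. M"
  interpret P: prob_space ?P by (rule prob_space_PiM_const)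
  let ?T = "\<lambda>k S. (\<integral>X. of_bool (good (card I) \<tau> R S X) * tr (N X) S (2 * k) \<partial>?P)"
  have "?T 0 S \<le> card I" if "S \<subseteq> I" for S
  proof -
    have "tr (N X) S 0 = card S" for X by (simp add: tr_def pw_def)
    then have "?T 0 S \<le> (\<integral>X. card S \<partial>?P)"
      using that I finite_subset by (intro integral_mono P.bm_integrable bm_mult good_bm) auto
    then show ?thesis using card_mono[OF I that] by (simp add: P.prob_space)
  qed
  note T0 = this
  have "?T m I \<le> card I * y ^ m"
  proof (rule trace_recursion[of I ?T m "2 * m * R" \<tau> y, OF I])
    show "?T (Suc k) S \<le> (\<Sum>i\<in>S. \<Sum>r\<le>k. (2 * m * R) ^ r / fact r * (\<tau> * ?T (k - r) (S - {i})))"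
      if "k < m" "S \<subseteq> I" for k S
      using kernel_trace_step[OF I that(2) R \<tau> that(1)] by simp
  qed (use T0 R y \<tau> in auto)
  then show ?thesis .
qed

end

section \<open>Decay implies contraction\<close>

context prob_space
begin

lemma integral_CS:
  assumes f: "f \<in> bm M" and g: "g \<in> bm M"
  shows "(\<integral>x. f x * g x \<partial>M)\<^sup>2 \<le> (\<integral>x. (f x)\<^sup>2 \<partial>M) * (\<integral>x. (g x)\<^sup>2 \<partial>M)"
proof (rule quadratic_discriminant)
  fix t
  have [simp]: "integrable M (\<lambda>x. (f x)\<^sup>2)" "integrable M (\<lambda>x. (g x)\<^sup>2)" "integrable M (\<lambda>x. f x * g x)"
    using f g by (auto intro!: bm_integrable)
  have "0 \<le> (\<integral>x. (f x + t * g x)\<^sup>2 \<partial>M)" by simp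
  also have "\<dots> = (\<integral>x. (f x)\<^sup>2 + (2 * t) * (f x * g x) + t\<^sup>2 * (g x)\<^sup>2 \<partial>M)"
    by (intro lint_cong) (simp add: power2_eq_square algebra_simps)
  also have "\<dots> = (\<integral>x. (f x)\<^sup>2 \<partial>M) + 2 * (\<integral>x. f x * g x \<partial>M) * t + (\<integral>x. (g x)\<^sup>2 \<partial>M) * t\<^sup>2"
    by simp
  finally show "0 \<le> (\<integral>x. (f x)\<^sup>2 \<partial>M) + 2 * (\<integral>x. f x * g x \<partial>M) * t + (\<integral>x. (g x)\<^sup>2 \<partial>M) * t\<^sup>2" .
qed

lemma kernel_apply_bm:
  assumes k: "(\<lambda>(x, y). k x y) \<in> bm (M \<Otimes>\<^sub>M M)" and f: "f \<in> bm M"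
  shows "(\<lambda>x. \<integral>y. k x y * f y \<partial>M) \<in> bm M"
proof (rule bm_integral)
  have "(\<lambda>z. f (snd z)) \<in> bm (M \<Otimes>\<^sub>M M)" by (rule bm_compose[OF f]) simp
  from bm_mult[OF k this] show "(\<lambda>(x, y). k x y * f y) \<in> bm (M \<Otimes>\<^sub>M M)"
    by (simp add: case_prod_beta')
qed

lemma kernel_self_adjoint:
  assumes k: "(\<lambda>(x, y). k x y) \<in> bm (M \<Otimes>\<^sub>M M)" and sym: "\<And>x y. k x y = k y x"
    and f: "f \<in> bm M" and g: "g \<in> bm M"
  shows "(\<integral>x. (\<integral>y. k x y * f y \<partial>M) * g x \<partial>M) = (\<integral>x. f x * (\<integral>y. k x y * g y \<partial>M) \<partial>M)"
proof -
  interpret P: pair_prob_space M M ..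
  have "(\<lambda>z. f (snd z)) \<in> bm (M \<Otimes>\<^sub>M M)" "(\<lambda>z. g (fst z)) \<in> bm (M \<Otimes>\<^sub>M M)"
    by (rule bm_compose[OF f], simp, rule bm_compose[OF g], simp)
  from bm_mult[OF bm_mult[OF k this(1)] this(2)]
  have "(\<lambda>(x, y). k x y * f y * g x) \<in> bm (M \<Otimes>\<^sub>M M)" by (simp add: case_prod_beta')
  then have "integrable (M \<Otimes>\<^sub>M M) (\<lambda>(x, y). k x y * f y * g x)" by (rule P.bm_integrable)
  from P.Fubini_integral[OF this]
  have "(\<integral>x. (\<integral>y. k x y * f y * g x \<partial>M) \<partial>M) = (\<integral>y. (\<integral>x. k x y * f y * g x \<partial>M) \<partial>M)" by simp
  also have "\<dots> = (\<integral>y. f y * (\<integral>x. k y x * g x \<partial>M) \<partial>M)"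
  proof (rule lint_cong)
    fix y
    have "(\<integral>x. k x y * f y * g x \<partial>M) = (\<integral>x. f y * (k y x * g x) \<partial>M)"
      by (simp add: sym[of _ y] mult_ac)
    then show "(\<integral>x. k x y * f y * g x \<partial>M) = f y * (\<integral>x. k y x * g x \<partial>M)" by simp
  qed
  also have "(\<integral>x. (\<integral>y. k x y * f y * g x \<partial>M) \<partial>M) = (\<integral>x. (\<integral>y. k x y * f y \<partial>M) * g x \<partial>M)" by simp
  finally show ?thesis .
qed

end

text \<open>A transitive graph after normalisation: with \<open>\<rho>\<close> as the volume, the
  common degree is the edge probability \<open>p\<close>.\<close>

locale regular_graph = prob_space \<rho> for \<rho> :: "'v measure" +
  fixes E :: "'v rel" and p :: real
  assumes E_sets: "E \<in> sets (\<rho> \<Otimes>\<^sub>M \<rho>)"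
    and E_sym: "sym E" and E_irrefl: "irrefl E"
    and p_pos: "0 < p"
    and degree: "x \<in> space \<rho> \<Longrightarrow> measure \<rho> (E `` {x}) = p"
begin

definition adj :: "'v \<Rightarrow> 'v \<Rightarrow> real" where
  "adj x y = of_bool ((x, y) \<in> E)"

text \<open>Density of one walk step with respect to \<open>\<rho>\<close>, minus the density 1 of
  its limit.\<close>

definition kern :: "'v \<Rightarrow> 'v \<Rightarrow> real" where
  "kern x y = adj x y / p - 1"

text \<open>The walk acting on functions. Thus \<open>(avg ^^ m) (adj y) x\<close> is the
  probability that \<open>m\<close> steps from \<open>x\<close> lead into the neighbourhood of
  \<open>y\<close>.\<close>

definition avg :: "('v \<Rightarrow> real) \<Rightarrow> 'v \<Rightarrow> real" where
  "avg f x = (\<integral>y. adj x y * f y \<partial>\<rho>) / p"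

lemma adj_commute: "adj x y = adj y x"
  using E_sym by (auto simp: adj_def sym_def)

lemma kern_commute: "kern x y = kern y x"
  by (simp add: kern_def adj_commute[of x y])

lemma adj_bm: "(\<lambda>(x, y). adj x y) \<in> bm (\<rho> \<Otimes>\<^sub>M \<rho>)"
proof -
  have "(\<lambda>z. of_bool (z \<in> E)) \<in> bm (\<rho> \<Otimes>\<^sub>M \<rho>)"
    using E_sets sets.sets_into_space[OF E_sets] by (intro bm_of_bool) (simp add: Int_def[symmetric] Int_absorb1)
  then show ?thesis by (simp add: adj_def case_prod_beta')
qed

lemma kern_bm: "(\<lambda>(x, y). kern x y) \<in> bm (\<rho> \<Otimes>\<^sub>M \<rho>)"
proof -
  have "(\<lambda>z. (1 / p) * (case z of (x, y) \<Rightarrow> adj x y) - 1) \<in> bm (\<rho> \<Otimes>\<^sub>M \<rho>)"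
    by (intro bm_diff bm_mult bm_const adj_bm)
  then show ?thesis by (simp add: kern_def case_prod_beta')
qed

lemma neighbourhood_sets: "E `` {x} \<in> sets \<rho>"
proof -
  have "E `` {x} = Pair x -` E" by auto
  then show ?thesis using sets_Pair1[OF E_sets] by simp
qed

lemma adj_eq_indicator: "adj x = indicator (E `` {x})"
  by (auto simp: adj_def indicator_def)

lemma integral_adj: "x \<in> space \<rho> \<Longrightarrow> (\<integral>y. adj x y \<partial>\<rho>) = p"
  using neighbourhood_sets degree by (simp add: adj_eq_indicator)

lemma p_le_1: "p \<le> 1"
  using degree not_empty prob_le_1 by fastforce

lemma integral_kern: "x \<in> space \<rho> \<Longrightarrow> (\<integral>y. kern x y \<partial>\<rho>) = 0"
  using p_pos bm_integrable[OF bm_section[OF adj_bm]] integral_adj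
  by (simp add: kern_def prob_space)

lemma gram_kern_diag: "x \<in> space \<rho> \<Longrightarrow> gram kern x x \<le> 1 / p"
proof -
  assume x: "x \<in> space \<rho>"
  have i: "integrable \<rho> (adj x)" by (rule bm_integrable[OF bm_section[OF adj_bm x]])
  have "kern x z * kern x z = adj x z * (1 / p\<^sup>2 - 2 / p) + 1" for z
    using p_pos by (cases "(x, z) \<in> E") (auto simp: kern_def adj_def field_simps power2_eq_square)
  then have "gram kern x x = p * (1 / p\<^sup>2 - 2 / p) + 1"
    using i integral_adj[OF x] by (simp add: gram_def prob_space)
  also have "\<dots> \<le> 1 / p" using p_pos by (simp add: field_simps power2_eq_square)
  finally show ?thesis .
qed

lemma avg_bm: "f \<in> bm \<rho> \<Longrightarrow> avg f \<in> bm \<rho>"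
  using bm_mult[OF kernel_apply_bm[OF adj_bm, of f] bm_const[of "1 / p"]]
  by (simp add: avg_def[abs_def])

lemma integral_avg:
  assumes f: "f \<in> bm \<rho>"
  shows "(\<integral>x. avg f x \<partial>\<rho>) = (\<integral>x. f x \<partial>\<rho>)"
proof -
  have "(\<integral>x. avg f x \<partial>\<rho>) = (\<integral>x. (\<integral>y. adj x y * f y \<partial>\<rho>) * 1 \<partial>\<rho>) / p"
    by (simp add: avg_def)
  also have "\<dots> = (\<integral>x. f x * (\<integral>y. adj x y * 1 \<partial>\<rho>) \<partial>\<rho>) / p"
    by (subst kernel_self_adjoint[OF adj_bm adj_commute f bm_const]) simp
  also have "(\<integral>x. f x * (\<integral>y. adj x y * 1 \<partial>\<rho>) \<partial>\<rho>) = (\<integral>x. f x * p \<partial>\<rho>)"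
    by (intro lint_cong) (simp add: integral_adj)
  finally show ?thesis using p_pos by simp
qed

lemma integral_kern_eq_avg:
  assumes f: "f \<in> bm \<rho>" and x: "x \<in> space \<rho>"
  shows "(\<integral>y. kern x y * (f y - b) \<partial>\<rho>) = avg f x - (\<integral>y. f y \<partial>\<rho>)"
proof -
  have 1: "integrable \<rho> (\<lambda>y. adj x y * f y)" "integrable \<rho> f" "integrable \<rho> (kern x)"
    using f bm_section[OF adj_bm x] bm_section[OF kern_bm x] by (auto intro!: bm_integrable)
  have "(\<integral>y. kern x y * (f y - b) \<partial>\<rho>) = (\<integral>y. (1 / p) * (adj x y * f y) - f y - b * kern x y \<partial>\<rho>)"
    using p_pos by (intro lint_cong) (simp add: kern_def field_simps)
  also have "\<dots> = avg f x - (\<integral>y. f y \<partial>\<rho>)"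
    using 1 integral_kern[OF x] by (simp add: avg_def)
  finally show ?thesis .
qed

text \<open>Uniform decay of \<^term>\<open>(avg ^^ m) (adj y)\<close> loses a constant, but self-adjointness makes the
  \<open>L\<^sup>2\<close> norms of the iterates log-convex, so that the rate already bounds the first step.\<close>

lemma contraction_if_decay:
  assumes decay: "\<And>m x y. x \<in> space \<rho> \<Longrightarrow> y \<in> space \<rho> \<Longrightarrow> \<bar>(avg ^^ m) (adj y) x - p\<bar> \<le> C * lam ^ m"
    and S: "finite S" and s: "\<And>a. a \<in> S \<Longrightarrow> s a \<in> space \<rho>"
  shows "ip S c (app (\<lambda>a b. gram (gram kern) (s a) (s b)) S c)
    \<le> lam\<^sup>2 * ip S c (app (\<lambda>a b. gram kern (s a) (s b)) S c)"
proof -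
  define w where "w m a = (avg ^^ m) (adj (s a))" for m a
  \<comment> \<open>This is the operator of \<open>kern\<close> applied \<open>m\<close> times to
    the combination of the functions \<open>kern (s a)\<close> with coefficients \<open>c a\<close>,
    expressed through the walk so that the decay can be inserted.\<close>
  define g where "g m x = (\<Sum>a\<in>S. c a / p * (w m a x - p))" for m x
  have w_bm: "w m a \<in> bm \<rho>" if "a \<in> S" for m a
    unfolding w_def by (induction m) (auto intro!: avg_bm bm_section[OF adj_bm s[OF that]])
  have w_int: "(\<integral>x. w m a x \<partial>\<rho>) = p" if "a \<in> S" for m a
  proof (induction m)
    case 0
    then show ?case using integral_adj[OF s[OF that]] by (simp add: w_def)
  next
    case (Suc m)
    then show ?case using integral_avg[OF w_bm[OF that, of m]] by (simp add: w_def)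
  qed
  have g_bm: "g m \<in> bm \<rho>" for m
    unfolding g_def[abs_def] by (intro bm_sum bm_mult bm_diff bm_const w_bm)
  have g_Suc: "(\<integral>y. kern x y * g m y \<partial>\<rho>) = g (Suc m) x" if x: "x \<in> space \<rho>" for m x
  proof -
    have "(\<integral>y. kern x y * g m y \<partial>\<rho>) = (\<integral>y. (\<Sum>a\<in>S. c a / p * (kern x y * (w m a y - p))) \<partial>\<rho>)"
      by (simp add: g_def sum_distrib_left mult_ac)
    also have "\<dots> = (\<Sum>a\<in>S. \<integral>y. c a / p * (kern x y * (w m a y - p)) \<partial>\<rho>)"
      by (intro Bochner_Integration.integral_sum bm_integrable bm_mult bm_diff bm_const w_bm bm_section[OF kern_bm x])
    also have "\<dots> = (\<Sum>a\<in>S. c a / p * (w (Suc m) a x - p))"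
    proof (intro sum.cong refl)
      fix a assume a: "a \<in> S"
      have "(\<integral>y. c a / p * (kern x y * (w m a y - p)) \<partial>\<rho>) = c a / p * (\<integral>y. kern x y * (w m a y - p) \<partial>\<rho>)"
        by (rule Bochner_Integration.integral_mult_right_zero)
      also have "\<dots> = c a / p * (w (Suc m) a x - p)"
        using integral_kern_eq_avg[OF w_bm[OF a, of m] x, of p] w_int[OF a, of m] by (simp add: w_def)
      finally show "(\<integral>y. c a / p * (kern x y * (w m a y - p)) \<partial>\<rho>) = c a / p * (w (Suc m) a x - p)" .
    qed
    finally show ?thesis by (simp add: g_def)
  qed
  define A where "A m = (\<integral>x. (g m x)\<^sup>2 \<partial>\<rho>)" for m
  have "(A (Suc m))\<^sup>2 \<le> A m * A (Suc (Suc m))" for m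
  proof -
    have "A (Suc m) = (\<integral>x. (\<integral>y. kern x y * g m y \<partial>\<rho>) * g (Suc m) x \<partial>\<rho>)"
      unfolding A_def by (intro lint_cong) (simp add: g_Suc power2_eq_square)
    also have "\<dots> = (\<integral>x. g m x * (\<integral>y. kern x y * g (Suc m) y \<partial>\<rho>) \<partial>\<rho>)"
      by (rule kernel_self_adjoint[OF kern_bm kern_commute g_bm g_bm])
    also have "\<dots> = (\<integral>x. g m x * g (Suc (Suc m)) x \<partial>\<rho>)"
      by (intro lint_cong) (simp add: g_Suc)
    finally show ?thesis using integral_CS[OF g_bm g_bm] by (simp add: A_def)
  qed
  moreover have "0 \<le> A m" for m by (simp add: A_def)
  ultimately have lc: "log_convex A" by (simp add: log_convex_def)
  \<comment> \<open>The factor may depend on \<open>c\<close>, on \<open>S\<close> and on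
    \<open>C\<close>, since only the rate in \<open>m\<close> survives
    \<open>log_convex_growth\<close>.\<close>
  define D where "D = (\<Sum>a\<in>S. \<bar>c a\<bar> / p) * C"
  have g_le: "\<bar>g m x\<bar> \<le> \<bar>D * lam ^ m\<bar>" if x: "x \<in> space \<rho>" for m x
  proof -
    have "\<bar>g m x\<bar> \<le> (\<Sum>a\<in>S. \<bar>c a\<bar> / p * (C * lam ^ m))"
      unfolding g_def using p_pos decay[OF x s]
      by (intro order_trans[OF sum_abs] sum_mono) (auto simp: abs_mult w_def intro!: mult_left_mono divide_right_mono)
    also have "\<dots> = D * lam ^ m" unfolding D_def sum_distrib_right by (simp add: mult_ac)
    finally show ?thesis by simp
  qed
  have "A m \<le> D\<^sup>2 * (lam\<^sup>2) ^ m" for m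
  proof -
    have "A m \<le> (D * lam ^ m)\<^sup>2"
      unfolding A_def
      using g_le by (intro integral_le_const bm_integrable bm_power g_bm) (auto simp: abs_le_square_iff)
    then show ?thesis by (simp add: power_mult_distrib power_mult[symmetric] mult.commute)
  qed
  from log_convex_growth[OF lc _ this] have "A 1 \<le> lam\<^sup>2 * A 0" by simp
  moreover have g0: "g 0 z = (\<Sum>a\<in>S. c a * kern (s a) z)" for z
    using p_pos by (simp add: g_def w_def kern_def field_simps)
  then have "A 0 = ip S c (app (\<lambda>a b. gram kern (s a) (s b)) S c)"
    by (simp add: A_def gram_form[OF kern_bm s])
  moreover have "g 1 z = (\<Sum>a\<in>S. c a * gram kern (s a) z)" if z: "z \<in> space \<rho>" for z
  proof -
    have "g 1 z = (\<integral>y. (\<Sum>a\<in>S. c a * (kern (s a) y * kern z y)) \<partial>\<rho>)"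
      using g_Suc[OF z, of 0] g0 by (simp add: sum_distrib_left mult_ac)
    also have "\<dots> = (\<Sum>a\<in>S. \<integral>y. c a * (kern (s a) y * kern z y) \<partial>\<rho>)"
      by (intro Bochner_Integration.integral_sum bm_integrable bm_mult bm_const bm_section[OF kern_bm] z s)
    finally show ?thesis by (simp add: gram_def)
  qed
  then have "A 1 = ip S c (app (\<lambda>a b. gram (gram kern) (s a) (s b)) S c)"
    by (simp add: A_def gram_form[OF gram_bm[OF kern_bm] s] cong: Bochner_Integration.integral_cong)
  ultimately show ?thesis by simp
qed

end

section \<open>Transitive graphs\<close>

context measured_graph
begin

lemma edges_subset: "E \<subseteq> space M \<times> space M"
  using sets.sets_into_space[OF E_sets] by (simp add: space_pair_measure)

lemma neighbours_sets: "E `` {x} \<in> sets M"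
proof -
  have "E `` {x} = Pair x -` E" by auto
  then show ?thesis using sets_Pair1[OF E_sets] by simp
qed

lemma automorphism_neighbours:
  assumes "graph_automorphism M E \<phi>" "x \<in> space M"
  shows "\<phi> -` (E `` {\<phi> x}) \<inter> space M = E `` {x}"
  using assms edges_subset by (auto simp: graph_automorphism_def)

lemma automorphism_emeasure:
  assumes "graph_automorphism M E \<phi>" "A \<in> sets M"
  shows "emeasure M (\<phi> -` A \<inter> space M) = emeasure M A"
proof -
  have "\<phi> \<in> M \<rightarrow>\<^sub>M M" "distr M M \<phi> = M" using assms by (auto simp: graph_automorphism_def)
  then show ?thesis using emeasure_distr[of \<phi> M M A] assms(2) by simp
qed

lemma emeasure_walk_kernel:
  "A \<in> sets M \<Longrightarrow> emeasure (walk_kernel M E x) A = emeasure M (E `` {x} \<inter> A) / emeasure M (E `` {x})"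
  unfolding walk_kernel_def by (rule emeasure_uniform_measure[OF neighbours_sets])

lemma automorphism_walk_kernel:
  assumes \<phi>: "graph_automorphism M E \<phi>" and x: "x \<in> space M" and A: "A \<in> sets M"
  shows "emeasure (walk_kernel M E (\<phi> x)) A = emeasure (walk_kernel M E x) (\<phi> -` A \<inter> space M)"
proof -
  have "\<phi> \<in> M \<rightarrow>\<^sub>M M" using \<phi> by (auto simp: graph_automorphism_def)
  then have A': "\<phi> -` A \<inter> space M \<in> sets M" using A by (rule measurable_sets)
  have "emeasure M (E `` {\<phi> x} \<inter> A) = emeasure M (\<phi> -` (E `` {\<phi> x} \<inter> A) \<inter> space M)"
    using A neighbours_sets by (intro automorphism_emeasure[OF \<phi>, symmetric] sets.Int)
  also have "\<phi> -` (E `` {\<phi> x} \<inter> A) \<inter> space M = E `` {x} \<inter> (\<phi> -` A \<inter> space M)"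
    using automorphism_neighbours[OF \<phi> x] by blast
  finally have "emeasure M (E `` {\<phi> x} \<inter> A) = emeasure M (E `` {x} \<inter> (\<phi> -` A \<inter> space M))" .
  moreover have "emeasure M (E `` {\<phi> x}) = emeasure M (E `` {x})"
    using automorphism_emeasure[OF \<phi> neighbours_sets, of "\<phi> x"] automorphism_neighbours[OF \<phi> x] by simp
  ultimately show ?thesis
    using A A' by (simp add: emeasure_walk_kernel)
qed

text \<open>An automorphism carries the walk from \<open>x\<close> to the walk from its image, so it
  maps the stationary measure to a stationary measure, and uniqueness applies.\<close>

lemma automorphism_invariant:
  assumes us: "unique_stationary M E \<rho>" and \<phi>: "graph_automorphism M E \<phi>" and A: "A \<in> sets M"
  shows "emeasure \<rho> (\<phi> -` A \<inter> space M) = emeasure \<rho> A"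
proof -
  have \<rho>: "\<rho> \<in> space (prob_algebra M)" and st: "walk M E \<rho> = \<rho>"
    using us by (auto simp: unique_stationary_def stationary_def)
  have s: "sets \<rho> = sets M" and pr: "prob_space \<rho>" using \<rho> by (auto simp: space_prob_algebra)
  have sp: "space \<rho> = space M" using s by (rule sets_eq_imp_space_eq)
  have m: "\<phi> \<in> M \<rightarrow>\<^sub>M M" using \<phi> by (auto simp: graph_automorphism_def)
  then have m': "\<phi> \<in> \<rho> \<rightarrow>\<^sub>M M" using measurable_cong_sets[OF s refl] by blast
  define \<nu> where "\<nu> = distr \<rho> M \<phi>"
  have \<nu>: "\<nu> \<in> space (prob_algebra M)"
    unfolding \<nu>_def using prob_space.prob_space_distr[OF pr m'] by (simp add: space_prob_algebra)
  have "walk M E \<nu> = \<nu>"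
  proof (rule measure_eqI)
    have w: "sets (walk M E \<nu>) = sets M"
      using walk_in_prob_algebra[OF \<nu>] by (simp add: space_prob_algebra)
    then show "sets (walk M E \<nu>) = sets \<nu>" by (simp add: \<nu>_def)
    fix B assume "B \<in> sets (walk M E \<nu>)"
    then have B: "B \<in> sets M" using w by simp
    have B': "\<phi> -` B \<inter> space M \<in> sets M" using m B by (rule measurable_sets)
    have meas: "(\<lambda>x. emeasure (walk_kernel M E x) B) \<in> borel_measurable M"
      using measurable_compose[OF measurable_prob_algebraD[OF walk_kernel_measurable] measurable_emeasure_subprob_algebra[OF B]] .
    have "emeasure (walk M E \<nu>) B = (\<integral>\<^sup>+x. emeasure (walk_kernel M E x) B \<partial>\<nu>)"
      unfolding walk_def by (rule emeasure_bind_prob_algebra[OF \<nu> walk_kernel_measurable B])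
    also have "\<dots> = (\<integral>\<^sup>+x. emeasure (walk_kernel M E (\<phi> x)) B \<partial>\<rho>)"
      unfolding \<nu>_def using meas by (intro nn_integral_distr[OF m']) simp
    also have "\<dots> = (\<integral>\<^sup>+x. emeasure (walk_kernel M E x) (\<phi> -` B \<inter> space M) \<partial>\<rho>)"
      by (intro nn_integral_cong automorphism_walk_kernel[OF \<phi> _ B]) (simp add: sp)
    also have "\<dots> = emeasure (walk M E \<rho>) (\<phi> -` B \<inter> space M)"
      unfolding walk_def by (rule emeasure_bind_prob_algebra[OF \<rho> walk_kernel_measurable B', symmetric])
    also have "\<dots> = emeasure \<nu> B"
      unfolding st \<nu>_def using emeasure_distr[OF m' B] by (simp add: sp)
    finally show "emeasure (walk M E \<nu>) B = emeasure \<nu> B" .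
  qed
  then have "\<nu> = \<rho>" using us \<nu> by (auto simp: unique_stationary_def stationary_def)
  then show ?thesis using emeasure_distr[OF m' A] by (simp add: \<nu>_def sp)
qed

text \<open>Uniqueness makes the stationary measure invariant under automorphisms, so by transitivity its
  density with respect to \<^term>\<open>M\<close> is constant.\<close>

lemma transitive_stationary:
  assumes vt: "vertex_transitive M E" and us: "unique_stationary M E \<rho>"
  obtains c where "0 < c" "\<And>x. x \<in> space M \<Longrightarrow> measure \<rho> (E `` {x}) = c"
    "\<And>x A. x \<in> space M \<Longrightarrow> A \<in> sets M \<Longrightarrow>
      emeasure (walk_kernel M E x) A = emeasure \<rho> (E `` {x} \<inter> A) / ennreal c"
proof -
  have \<rho>: "\<rho> \<in> space (prob_algebra M)" and st: "walk M E \<rho> = \<rho>"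
    using us by (auto simp: unique_stationary_def stationary_def)
  have s: "sets \<rho> = sets M" and pr: "prob_space \<rho>" using \<rho> by (auto simp: space_prob_algebra)
  interpret \<rho>: prob_space \<rho> by (rule pr)
  interpret PS: pair_sigma_finite \<rho> M ..
  have sp: "space \<rho> = space M" using s by (rule sets_eq_imp_space_eq)
  obtain x0 where x0: "x0 \<in> space M" using \<rho>.not_empty sp by auto
  define d where "d = emeasure M (E `` {x0})"
  define r where "r = emeasure \<rho> (E `` {x0})"
  have d: "d > 0" "d < \<infinity>" using degree_pos[OF x0] degree_finite[OF x0] by (auto simp: d_def)
  have const: "emeasure M (E `` {x}) = d \<and> emeasure \<rho> (E `` {x}) = r" if x: "x \<in> space M" for x
  proof -
    obtain \<phi> where \<phi>: "graph_automorphism M E \<phi>" "\<phi> x0 = x"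
      using vt x x0 unfolding vertex_transitive_def by blast
    show ?thesis
      using automorphism_emeasure[OF \<phi>(1) neighbours_sets, of x]
        automorphism_invariant[OF us \<phi>(1) neighbours_sets, of x]
        automorphism_neighbours[OF \<phi>(1) x0] \<phi>(2) by (simp add: d_def r_def)
  qed
  \<comment> \<open>Stationarity writes \<open>\<rho>(A)\<close> as a double integral over edges
    ending in \<open>A\<close>. Integrating over the start first, by symmetry of \<open>E\<close>,
    produces the constant \<open>r\<close> for each endpoint.\<close>
  have \<rho>_eq: "emeasure \<rho> A = r * emeasure M A / d" if A: "A \<in> sets M" for A
  proof -
    let ?f = "\<lambda>(x, y). indicator E (x, y) * indicator A y :: ennreal"
    have E': "E \<in> sets (\<rho> \<Otimes>\<^sub>M M)" using E_sets by (simp add: sets_pair_measure_cong[OF s refl])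
    have f: "?f \<in> borel_measurable (\<rho> \<Otimes>\<^sub>M M)"
      using E' A by (simp add: case_prod_beta')
    have "emeasure \<rho> A = (\<integral>\<^sup>+x. emeasure (walk_kernel M E x) A \<partial>\<rho>)"
      using emeasure_bind_prob_algebra[OF \<rho> walk_kernel_measurable A] st by (simp add: walk_def)
    also have "\<dots> = (\<integral>\<^sup>+x. (\<integral>\<^sup>+y. ?f (x, y) \<partial>M) / d \<partial>\<rho>)"
    proof (rule nn_integral_cong)
      fix x assume "x \<in> space \<rho>"
      then have x: "x \<in> space M" by (simp add: sp)
      have "(\<integral>\<^sup>+y. ?f (x, y) \<partial>M) = (\<integral>\<^sup>+y. indicator (E `` {x} \<inter> A) y \<partial>M)"
        by (intro nn_integral_cong) (auto simp: indicator_def)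
      also have "\<dots> = emeasure M (E `` {x} \<inter> A)" using A neighbours_sets by simp
      finally show "emeasure (walk_kernel M E x) A = (\<integral>\<^sup>+y. ?f (x, y) \<partial>M) / d"
        using A const[OF x] by (simp add: emeasure_walk_kernel)
    qed
    also have "\<dots> = (\<integral>\<^sup>+x. (\<integral>\<^sup>+y. ?f (x, y) \<partial>M) \<partial>\<rho>) / d"
      by (rule nn_integral_divide[OF borel_measurable_nn_integral_fst[OF f]])
    also have "(\<integral>\<^sup>+x. (\<integral>\<^sup>+y. ?f (x, y) \<partial>M) \<partial>\<rho>) = (\<integral>\<^sup>+y. (\<integral>\<^sup>+x. ?f (x, y) \<partial>\<rho>) \<partial>M)"
      using PS.Fubini[OF f] by simp
    also have "\<dots> = (\<integral>\<^sup>+y. r * indicator A y \<partial>M)"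
    proof (rule nn_integral_cong)
      fix y assume y: "y \<in> space M"
      have "(\<integral>\<^sup>+x. ?f (x, y) \<partial>\<rho>) = (\<integral>\<^sup>+x. indicator A y * indicator (E `` {y}) x \<partial>\<rho>)"
        using E_sym by (intro nn_integral_cong) (auto simp: indicator_def sym_def)
      also have "\<dots> = r * indicator A y"
        using const[OF y] neighbours_sets s by (simp add: nn_integral_cmult mult.commute)
      finally show "(\<integral>\<^sup>+x. ?f (x, y) \<partial>\<rho>) = r * indicator A y" .
    qed
    also have "\<dots> = r * emeasure M A" using A by (simp add: nn_integral_cmult)
    finally show ?thesis .
  qed
  have r0: "r \<noteq> 0"
  proof
    assume "r = 0"
    then have "emeasure \<rho> (space M) = 0" using \<rho>_eq[of "space M"] by simp
    then show False using \<rho>.emeasure_space_1 sp by simp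
  qed
  have r: "r = ennreal (measure \<rho> (E `` {x0}))" by (simp add: r_def \<rho>.emeasure_eq_measure)
  show ?thesis
  proof (rule that[of "measure \<rho> (E `` {x0})"])
    show "0 < measure \<rho> (E `` {x0})" using r0 r by (cases "measure \<rho> (E `` {x0}) = 0") (auto simp: less_le)
    show "measure \<rho> (E `` {x}) = measure \<rho> (E `` {x0})" if "x \<in> space M" for x
      using const[OF that] by (simp add: measure_def r_def)
    fix x A assume x: "x \<in> space M" and A: "A \<in> sets M"
    have "emeasure \<rho> (E `` {x} \<inter> A) / r = r * emeasure M (E `` {x} \<inter> A) / d / r"
      using A neighbours_sets by (subst \<rho>_eq) auto
    also have "\<dots> = (r / r) * (emeasure M (E `` {x} \<inter> A) / d)"
      by (simp add: divide_ennreal_def mult_ac)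
    also have "r / r = 1" using r0 r by (intro ennreal_divide_self) auto
    finally show "emeasure (walk_kernel M E x) A = emeasure \<rho> (E `` {x} \<inter> A) / ennreal (measure \<rho> (E `` {x0}))"
      using A const[OF x] r by (simp add: emeasure_walk_kernel)
  qed
qed

text \<open>The decay is tested on walks started from a point mass and on the single event of
  landing in a neighbourhood; this already gives the uniform pointwise estimate.\<close>

lemma transitive_regular_graph:
  assumes vt: "vertex_transitive M E" and us: "unique_stationary M E \<rho>"
    and decay: "\<And>k \<alpha>. \<alpha> \<in> space (prob_algebra M) \<Longrightarrow> tv_dist ((walk M E ^^ k) \<alpha>) \<rho> \<le> C * lam ^ k"
  obtains c where "regular_graph \<rho> E c"
    "\<And>m x y. x \<in> space \<rho> \<Longrightarrow> y \<in> space \<rho> \<Longrightarrow>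
      \<bar>(regular_graph.avg \<rho> E c ^^ m) (regular_graph.adj E y) x - c\<bar> \<le> C * lam ^ m"
proof -
  obtain c where c: "0 < c" "\<And>x. x \<in> space M \<Longrightarrow> measure \<rho> (E `` {x}) = c"
    and \<kappa>: "\<And>x A. x \<in> space M \<Longrightarrow> A \<in> sets M \<Longrightarrow>
      emeasure (walk_kernel M E x) A = emeasure \<rho> (E `` {x} \<inter> A) / ennreal c"
    using transitive_stationary[OF vt us] by metis
  have \<rho>: "\<rho> \<in> space (prob_algebra M)" and st: "walk M E \<rho> = \<rho>"
    using us by (auto simp: unique_stationary_def stationary_def)
  have s: "sets \<rho> = sets M" and pr: "prob_space \<rho>" using \<rho> by (auto simp: space_prob_algebra)
  have sp: "space \<rho> = space M" using s by (rule sets_eq_imp_space_eq)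
  interpret R: regular_graph \<rho> E c
  proof (intro regular_graph.intro[OF pr] regular_graph_axioms.intro)
    show "E \<in> sets (\<rho> \<Otimes>\<^sub>M \<rho>)" using E_sets by (simp add: sets_pair_measure_cong[OF s s])
  qed (use E_sym E_irrefl c sp in auto)
  \<comment> \<open>Relative to \<open>\<rho>\<close> the walk kernel has an explicit density, which
    identifies the walk on measures with \<open>avg\<close> on functions.\<close>
  have kernel: "walk_kernel M E x = density \<rho> (\<lambda>y. ennreal (R.adj x y / c))" if x: "x \<in> space M" for x
  proof (rule measure_eqI)
    show "sets (walk_kernel M E x) = sets (density \<rho> (\<lambda>y. ennreal (R.adj x y / c)))"
      by (simp add: walk_kernel_def s)
    fix A assume "A \<in> sets (walk_kernel M E x)"
    then have A: "A \<in> sets M" by (simp add: walk_kernel_def)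
    have "emeasure (density \<rho> (\<lambda>y. ennreal (R.adj x y / c))) A = (\<integral>\<^sup>+y. ennreal (R.adj x y / c) * indicator A y \<partial>\<rho>)"
      using A s neighbours_sets by (intro emeasure_density) (auto simp: R.adj_eq_indicator)
    also have "\<dots> = (\<integral>\<^sup>+y. ennreal (1 / c) * indicator (E `` {x} \<inter> A) y \<partial>\<rho>)"
      by (intro nn_integral_cong) (auto simp: R.adj_def indicator_def)
    also have "\<dots> = ennreal (1 / c) * emeasure \<rho> (E `` {x} \<inter> A)"
      using A s neighbours_sets by (simp add: nn_integral_cmult)
    also have "\<dots> = emeasure \<rho> (E `` {x} \<inter> A) / ennreal c"
      using c(1) by (simp add: divide_ennreal_def inverse_ennreal divide_inverse mult.commute)
    finally show "emeasure (walk_kernel M E x) A = emeasure (density \<rho> (\<lambda>y. ennreal (R.adj x y / c))) A"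
      using \<kappa>[OF x A] by simp
  qed
  have w_bm: "(R.avg ^^ m) (R.adj y) \<in> bm \<rho>" if "y \<in> space \<rho>" for m y
    by (induction m) (auto intro!: R.avg_bm R.bm_section[OF R.adj_bm that])
  have w_nn: "0 \<le> (R.avg ^^ m) (R.adj y) x" for m x y
    by (induction m arbitrary: x) (auto simp: R.adj_def R.avg_def c(1) less_imp_le intro!: integral_nonneg divide_nonneg_nonneg)
  \<comment> \<open>Duality between the walk and \<open>avg\<close>. The induction peels off the
    first step of the walk, so it has to range over all initial distributions.\<close>
  have walk: "emeasure ((walk M E ^^ m) \<alpha>) (E `` {y}) = (\<integral>\<^sup>+x. ennreal ((R.avg ^^ m) (R.adj y) x) \<partial>\<alpha>)"
    if y: "y \<in> space \<rho>" and \<alpha>: "\<alpha> \<in> space (prob_algebra M)" for m y \<alpha>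
    using \<alpha>
  proof (induction m arbitrary: \<alpha>)
    case 0
    then have "sets \<alpha> = sets M" by (simp add: space_prob_algebra)
    then show ?case using neighbours_sets by (simp add: R.adj_eq_indicator ennreal_indicator)
  next
    case (Suc m)
    let ?w = "(R.avg ^^ m) (R.adj y)"
    have \<alpha>s: "sets \<alpha> = sets M" using Suc.prems by (simp add: space_prob_algebra)
    have wm: "?w \<in> borel_measurable \<rho>" using bm_measurable[OF w_bm[OF y]] .
    have wm': "?w \<in> borel_measurable M" using wm measurable_cong_sets[OF s refl] by blast
    have k: "walk_kernel M E \<in> \<alpha> \<rightarrow>\<^sub>M subprob_algebra M"
      using measurable_prob_algebraD[OF walk_kernel_measurable] measurable_cong_sets[OF \<alpha>s refl] by blast
    have "emeasure ((walk M E ^^ Suc m) \<alpha>) (E `` {y}) = (\<integral>\<^sup>+x. ennreal (?w x) \<partial>(walk M E \<alpha>))"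
      using Suc.IH[OF walk_in_prob_algebra[OF Suc.prems]] by (simp add: funpow_swap1)
    also have "\<dots> = (\<integral>\<^sup>+x. \<integral>\<^sup>+z. ennreal (?w z) \<partial>walk_kernel M E x \<partial>\<alpha>)"
      unfolding walk_def using wm' by (intro nn_integral_bind[OF _ k]) simp
    also have "\<dots> = (\<integral>\<^sup>+x. ennreal ((R.avg ^^ Suc m) (R.adj y) x) \<partial>\<alpha>)"
    proof (rule nn_integral_cong)
      fix x assume "x \<in> space \<alpha>"
      then have x: "x \<in> space M" using sets_eq_imp_space_eq[OF \<alpha>s] by simp
      have a_bm: "R.adj x \<in> bm \<rho>" using x by (intro R.bm_section[OF R.adj_bm]) (simp add: sp)
      have "(\<integral>\<^sup>+z. ennreal (?w z) \<partial>walk_kernel M E x) = (\<integral>\<^sup>+z. ennreal (R.adj x z / c) * ennreal (?w z) \<partial>\<rho>)"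
        unfolding kernel[OF x] using wm bm_measurable[OF a_bm] by (intro nn_integral_density) auto
      also have "\<dots> = (\<integral>\<^sup>+z. ennreal (R.adj x z * ?w z * (1 / c)) \<partial>\<rho>)"
        using c(1) w_nn by (intro nn_integral_cong) (simp add: ennreal_mult'[symmetric] R.adj_def)
      also have "\<dots> = ennreal (\<integral>z. R.adj x z * ?w z * (1 / c) \<partial>\<rho>)"
        using c(1) w_nn by (intro nn_integral_eq_integral R.bm_integrable bm_mult a_bm w_bm[OF y] bm_const)
          (auto simp: R.adj_def)
      also have "(\<integral>z. R.adj x z * ?w z * (1 / c) \<partial>\<rho>) = R.avg ?w x" by (simp add: R.avg_def)
      finally show "(\<integral>\<^sup>+z. ennreal (?w z) \<partial>walk_kernel M E x) = ennreal ((R.avg ^^ Suc m) (R.adj y) x)" by simp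
    qed
    finally show ?case .
  qed
  show ?thesis
  proof (rule that[OF R.regular_graph_axioms])
    fix m x y assume x: "x \<in> space \<rho>" and y: "y \<in> space \<rho>"
    let ?w = "(R.avg ^^ m) (R.adj y)"
    let ?\<mu> = "(walk M E ^^ m) (return M x)"
    have ret: "return M x \<in> space (prob_algebra M)"
      using x sp by (simp add: space_prob_algebra prob_space_return)
    have "?\<mu> \<in> space (prob_algebra M)"
      using ret by (induction m) (auto intro: walk_in_prob_algebra)
    then have \<mu>: "prob_space ?\<mu>" "sets ?\<mu> = sets M" by (auto simp: space_prob_algebra)
    have "?w \<in> borel_measurable M"
      using bm_measurable[OF w_bm[OF y]] measurable_cong_sets[OF s refl] by blast
    then have "emeasure ?\<mu> (E `` {y}) = ennreal (?w x)"
      using walk[OF y ret, of m] x sp by (simp add: nn_integral_return)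
    then have "measure ?\<mu> (E `` {y}) = ?w x" using w_nn by (simp add: measure_def)
    moreover have "measure \<rho> (E `` {y}) = c" using c(2) y sp by simp
    moreover have "\<bar>measure ?\<mu> (E `` {y}) - measure \<rho> (E `` {y})\<bar> \<le> tv_dist ?\<mu> \<rho>"
      unfolding tv_dist_def
    proof (rule cSUP_upper)
      show "E `` {y} \<in> sets ?\<mu>" using \<mu> neighbours_sets by simp
      have "\<bar>measure ?\<mu> A - measure \<rho> A\<bar> \<le> 1" for A
        using prob_space.prob_le_1[OF \<mu>(1), of A] R.prob_le_1[of A]
          measure_nonneg[of ?\<mu> A] measure_nonneg[of \<rho> A] unfolding abs_le_iff by linarith
      then show "bdd_above ((\<lambda>A. \<bar>measure ?\<mu> A - measure \<rho> A\<bar>) ` sets ?\<mu>)" by (intro bdd_aboveI2)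
    qed
    ultimately show "\<bar>?w x - c\<bar> \<le> C * lam ^ m" using decay[OF ret, of m] by simp
  qed
qed

end

section \<open>Concentration of the sample\<close>

context prob_space
begin

lemma bm_markov:
  assumes h: "h \<in> bm M" and nn: "\<And>x. x \<in> space M \<Longrightarrow> 0 \<le> h x" and a: "0 < a"
  shows "prob {x \<in> space M. a < h x} \<le> (\<integral>x. h x \<partial>M) / a"
proof -
  have [measurable]: "h \<in> borel_measurable M" using bm_measurable[OF h] .
  have "prob {x \<in> space M. a < h x} \<le> prob {x \<in> space M. a \<le> h x}"
    by (intro finite_measure_mono) auto
  also have "\<dots> \<le> (\<integral>x. h x \<partial>M) / a"
    using integral_Markov_inequality_measure[OF bm_integrable[OF h] sets.top, of a] nn a by auto
  finally show ?thesis .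
qed

end

lemma exp_le_quadratic:
  fixes t :: real
  assumes "\<bar>t\<bar> \<le> 1"
  shows "exp t \<le> 1 + t + t\<^sup>2"
proof (cases "0 \<le> t")
  case True
  then show ?thesis using exp_bound[of t] assms by simp
next
  case False
  define u where "u = - t"
  have u: "0 < u" "u \<le> 1" using False assms by (auto simp: u_def)
  have "exp (- u) = 1 / exp u" by (simp add: exp_minus divide_inverse)
  also have "\<dots> \<le> 1 / (1 + u)" using u by (intro divide_left_mono) (auto simp: exp_ge_add_one_self)
  also have "\<dots> \<le> 1 - u + u\<^sup>2" 
  proof -
    \<comment> \<open>The product equals \<open>1 + u^3\<close>.\<close>
    have "1 \<le> (1 - u + u\<^sup>2) * (1 + u)" using u by (simp add: algebra_simps power2_eq_square)
    then show ?thesis using u by (simp add: pos_divide_le_eq)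
  qed
  finally show ?thesis by (simp add: u_def)
qed

context regular_graph
begin

lemma adj_component_bm: "a \<in> I \<Longrightarrow> b \<in> I \<Longrightarrow> (\<lambda>X. adj (X a) (X b)) \<in> bm (\<Pi>\<^sub>M i\<in>I. \<rho>)"
  using bm_compose[OF adj_bm, of "\<lambda>X. (X a, X b)" "\<Pi>\<^sub>M i\<in>I. \<rho>"] by simp

text \<open>Given \<open>X i\<close>, the adjacencies to the other points are independent with one
  probability \<open>p\<close>, because all degrees agree. Resampling one \<open>j\<close> after
  another expresses this without conditioning.\<close>

lemma degree_mgf:
  assumes I: "finite I" "i \<in> I" and "J \<subseteq> I - {i}"
  shows "(\<integral>X. (\<Prod>j\<in>J. exp (t * adj (X i) (X j))) \<partial>(\<Pi>\<^sub>M i\<in>I. \<rho>)) = (1 + (exp t - 1) * p) ^ card J"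
    and "(\<lambda>X. \<Prod>j\<in>J. exp (t * adj (X i) (X j))) \<in> bm (\<Pi>\<^sub>M i\<in>I. \<rho>)"
proof -
  let ?P = "\<Pi>\<^sub>M i\<in>I. \<rho>"
  interpret P: prob_space ?P by (rule prob_space_PiM_const)
  have e: "exp (t * adj x y) = 1 + (exp t - 1) * adj x y" for x y by (simp add: adj_def)
  have "finite J" using assms finite_subset by blast
  then have "(\<lambda>X. \<Prod>j\<in>J. exp (t * adj (X i) (X j))) \<in> bm ?P \<and>
    (\<integral>X. (\<Prod>j\<in>J. exp (t * adj (X i) (X j))) \<partial>?P) = (1 + (exp t - 1) * p) ^ card J"
    using assms(3)
  proof (induction J rule: finite_induct)
    case empty
    then show ?case using P.prob_space by auto
  next
    case (insert j J)
    let ?F = "\<lambda>X. \<Prod>j\<in>J. exp (t * adj (X i) (X j))"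
    have IH: "?F \<in> bm ?P" "(\<integral>X. ?F X \<partial>?P) = (1 + (exp t - 1) * p) ^ card J" using insert by auto
    have j: "j \<in> I" "j \<noteq> i" using insert.prems by auto
    let ?h = "\<lambda>X. ?F X * (1 + (exp t - 1) * adj (X i) (X j))"
    have eq: "(\<Prod>j\<in>insert j J. exp (t * adj (X i) (X j))) = ?h X" for X
      using insert.hyps by (simp add: e mult.commute)
    have h: "?h \<in> bm ?P" using IH(1) I(2) j by (intro bm_mult bm_add bm_const adj_component_bm)
    have "(\<integral>X. ?h X \<partial>?P) = (\<integral>X. (\<integral>x. ?h (X(j := x)) \<partial>\<rho>) \<partial>?P)"
      by (rule integral_resample[OF I(1) j(1) h])
    also have "\<dots> = (\<integral>X. ?F X * (1 + (exp t - 1) * p) \<partial>?P)"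
    proof (rule lint_cong)
      fix X assume X: "X \<in> space ?P"
      then have x: "X i \<in> space \<rho>" using I(2) by (rule space_PiM_component)
      have "?F (X(j := x)) = ?F X" for x using insert.hyps j by (intro prod.cong) auto
      then have "?h (X(j := x)) = ?F X * (1 + (exp t - 1) * adj (X i) x)" for x using j by simp
      then show "(\<integral>x. ?h (X(j := x)) \<partial>\<rho>) = ?F X * (1 + (exp t - 1) * p)"
        using bm_integrable[OF bm_section[OF adj_bm x]] integral_adj[OF x] by (simp add: prob_space)
    qed
    also have "\<dots> = (1 + (exp t - 1) * p) ^ card (insert j J)"
      using IH(2) insert.hyps by simp
    finally show ?case using h unfolding eq by simp
  qed
  then show "(\<integral>X. (\<Prod>j\<in>J. exp (t * adj (X i) (X j))) \<partial>?P) = (1 + (exp t - 1) * p) ^ card J"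
    and "(\<lambda>X. \<Prod>j\<in>J. exp (t * adj (X i) (X j))) \<in> bm ?P" by auto
qed

definition deg :: "nat set \<Rightarrow> (nat \<Rightarrow> 'v) \<Rightarrow> nat \<Rightarrow> real" where
  "deg I X i = (\<Sum>j\<in>I - {i}. adj (X i) (X j))"

lemma deg_bm: "i \<in> I \<Longrightarrow> (\<lambda>X. deg I X i) \<in> bm (\<Pi>\<^sub>M i\<in>I. \<rho>)"
  unfolding deg_def by (intro bm_sum adj_component_bm) auto

text \<open>The sign of \<open>t\<close> is left open, so that one computation serves both
  tails.\<close>

lemma degree_chernoff:
  assumes I: "finite I" "i \<in> I" and t: "\<bar>t\<bar> \<le> 1"
  defines "\<mu> \<equiv> real (card I - 1) * p"
  shows "measure (\<Pi>\<^sub>M i\<in>I. \<rho>) {X \<in> space (\<Pi>\<^sub>M i\<in>I. \<rho>). a < t * (deg I X i - \<mu>)} \<le> exp (\<mu> * t\<^sup>2 - a)"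
proof -
  let ?P = "\<Pi>\<^sub>M i\<in>I. \<rho>"
  interpret P: prob_space ?P by (rule prob_space_PiM_const)
  let ?h = "\<lambda>X. \<Prod>j\<in>I - {i}. exp (t * adj (X i) (X j))"
  have h: "?h X = exp (t * deg I X i)" for X
    using I by (simp add: deg_def sum_distrib_left exp_sum)
  have card: "card (I - {i}) = card I - 1" using I by simp
  have "measure ?P {X \<in> space ?P. a < t * (deg I X i - \<mu>)} = measure ?P {X \<in> space ?P. exp (a + t * \<mu>) < ?h X}"
    unfolding h by (intro arg_cong[where f="measure ?P"]) (auto simp: algebra_simps)
  also have "\<dots> \<le> (\<integral>X. ?h X \<partial>?P) / exp (a + t * \<mu>)"
    by (rule P.bm_markov[OF degree_mgf(2)[OF I order_refl]]) (auto intro: prod_nonneg)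
  also have "(\<integral>X. ?h X \<partial>?P) = (1 + (exp t - 1) * p) ^ (card I - 1)"
    using degree_mgf(1)[OF I order_refl] by (simp add: card)
  also have "\<dots> \<le> exp ((exp t - 1) * p) ^ (card I - 1)"
  proof (rule power_mono)
    have "exp t * p \<ge> 0" using p_pos by simp
    then show "0 \<le> 1 + (exp t - 1) * p" using p_le_1 by (simp add: algebra_simps)
  qed (rule exp_ge_add_one_self)
  also have "\<dots> = exp (\<mu> * (exp t - 1))" by (simp add: exp_of_nat_mult[symmetric] \<mu>_def mult_ac)
  also have "\<dots> \<le> exp (\<mu> * (t + t\<^sup>2))"
    using exp_le_quadratic[OF t] p_pos by (simp add: \<mu>_def mult_left_mono)
  also have "exp (\<mu> * (t + t\<^sup>2)) / exp (a + t * \<mu>) = exp (\<mu> * t\<^sup>2 - a)"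
    by (simp add: exp_diff[symmetric] algebra_simps)
  finally show ?thesis by (simp add: divide_right_mono)
qed

lemma degree_concentration:
  assumes I: "finite I" "i \<in> I" and \<eta>: "0 < \<eta>" "\<eta> \<le> 1"
  defines "\<mu> \<equiv> real (card I - 1) * p"
  shows "measure (\<Pi>\<^sub>M i\<in>I. \<rho>) {X \<in> space (\<Pi>\<^sub>M i\<in>I. \<rho>). \<eta> * \<mu> < \<bar>deg I X i - \<mu>\<bar>} \<le> 2 * exp (- \<mu> * \<eta>\<^sup>2 / 4)"
proof -
  let ?P = "\<Pi>\<^sub>M i\<in>I. \<rho>"
  interpret P: prob_space ?P by (rule prob_space_PiM_const)
  \<comment> \<open>The threshold is \<open>(\<eta> / 2) * (\<eta> * \<mu>)\<close>; the choices
    \<open>t = \<eta> / 2\<close> and \<open>t = - \<eta> / 2\<close> are optimal and give the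
    exponent \<open>- \<mu> * \<eta>\<^sup>2 / 4\<close>.\<close>
  let ?A = "\<lambda>t. {X \<in> space ?P. \<eta>\<^sup>2 * \<mu> / 2 < t * (deg I X i - \<mu>)}"
  have [measurable]: "(\<lambda>X. deg I X i) \<in> borel_measurable ?P" using bm_measurable[OF deg_bm[OF I(2)]] .
  have 1: "measure ?P (?A t) \<le> exp (- \<mu> * \<eta>\<^sup>2 / 4)" if "t = \<eta> / 2 \<or> t = - \<eta> / 2" for t
  proof -
    have "measure ?P (?A t) \<le> exp (\<mu> * t\<^sup>2 - \<eta>\<^sup>2 * \<mu> / 2)"
      unfolding \<mu>_def by (rule degree_chernoff[OF I]) (use that \<eta> in auto)
    also have "t\<^sup>2 = \<eta>\<^sup>2 / 4"
      using that by (elim disjE; simp only: power_divide power2_minus; simp)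
    also have "\<mu> * (\<eta>\<^sup>2 / 4) - \<eta>\<^sup>2 * \<mu> / 2 = - \<mu> * \<eta>\<^sup>2 / 4"
      by simp
    finally show ?thesis .
  qed
  have "{X \<in> space ?P. \<eta> * \<mu> < \<bar>deg I X i - \<mu>\<bar>} \<subseteq> ?A (\<eta> / 2) \<union> ?A (- \<eta> / 2)"
  proof (intro subsetI)
    fix X assume X: "X \<in> {X \<in> space ?P. \<eta> * \<mu> < \<bar>deg I X i - \<mu>\<bar>}"
    then consider "\<eta> * \<mu> < deg I X i - \<mu>" | "\<eta> * \<mu> < - (deg I X i - \<mu>)" by fastforce
    then show "X \<in> ?A (\<eta> / 2) \<union> ?A (- \<eta> / 2)"
    proof cases
      case 1
      then have "(\<eta> / 2) * (\<eta> * \<mu>) < (\<eta> / 2) * (deg I X i - \<mu>)" using \<eta> by (intro mult_strict_left_mono) auto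
      then have "\<eta>\<^sup>2 * \<mu> / 2 < \<eta> / 2 * (deg I X i - \<mu>)" by (simp add: power2_eq_square mult_ac)
      then show ?thesis using X by blast
    next
      case 2
      then have "(\<eta> / 2) * (\<eta> * \<mu>) < (\<eta> / 2) * - (deg I X i - \<mu>)" using \<eta> by (intro mult_strict_left_mono) auto
      then have "\<eta>\<^sup>2 * \<mu> / 2 < - \<eta> / 2 * (deg I X i - \<mu>)" by (simp add: power2_eq_square algebra_simps)
      then show ?thesis using X by blast
    qed
  qed
  then have "measure ?P {X \<in> space ?P. \<eta> * \<mu> < \<bar>deg I X i - \<mu>\<bar>} \<le> measure ?P (?A (\<eta> / 2) \<union> ?A (- \<eta> / 2))"
    by (intro P.finite_measure_mono) auto
  also have "\<dots> \<le> measure ?P (?A (\<eta> / 2)) + measure ?P (?A (- \<eta> / 2))"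
    by (intro measure_Un_le) auto
  also have "\<dots> \<le> 2 * exp (- \<mu> * \<eta>\<^sup>2 / 4)" using 1[of "\<eta> / 2"] 1[of "- \<eta> / 2"] by simp
  finally show ?thesis .
qed

text \<open>An edge contributes at most \<open>1 / p\<^sup>2\<close>, a non-edge exactly 1.\<close>

lemma kern_row_bound:
  "(\<Sum>a\<in>I - {i}. (kern (X i) (X a))\<^sup>2) \<le> deg I X i / p\<^sup>2 + card (I - {i})"
proof -
  have "(kern x y)\<^sup>2 \<le> adj x y / p\<^sup>2 + 1" for x y
  proof (cases "(x, y) \<in> E")
    case True
    then have "(kern x y)\<^sup>2 = (1 - p)\<^sup>2 / p\<^sup>2" using p_pos by (simp add: kern_def adj_def field_simps power2_eq_square)
    also have "\<dots> \<le> 1 / p\<^sup>2" using p_pos p_le_1 by (intro divide_right_mono) (auto simp: power_le_one)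
    finally show ?thesis using True by (simp add: adj_def)
  qed (simp add: kern_def adj_def)
  then have "(\<Sum>a\<in>I - {i}. (kern (X i) (X a))\<^sup>2) \<le> (\<Sum>a\<in>I - {i}. adj (X i) (X a) / p\<^sup>2 + 1)"
    by (intro sum_mono)
  then show ?thesis by (simp add: deg_def sum.distrib sum_divide_distrib)
qed

text \<open>Each of the two rounds, for \<open>G\<close> and then for \<open>N\<close>, loses
  \<open>exp \<delta>\<close> in the recursion and again in Markov's inequality. The four losses
  give \<open>exp (4 * \<delta>)\<close> in the square of \<open>t\<close>. The failure terms are
  the two Markov bounds and a union bound over the degrees.\<close>

lemma sample_norm_bound:
  fixes n k :: nat and \<delta> \<eta> C lam :: real
  assumes decay: "\<And>m x y. x \<in> space \<rho> \<Longrightarrow> y \<in> space \<rho> \<Longrightarrow> \<bar>(avg ^^ m) (adj y) x - p\<bar> \<le> C * lam ^ m"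
    and lam: "0 \<le> lam" "1 \<le> lam\<^sup>2 * n * p" and n: "1 \<le> n" and k: "1 \<le> k"
    and \<delta>: "0 < \<delta>" and \<eta>: "0 < \<eta>" "\<eta> \<le> 1"
  defines "I \<equiv> {..<n}"
  defines "\<mu> \<equiv> real (n - 1) * p"
  defines "t \<equiv> n * exp (2 * \<delta>) * max lam (sqrt (8 * k / (n * p * \<delta>)))"
  obtains A where "A \<in> sets (\<Pi>\<^sub>M i\<in>I. \<rho>)"
    "measure (\<Pi>\<^sub>M i\<in>I. \<rho>) A \<ge> 1 - (2 * n * exp (- (k * \<delta>)) + 2 * n * exp (- \<mu> * \<eta>\<^sup>2 / 4))"
    "\<And>X i. X \<in> A \<Longrightarrow> i \<in> I \<Longrightarrow> \<bar>deg I X i - \<mu>\<bar> \<le> \<eta> * \<mu>"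
    "\<And>X. X \<in> A \<Longrightarrow> norm_le (\<lambda>a b. if a = b then 0 else kern (X a) (X b)) I t"
proof -
  let ?P = "\<Pi>\<^sub>M i\<in>I. \<rho>"
  interpret P: prob_space ?P by (rule prob_space_PiM_const)
  interpret K: sym_kernel \<rho> kern lam "1 / p"
  proof
    show "ip S c (app (\<lambda>a b. gram (gram kern) (s a) (s b)) S c)
        \<le> lam\<^sup>2 * ip S c (app (\<lambda>a b. gram kern (s a) (s b)) S c)"
      if "finite S" "\<And>a. a \<in> S \<Longrightarrow> s a \<in> space \<rho>" for S s c
      using decay that by (rule contraction_if_decay)
  qed (rule kern_bm kern_commute gram_kern_diag; assumption?)+
  have I: "finite I" "card I = n" by (auto simp: I_def)
  \<comment> \<open>In both maxima the first entry balances the recursion and the second keeps its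
    exponent below \<open>\<delta>\<close>, for walks of length \<open>2 * k\<close> and row bounds
    \<open>1 / p\<close> and \<open>4 * n / p\<close>. The factor \<open>exp \<delta>\<close> in
    \<open>\<tau>\<close> is the slack for Markov's inequality.\<close>
  define yG where "yG = max (n * lam\<^sup>2 * exp \<delta>) (2 * k / (p * \<delta>))"
  define \<tau> where "\<tau> = yG * exp \<delta>"
  define yN where "yN = max (n * \<tau> * exp \<delta>) (8 * k * n / (p * \<delta>))"
  have pos: "0 < yG" "0 < \<tau>" "0 < yN"
    using p_pos \<delta> k n by (auto simp: yG_def \<tau>_def yN_def less_max_iff_disj)
  have yG: "n * lam\<^sup>2 * exp ((2 * k) * (1 / p) / yG) \<le> yG"
  proof -
    have "2 * k / (p * \<delta>) \<le> yG" by (simp add: yG_def)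
    then have "(2 * k) * (1 / p) / yG \<le> \<delta>"
      using p_pos \<delta> pos by (simp add: field_simps)
    then have "n * lam\<^sup>2 * exp ((2 * k) * (1 / p) / yG) \<le> n * lam\<^sup>2 * exp \<delta>"
      by (intro mult_left_mono) auto
    then show ?thesis by (simp add: yG_def)
  qed
  have yN: "n * \<tau> * exp (2 * k * (4 * n / p) / yN) \<le> yN"
  proof -
    have "8 * k * n / (p * \<delta>) \<le> yN" by (simp add: yN_def)
    then have "2 * k * (4 * n / p) / yN \<le> \<delta>"
      using p_pos \<delta> pos by (simp add: field_simps)
    then have "n * \<tau> * exp (2 * k * (4 * n / p) / yN) \<le> n * \<tau> * exp \<delta>"
      using pos by (intro mult_left_mono) auto
    then show ?thesis by (simp add: yN_def)
  qed
  have t2: "yN * exp \<delta> \<le> t\<^sup>2"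
  proof -
    define u where "u = 8 * k / (n * p * \<delta>)"
    have u0: "0 \<le> u" using p_pos \<delta> by (simp add: u_def)
    have "t\<^sup>2 = n\<^sup>2 * exp (4 * \<delta>) * (max lam (sqrt u))\<^sup>2"
      by (simp add: t_def u_def power_mult_distrib exp_double[symmetric] mult_ac)
    also have "(max lam (sqrt u))\<^sup>2 = max (lam\<^sup>2) u"
      using lam u0 by (auto simp: max_def real_le_lsqrt real_sqrt_le_iff not_le real_less_rsqrt)
        (smt (verit) real_sqrt_pow2 power_mono real_sqrt_ge_zero power2_less_imp_less)+
    finally have t: "t\<^sup>2 = n\<^sup>2 * exp (4 * \<delta>) * max (lam\<^sup>2) u" .
    have e: "exp (4 * \<delta>) = exp \<delta> * exp \<delta> * exp \<delta> * exp \<delta>" by (simp add: exp_add[symmetric])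
    have e1: "1 \<le> exp \<delta>" using \<delta> by simp
    have nu: "n\<^sup>2 * u = 8 * k * n / (p * \<delta>)" using n by (simp add: u_def power2_eq_square)
    define v where "v = max (lam\<^sup>2) u"
    have v: "lam\<^sup>2 \<le> v" "u \<le> v" "0 \<le> v" using u0 by (auto simp: v_def)
    have "n * u = 8 * k / (p * \<delta>)" using n by (simp add: u_def)
    moreover have "2 * k / (p * \<delta>) \<le> 8 * k / (p * \<delta>)"
      using p_pos \<delta> by (intro divide_right_mono) auto
    moreover have "n * u \<le> n * v" using v by (intro mult_left_mono) auto
    moreover have "1 * (n * v) \<le> exp \<delta> * (n * v)" using e1 v by (intro mult_right_mono) auto
    ultimately have A1: "2 * k / (p * \<delta>) \<le> exp \<delta> * (n * v)" by linarith
    have "exp \<delta> * (n * lam\<^sup>2) \<le> exp \<delta> * (n * v)" using v by (intro mult_left_mono) auto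
    then have A: "yG \<le> exp \<delta> * (n * v)" using A1 by (simp add: yG_def mult_ac)
    have "n * \<tau> * exp \<delta> \<le> n * (exp \<delta> * (n * v) * exp \<delta>) * exp \<delta>"
      unfolding \<tau>_def using A by (intro mult_right_mono mult_left_mono) auto
    then have B1: "n * \<tau> * exp \<delta> \<le> n\<^sup>2 * v * (exp \<delta> * exp \<delta> * exp \<delta>)"
      by (simp add: power2_eq_square mult_ac)
    have "1 * 1 \<le> exp \<delta> * exp \<delta>" using e1 by (intro mult_mono) auto
    then have "1 * 1 * 1 \<le> exp \<delta> * exp \<delta> * exp \<delta>" using e1 by (intro mult_mono) auto
    then have "n\<^sup>2 * v * 1 \<le> n\<^sup>2 * v * (exp \<delta> * exp \<delta> * exp \<delta>)"
      using v by (intro mult_left_mono) auto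
    moreover have "n\<^sup>2 * u \<le> n\<^sup>2 * v" using v by (intro mult_left_mono) auto
    ultimately have "yN \<le> n\<^sup>2 * v * (exp \<delta> * exp \<delta> * exp \<delta>)"
      unfolding yN_def by (intro max.boundedI) (use B1 nu in linarith)+
    then have "yN * exp \<delta> \<le> n\<^sup>2 * v * (exp \<delta> * exp \<delta> * exp \<delta>) * exp \<delta>"
      by (intro mult_right_mono) auto
    then show ?thesis unfolding t e v_def[symmetric] by (simp add: mult_ac)
  qed
  have t0: "0 \<le> t" using lam by (simp add: t_def le_max_iff_disj)
  define g where "g X = tr (K.G X) I (2 * k)" for X
  define h where "h X = of_bool (K.good n \<tau> (4 * n / p) I X) * tr (K.N X) I (2 * k)" for X
  have g_bm: "g \<in> bm ?P" unfolding g_def[abs_def] by (intro bm_tr K.G_bm)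
  have h_bm: "h \<in> bm ?P" unfolding h_def[abs_def] by (intro bm_mult bm_tr K.N_bm K.good_bm I) auto
  have g0: "0 \<le> g X" for X unfolding g_def by (intro tr_even_nonneg K.G_commute I)
  have h0: "0 \<le> h X" for X unfolding h_def by (intro mult_nonneg_nonneg tr_even_nonneg K.N_commute I) simp
  \<comment> \<open>The lower bound on \<open>lam\<close> makes
    \<open>1 / p \<le> lam\<^sup>2 * n\<close>, as the recursion for \<open>G\<close> demands of its
    diagonal.\<close>
  have Eg: "(\<integral>X. g X \<partial>?P) \<le> n * yG ^ (2 * k)"
    unfolding g_def using K.gram_trace_bound[OF I(1), of yG "2 * k"] I(2) p_pos pos yG lam k
    by (simp add: field_simps)
  have Eh: "(\<integral>X. h X \<partial>?P) \<le> n * yN ^ k"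
    unfolding h_def using K.kernel_trace_bound[OF I(1), of "4 * n / p" \<tau> yN k] I(2) p_pos pos yN
    by simp
  define Bg where "Bg = {X \<in> space ?P. \<tau> ^ (2 * k) < g X}"
  define Bh where "Bh = {X \<in> space ?P. (yN * exp \<delta>) ^ k < h X}"
  define Bd where "Bd i = {X \<in> space ?P. \<eta> * \<mu> < \<bar>deg I X i - \<mu>\<bar>}" for i
  have [measurable]: "g \<in> borel_measurable ?P" "h \<in> borel_measurable ?P"
    using g_bm h_bm by (auto intro: bm_measurable)
  have deg_meas: "(\<lambda>X. deg I X i) \<in> borel_measurable ?P" if "i \<in> I" for i
    using bm_measurable[OF deg_bm[OF that]] .
  have B_sets: "Bg \<in> sets ?P" "Bh \<in> sets ?P" "(\<Union>i\<in>I. Bd i) \<in> sets ?P"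
    unfolding Bg_def Bh_def Bd_def using deg_meas I by (auto intro!: sets.finite_UN)
  have "P.prob Bg \<le> (\<integral>X. g X \<partial>?P) / \<tau> ^ (2 * k)"
    unfolding Bg_def using pos by (intro P.bm_markov g_bm g0) auto
  also have "\<dots> \<le> n * yG ^ (2 * k) / \<tau> ^ (2 * k)"
    using Eg pos by (intro divide_right_mono) auto
  also have "\<dots> = n * exp (- (real (2 * k) * \<delta>))"
    using pos by (simp add: \<tau>_def power_mult_distrib exp_of_nat_mult[symmetric] exp_minus divide_inverse)
  also have "\<dots> \<le> n * exp (- (k * \<delta>))" using \<delta> by (intro mult_left_mono) auto
  finally have Pg: "P.prob Bg \<le> n * exp (- (k * \<delta>))" .
  have "P.prob Bh \<le> (\<integral>X. h X \<partial>?P) / (yN * exp \<delta>) ^ k"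
    unfolding Bh_def using pos by (intro P.bm_markov h_bm h0) auto
  also have "\<dots> \<le> n * yN ^ k / (yN * exp \<delta>) ^ k"
    using Eh pos by (intro divide_right_mono) auto
  also have "\<dots> = n * exp (- (k * \<delta>))"
    using pos by (simp add: power_mult_distrib exp_of_nat_mult[symmetric] exp_minus divide_inverse)
  finally have Ph: "P.prob Bh \<le> n * exp (- (k * \<delta>))" .
  have "P.prob (\<Union>i\<in>I. Bd i) \<le> (\<Sum>i\<in>I. P.prob (Bd i))"
    unfolding Bd_def using deg_meas by (intro P.finite_measure_subadditive_finite I) auto
  also have "\<dots> \<le> (\<Sum>i\<in>I. 2 * exp (- \<mu> * \<eta>\<^sup>2 / 4))"
    unfolding Bd_def \<mu>_def using degree_concentration[OF I(1) _ \<eta>] I(2) by (intro sum_mono) simp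
  also have "\<dots> = 2 * n * exp (- \<mu> * \<eta>\<^sup>2 / 4)" by (simp add: I)
  finally have Pd: "P.prob (\<Union>i\<in>I. Bd i) \<le> 2 * n * exp (- \<mu> * \<eta>\<^sup>2 / 4)" .
  define B where "B = Bg \<union> Bh \<union> (\<Union>i\<in>I. Bd i)"
  have B: "B \<in> sets ?P" using B_sets by (auto simp: B_def)
  have "P.prob B \<le> P.prob Bg + P.prob Bh + P.prob (\<Union>i\<in>I. Bd i)"
    unfolding B_def using B_sets
    by (intro order_trans[OF measure_Un_le] add_right_mono measure_Un_le) auto
  then have PB: "P.prob B \<le> 2 * n * exp (- (k * \<delta>)) + 2 * n * exp (- \<mu> * \<eta>\<^sup>2 / 4)"
    using Pg Ph Pd by simp
  show ?thesis
  proof (rule that[of "space ?P - B"])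
    show "space ?P - B \<in> sets ?P" using B by auto
    show "P.prob (space ?P - B) \<ge> 1 - (2 * n * exp (- (k * \<delta>)) + 2 * n * exp (- \<mu> * \<eta>\<^sup>2 / 4))"
      using PB P.prob_compl[OF B] by simp
    show d: "\<bar>deg I X i - \<mu>\<bar> \<le> \<eta> * \<mu>" if "X \<in> space ?P - B" "i \<in> I" for X i
      using that by (auto simp: B_def Bd_def not_less)
    fix X assume X: "X \<in> space ?P - B"
    obtain k' where k': "k = Suc k'" using k by (cases k) auto
    \<comment> \<open>One trace bounds the norm and the norm bounds all traces, so a single Markov
      event controls the countably many conditions in \<open>K.good\<close>.\<close>
    have "tr (K.G X) I (2 * Suc k') \<le> \<tau> ^ (2 * Suc k')"
      using X by (auto simp: B_def Bg_def g_def k' not_less)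
    then have "norm_le (K.G X) I \<tau>" by (intro norm_le_if_tr_power K.G_commute I)
    then have tr: "tr (K.G X) I (2 * j) \<le> n * \<tau> ^ (2 * j)" for j
      using norm_le_tr_even[of "K.G X", OF K.G_commute I(1)] I(2) by simp
    \<comment> \<open>A degree of at most twice its mean contributes \<open>2 * n / p\<close>, and
      the non-edges contribute at most \<open>n / p\<close>.\<close>
    have row: "(\<Sum>a\<in>I - {i}. (kern (X i) (X a))\<^sup>2) \<le> 4 * n / p" if i: "i \<in> I" for i
    proof -
      have "deg I X i \<le> \<mu> + \<eta> * \<mu>" using d[OF X i] by (simp add: abs_le_iff)
      also have "\<eta> * \<mu> \<le> 1 * \<mu>" using \<eta> p_pos by (intro mult_right_mono) (auto simp: \<mu>_def)
      also have "\<mu> + 1 * \<mu> = 2 * \<mu>" by simp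
      also have "2 * \<mu> \<le> 2 * (n * p)" using p_pos by (simp add: \<mu>_def)
      finally have "deg I X i / p\<^sup>2 \<le> 2 * (n * p) / p\<^sup>2" by (intro divide_right_mono) auto
      also have "\<dots> = 2 * n / p" using p_pos by (simp add: power2_eq_square)
      finally have 1: "deg I X i / p\<^sup>2 \<le> 2 * n / p" .
      have "real (card (I - {i})) \<le> n" using I card_mono[of I "I - {i}"] by (simp add: I)
      also have "real n \<le> n / p" using p_pos p_le_1 by (simp add: pos_le_divide_eq mult_left_le)
      finally have "(\<Sum>a\<in>I - {i}. (kern (X i) (X a))\<^sup>2) \<le> 2 * n / p + n / p"
        using kern_row_bound[of X i I] 1 by linarith
      also have "\<dots> \<le> 4 * n / p" using p_pos by (simp add: add_divide_distrib[symmetric] divide_right_mono)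
      finally show ?thesis .
    qed
    have "K.good n \<tau> (4 * n / p) I X" using tr row by (simp add: K.good_def)
    moreover have "h X \<le> (yN * exp \<delta>) ^ k" using X by (auto simp: B_def Bh_def not_less)
    ultimately have "tr (K.N X) I (2 * k) \<le> (yN * exp \<delta>) ^ k" by (simp add: h_def)
    also have "\<dots> \<le> (t\<^sup>2) ^ k" using t2 pos by (intro power_mono) auto
    finally have "tr (K.N X) I (2 * Suc k') \<le> t ^ (2 * Suc k')" by (simp only: power_mult k')
    then have "norm_le (K.N X) I t" by (intro norm_le_if_tr_power K.N_commute I)
    then show "norm_le (\<lambda>a b. if a = b then 0 else kern (X a) (X b)) I t"
      by (simp add: K.N_def[abs_def])
  qed
qed

end

section \<open>Eigenvalues of real symmetric matrices\<close>

lemma index_mult_mat_vec_sum: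
  "A \<in> carrier_mat n n \<Longrightarrow> v \<in> carrier_vec n \<Longrightarrow> i < n \<Longrightarrow> (A *\<^sub>v v) $ i = (\<Sum>j<n. A $$ (i, j) * v $ j)"
  by (simp add: scalar_prod_def atLeast0LessThan)

lemma real_symmetric_eigenvalue_real:
  fixes A :: "real mat"
  assumes A: "A \<in> carrier_mat n n" and sym: "\<And>i j. i < n \<Longrightarrow> j < n \<Longrightarrow> A $$ (i, j) = A $$ (j, i)"
    and ev: "eigenvalue (map_mat complex_of_real A) a"
  shows "a \<in> \<real>"
proof -
  let ?A = "map_mat complex_of_real A"
  have cA: "?A \<in> carrier_mat n n" using A by simp
  obtain v where v: "v \<in> carrier_vec n" "v \<noteq> 0\<^sub>v n" "?A *\<^sub>v v = a \<cdot>\<^sub>v v"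
    using ev A by (auto simp: eigenvalue_def eigenvector_def)
  define s where "s = (\<Sum>i<n. \<Sum>j<n. complex_of_real (A $$ (i, j)) * v $ j * cnj (v $ i))"
  define q where "q = (\<Sum>i<n. (cmod (v $ i))\<^sup>2)"
  have "s = (\<Sum>i<n. (?A *\<^sub>v v) $ i * cnj (v $ i))"
    unfolding s_def using A
    by (intro sum.cong refl) (simp add: index_mult_mat_vec_sum[OF cA v(1)] sum_distrib_right del: index_mult_mat_vec)
  also have "\<dots> = (\<Sum>i<n. a * (v $ i * cnj (v $ i)))"
    unfolding v(3) using v(1) by (intro sum.cong refl) (simp add: mult_ac)
  also have "\<dots> = a * complex_of_real q"
    by (simp add: q_def sum_distrib_left complex_norm_square[symmetric] del: of_real_power)
  finally have s: "s = a * complex_of_real q" .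
  have "cnj s = (\<Sum>i<n. \<Sum>j<n. complex_of_real (A $$ (i, j)) * cnj (v $ j) * v $ i)"
    by (simp add: s_def)
  also have "\<dots> = s"
    unfolding s_def by (subst sum.swap) (intro sum.cong refl, simp add: sym mult_ac)
  finally have "s \<in> \<real>" by (simp add: Reals_cnj_iff)
  moreover have "q \<noteq> 0"
  proof
    assume "q = 0"
    then have "\<forall>i<n. v $ i = 0" by (simp add: q_def sum_nonneg_eq_0_iff)
    then have "v = 0\<^sub>v n" using v(1) by (intro eq_vecI) auto
    then show False using v(2) by simp
  qed
  then have "a = s / complex_of_real q" using s by simp
  ultimately show ?thesis by simp
qed

text \<open>The polynomial splits over the complex numbers with real roots, and the factorisation
  descends because the embedding of real polynomials is injective.\<close>

lemma size_proots_char_poly_symmetric: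
  fixes A :: "real mat"
  assumes A: "A \<in> carrier_mat n n" and sym: "\<And>i j. i < n \<Longrightarrow> j < n \<Longrightarrow> A $$ (i, j) = A $$ (j, i)"
  shows "size (proots (char_poly A)) = n"
proof -
  interpret R: map_poly_inj_comm_ring_hom "complex_of_real" ..
  let ?A = "map_mat complex_of_real A"
  have cA: "?A \<in> carrier_mat n n" using A by simp
  obtain as where as: "char_poly ?A = (\<Prod>a\<leftarrow>as. [:- a, 1:])" "length as = n"
    using char_poly_factorized[OF cA] by blast
  have real: "a \<in> \<real>" if "a \<in> set as" for a
  proof (rule real_symmetric_eigenvalue_real[OF A sym])
    show "eigenvalue ?A a"
      unfolding eigenvalue_root_char_poly[OF cA] as(1)
      using that by (auto simp: poly_prod_list prod_list_zero_iff)
  qed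
  define rs where "rs = map Re as"
  have as': "as = map complex_of_real rs"
    using real by (simp add: rs_def map_idI)
  have "map_poly complex_of_real (char_poly A) = (\<Prod>a\<leftarrow>as. [:- a, 1:])"
    using of_real_hom.char_poly_hom[OF A, where 'a=complex] as(1) by simp
  also have "\<dots> = map_poly complex_of_real (\<Prod>r\<leftarrow>rs. [:- r, 1:])"
  proof -
    have "map_poly complex_of_real [:- r, 1:] = [:- complex_of_real r, 1:]" for r
      by (simp add: map_poly_pCons)
    then show ?thesis
      unfolding as' by (induction rs) (simp_all only: list.map prod_list.Cons prod_list.Nil R.hom_mult R.hom_one)
  qed
  finally have "char_poly A = (\<Prod>r\<leftarrow>rs. [:- r, 1:])"
    by (rule R.injectivity)
  moreover have "proots (\<Prod>r\<leftarrow>rs. [:- r, 1:]) = mset rs" for rs :: "real list"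
  proof (induction rs)
    case (Cons r rs)
    have "(\<Prod>r\<leftarrow>rs. [:- r, 1:]) \<noteq> 0" by (induction rs) (auto simp del: mult_pCons_left)
    then have "proots ([:- r, 1:] * (\<Prod>r\<leftarrow>rs. [:- r, 1:])) = {#r#} + mset rs"
      by (subst proots_mult) (simp_all add: Cons)
    then show ?case by (simp del: mult_pCons_left)
  qed simp
  ultimately have "proots (char_poly A) = mset rs" by (simp only:)
  moreover have "length rs = n" using as(2) by (simp add: rs_def)
  ultimately show ?thesis by simp
qed

text \<open>A Householder reflection turns \<open>u\<close> into the first axis, where symmetry
  makes the matrix block diagonal. One root \<open>e\<close> is removed exactly once, and the
  remaining roots get eigenvectors orthogonal to \<open>u\<close> even if \<open>e\<close> is a
  multiple eigenvalue.\<close>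

lemma symmetric_deflation:
  fixes A :: "real mat"
  assumes A: "A \<in> carrier_mat n n" and sym: "\<And>i j. i < n \<Longrightarrow> j < n \<Longrightarrow> A $$ (i, j) = A $$ (j, i)"
    and u: "u \<in> carrier_vec n" "u \<noteq> 0\<^sub>v n" "A *\<^sub>v u = e \<cdot>\<^sub>v u"
  obtains q where "char_poly A = [:- e, 1:] * q"
    "\<And>\<mu>. poly q \<mu> = 0 \<Longrightarrow> \<exists>w\<in>carrier_vec n. w \<noteq> 0\<^sub>v n \<and> A *\<^sub>v w = \<mu> \<cdot>\<^sub>v w \<and> u \<bullet> w = 0"
proof -
  have n: "0 < n" using u by (auto intro!: eq_vecI)
  let ?n1 = "n - 1" and ?e0 = "unit_vec n 0 :: real vec"
  define r where "r = sqrt (\<Sum>i<n. (u $ i)\<^sup>2)"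
  have "(\<Sum>i<n. (u $ i)\<^sup>2) \<noteq> 0"
  proof
    assume "(\<Sum>i<n. (u $ i)\<^sup>2) = 0"
    then have "\<forall>i<n. u $ i = 0" by (simp add: sum_nonneg_eq_0_iff)
    then show False using u(1,2) by (auto intro!: eq_vecI)
  qed
  then have r: "r \<noteq> 0" "r\<^sup>2 = (\<Sum>i<n. (u $ i)\<^sup>2)" by (simp_all add: r_def sum_nonneg)
  \<comment> \<open>\<open>H\<close> below is the reflection in the hyperplane orthogonal to
    \<open>h\<close>. If \<open>u\<close> already has the direction of the first axis, then
    \<open>h = 0\<close>, the quotient \<open>c\<close> is 0 and \<open>H\<close> is the
    identity.\<close>
  define h where "h i = u $ i / r - of_bool (i = 0)" for i
  define c where "c = 2 / (\<Sum>i<n. (h i)\<^sup>2)"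
  define H where "H = Matrix.mat n n (\<lambda>(i, j). of_bool (i = j) - c * h i * h j)"
  have H: "H \<in> carrier_mat n n" by (simp add: H_def)
  have Ht: "transpose_mat H = H" by (rule eq_matI) (auto simp: H_def)
  have At: "transpose_mat A = A" using A sym by (intro eq_matI) auto
  have D: "(\<Sum>i<n. (h i)\<^sup>2) = - 2 * h 0"
  proof -
    have "(\<Sum>i<n. (h i)\<^sup>2) = (\<Sum>i<n. (u $ i)\<^sup>2 / r\<^sup>2 + of_bool (i = 0) * (1 - 2 * (u $ 0 / r)))"
      by (intro sum.cong refl) (auto simp: h_def power2_eq_square algebra_simps)
    also have "\<dots> = (\<Sum>i<n. (u $ i)\<^sup>2 / r\<^sup>2) + (1 - 2 * (u $ 0 / r))"
      using n by (simp add: sum.distrib sum_distrib_right[symmetric] of_bool_def)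
    also have "(\<Sum>i<n. (u $ i)\<^sup>2 / r\<^sup>2) = 1"
      unfolding sum_divide_distrib[symmetric] r(2)[symmetric] using r(1) by simp
    finally show ?thesis by (simp add: h_def)
  qed
  have He0: "H *\<^sub>v ?e0 = (1 / r) \<cdot>\<^sub>v u"
  proof (rule eq_vecI)
    fix i assume "i < dim_vec ((1 / r) \<cdot>\<^sub>v u)"
    then have i: "i < n" using u(1) by simp
    have "c * h i * h 0 = - h i"
    proof (cases "h 0 = 0")
      case True
      then have "h i = 0" using D i by (simp add: sum_nonneg_eq_0_iff)
      then show ?thesis by simp
    qed (simp add: c_def D)
    then show "(H *\<^sub>v ?e0) $ i = ((1 / r) \<cdot>\<^sub>v u) $ i"
      using i n u(1) H by (simp add: H_def h_def)
  qed (use H u in auto)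
  have HH: "H * H = 1\<^sub>m n"
  proof (rule eq_matI)
    fix i j assume "i < dim_row (1\<^sub>m n :: real mat)" "j < dim_col (1\<^sub>m n :: real mat)"
    then have ij: "i < n" "j < n" by auto
    have "(H * H) $$ (i, j) = (\<Sum>k<n. (of_bool (i = k) - c * h i * h k) * (of_bool (k = j) - c * h k * h j))"
      using ij by (simp add: H_def scalar_prod_def atLeast0LessThan)
    also have "\<dots> = (\<Sum>k<n. (if k = i then of_bool (i = j) - c * h i * h j else 0)
        - (if k = j then c * h i * h j else 0) + c\<^sup>2 * h i * h j * (h k)\<^sup>2)"
      by (intro sum.cong refl) (auto simp: algebra_simps power2_eq_square)
    also have "\<dots> = of_bool (i = j) - 2 * (c * h i * h j) + c\<^sup>2 * h i * h j * (\<Sum>k<n. (h k)\<^sup>2)"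
      using ij by (simp add: sum.distrib sum_subtractf sum_distrib_left[symmetric])
    also have "c\<^sup>2 * h i * h j * (\<Sum>k<n. (h k)\<^sup>2) = 2 * (c * h i * h j)"
      by (cases "(\<Sum>k<n. (h k)\<^sup>2) = 0") (simp_all add: c_def power2_eq_square)
    finally show "(H * H) $$ (i, j) = 1\<^sub>m n $$ (i, j)" using ij by (simp add: of_bool_def)
  qed (use H in auto)
  have HHx: "H *\<^sub>v (H *\<^sub>v x) = x" if "x \<in> carrier_vec n" for x
    using that H HH by (metis assoc_mult_mat_vec one_mult_mat_vec)
  define A' where "A' = H * (A * H)"
  obtain A1 A2 A0 A3 where splitA': "split_block A' 1 1 = (A1, A2, A0, A3)"
    by (cases "split_block A' 1 1") auto
  have A': "A' \<in> carrier_mat n n" using H A by (simp add: A'_def)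
  have A'A: "similar_mat A' A"
    unfolding similar_mat_def
    by (rule exI[of _ H], rule exI[of _ H], rule similar_mat_witI[of _ _ n])
      (use H A A' HH in \<open>auto simp: A'_def\<close>)
  have A't: "transpose_mat A' = A'"
    using H A by (simp add: A'_def transpose_mult[of _ n n _ n] Ht At)
  have A'x: "A' *\<^sub>v x = H *\<^sub>v (A *\<^sub>v (H *\<^sub>v x))" if "x \<in> carrier_vec n" for x
    unfolding A'_def using that H A by (simp add: assoc_mult_mat_vec[of _ n n _ n])
  have "A' *\<^sub>v ?e0 = e \<cdot>\<^sub>v ?e0"
  proof -
    have "A' *\<^sub>v ?e0 = H *\<^sub>v (e \<cdot>\<^sub>v (H *\<^sub>v ?e0))"
      using A u by (simp add: A'x He0 mult_mat_vec smult_smult_assoc mult.commute)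
    also have "\<dots> = e \<cdot>\<^sub>v (H *\<^sub>v (H *\<^sub>v ?e0))" by (rule mult_mat_vec[OF H mult_mat_vec_carrier[OF H]]) simp
    finally show ?thesis by (simp add: HHx)
  qed
  note col0 = this
  have A'i0: "A' $$ (i, 0) = (if i = 0 then e else 0)" if "i < n" for i
    using arg_cong[OF col0, of "\<lambda>v. vec_index v i"] A' that n by simp
  have row0: "A' $$ (0, j) = 0" if "0 < j" "j < n" for j
    using arg_cong[OF A't, of "\<lambda>B. B $$ (0, j)"] A'i0[of j] that A' n by simp
  have dims: "dim_row A' = 1 + ?n1" "dim_col A' = 1 + ?n1" using A' n by auto
  from split_block[OF splitA' dims] have A1: "A1 \<in> carrier_mat 1 1" and A2: "A2 \<in> carrier_mat 1 ?n1"
    and A0: "A0 \<in> carrier_mat ?n1 1" and A3: "A3 \<in> carrier_mat ?n1 ?n1"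
    and A'block: "A' = four_block_mat A1 A2 A0 A3" by auto
  have A1id: "A1 = Matrix.mat 1 1 (\<lambda>_. e)"
    using splitA'[unfolded split_block_def Let_def] A'i0[OF n] by (auto intro!: eq_matI)
  have A0id: "A0 = 0\<^sub>m ?n1 1"
    using splitA'[unfolded split_block_def Let_def] A'i0 A' by (auto intro!: eq_matI)
  have cp: "char_poly A = [:- e, 1:] * char_poly A3"
  proof -
    have "char_poly A = char_poly A'" using char_poly_similar[OF A'A] by simp
    also have "\<dots> = char_poly A1 * char_poly A3"
      unfolding A'block A0id by (rule char_poly_four_block_zeros_col[OF A1 A2 A3])
    also have "char_poly A1 = [:- e, 1:]"
      by (simp add: A1id char_poly_defs Determinant.det_def sign_def)
    finally show ?thesis .
  qed
  show ?thesis
  proof (rule that[OF cp])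
    fix \<mu> assume "poly (char_poly A3) \<mu> = 0"
    then have "eigenvalue A3 \<mu>" using eigenvalue_root_char_poly[OF A3] by simp
    then obtain v where v: "v \<in> carrier_vec ?n1" "v \<noteq> 0\<^sub>v ?n1" "A3 *\<^sub>v v = \<mu> \<cdot>\<^sub>v v"
      using A3 by (auto simp: eigenvalue_def eigenvector_def)
    \<comment> \<open>Padding with 0 gives an eigenvector of \<open>A'\<close> orthogonal to the
      first axis; reflecting back gives one of \<open>A\<close> orthogonal to
      \<open>u\<close>.\<close>
    define x where "x = Matrix.vec n (\<lambda>i. if i = 0 then 0 else v $ (i - 1))"
    have x: "x \<in> carrier_vec n" by (simp add: x_def)
    have ev: "A' *\<^sub>v x = \<mu> \<cdot>\<^sub>v x"
    proof (rule eq_vecI)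
      fix i assume "i < dim_vec (\<mu> \<cdot>\<^sub>v x)"
      then have i: "i < n" using x by simp
      have sum: "(\<Sum>j<n. A' $$ (i, j) * x $ j) = (\<Sum>j<?n1. A' $$ (i, Suc j) * v $ j)"
      proof -
        obtain m where m: "n = Suc m" using n by (cases n) auto
        show ?thesis unfolding m sum.lessThan_Suc_shift by (simp add: x_def m)
      qed
      have "(A' *\<^sub>v x) $ i = (\<Sum>j<?n1. A' $$ (i, Suc j) * v $ j)"
        using sum index_mult_mat_vec_sum[OF A' x i] by simp
      also have "\<dots> = \<mu> * x $ i"
      proof (cases i)
        case 0
        then show ?thesis using row0 n by (simp add: x_def)
      next
        case (Suc k)
        then have k: "k < ?n1" using i by simp
        have "A' $$ (i, Suc j) = A3 $$ (k, j)" if "j < ?n1" for j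
          using splitA'[unfolded split_block_def Let_def] that k A' Suc by auto
        then have "(\<Sum>j<?n1. A' $$ (i, Suc j) * v $ j) = (A3 *\<^sub>v v) $ k"
          using index_mult_mat_vec_sum[OF A3 v(1) k] by simp
        then show ?thesis using v k i Suc by (simp add: x_def)
      qed
      finally show "(A' *\<^sub>v x) $ i = (\<mu> \<cdot>\<^sub>v x) $ i" using i x by simp
    qed (use A' x in auto)
    have x0: "x \<noteq> 0\<^sub>v n"
    proof
      assume "x = 0\<^sub>v n"
      then have "x $ Suc i = 0" if "i < ?n1" for i using that by simp
      then have "v = 0\<^sub>v ?n1" using v(1) by (intro eq_vecI) (auto simp: x_def)
      then show False using v(2) by simp
    qed
    define w where "w = H *\<^sub>v x"
    have w: "w \<in> carrier_vec n" using H x by (simp add: w_def)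
    have "A *\<^sub>v w = H *\<^sub>v (A' *\<^sub>v x)" using A w x by (simp add: A'x HHx w_def[symmetric])
    also have "\<dots> = \<mu> \<cdot>\<^sub>v w" unfolding ev w_def by (rule mult_mat_vec[OF H x])
    finally have Aw: "A *\<^sub>v w = \<mu> \<cdot>\<^sub>v w" .
    have "H *\<^sub>v 0\<^sub>v n = 0\<^sub>v n" using H by (intro eq_vecI) auto
    then have w0: "w \<noteq> 0\<^sub>v n" using x0 HHx[OF x] by (auto simp: w_def)
    have "u = r \<cdot>\<^sub>v (H *\<^sub>v ?e0)" using r u(1) by (simp add: He0 smult_smult_assoc)
    then have "u \<bullet> w = r * ((H *\<^sub>v ?e0) \<bullet> w)" using H w by simp
    also have "(H *\<^sub>v ?e0) \<bullet> w = ?e0 \<bullet> (H *\<^sub>v w)"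
      using transpose_vec_mult_scalar[OF H w, of ?e0] by (simp add: Ht)
    also have "\<dots> = 0" using n x by (simp add: w_def HHx) (simp add: x_def)
    finally have "u \<bullet> w = 0" by simp
    then show "\<exists>w\<in>carrier_vec n. w \<noteq> 0\<^sub>v n \<and> A *\<^sub>v w = \<mu> \<cdot>\<^sub>v w \<and> u \<bullet> w = 0"
      using w w0 Aw by blast
  qed
qed

text \<open>The point is that \<open>e\<close> may sit anywhere in the order. If a later position
  shows \<open>e\<close> and \<open>e\<close> is not in \<open>R\<close>, then the first position
  shows an entry of \<open>R\<close>, since \<open>e\<close> occurs once; that entry is at least
  \<open>e\<close>, so it bounds \<open>e\<close> as well.\<close>

lemma abs_nth_sorted_le:
  fixes e b :: real
  assumes M: "M = add_mset e R" and e0: "0 \<le> e" and R: "\<And>x. x \<in># R \<Longrightarrow> \<bar>x\<bar> \<le> b"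
    and j: "0 < j" "j < size M"
  shows "\<bar>rev (sorted_list_of_multiset M) ! j\<bar> \<le> b"
proof -
  define L where "L = rev (sorted_list_of_multiset M)"
  have L: "mset L = M" "length L = size M"
    by (simp_all add: L_def) (metis mset_sorted_list_of_multiset size_mset)
  have sorted: "sorted (rev L)" by (simp add: L_def)
  have ge: "L ! j \<le> L ! 0"
    using sorted j L(2) unfolding sorted_rev_iff_nth_mono by simp
  show ?thesis
  proof (cases "L ! j \<in># R")
    case True
    then show ?thesis using R by (simp add: L_def)
  next
    case False
    have "L ! j \<in># M" using L j nth_mem_mset[of j L] by simp
    then have e: "L ! j = e" using False M by auto
    have "L ! 0 \<in># R"
    proof (rule ccontr)
      assume notR: "L ! 0 \<notin># R"
      have "L ! 0 \<in># M" using L j nth_mem_mset[of 0 L] by simp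
      then have "L ! 0 = e" using notR M by auto
      have "L \<noteq> []" using L(2) j by (metis less_zeroE list.size(3))
      then obtain y L' where L': "L = y # L'" by (meson list.exhaust)
      have "L ! j = L' ! (j - 1)" "j - 1 < length L'" using j L' L(2) by auto
      then have "e \<in># mset L'" using e nth_mem_mset by metis
      moreover have "mset L' = R" using L' \<open>L ! 0 = e\<close> L(1) M by simp
      ultimately show False using notR \<open>L ! 0 = e\<close> by simp
    qed
    then have "\<bar>L ! 0\<bar> \<le> b" by (rule R)
    then show ?thesis using ge e0 e by (simp add: L_def)
  qed
qed

section \<open>Spectrum of the random restriction\<close>

text \<open>Deflating any eigenvector with nonnegative eigenvalue avoids a proof that
  \<open>u\<close> belongs to the largest one. The range of \<open>k\<close> covers the second and
  the last eigenvalue together.\<close>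

lemma abs_nth_eigenvalue_le:
  fixes A :: "real mat"
  assumes A: "A \<in> carrier_mat n n" and sym: "\<And>i j. i < n \<Longrightarrow> j < n \<Longrightarrow> A $$ (i, j) = A $$ (j, i)"
    and u: "u \<in> carrier_vec n" "u \<noteq> 0\<^sub>v n" "A *\<^sub>v u = e \<cdot>\<^sub>v u" "0 \<le> e"
    and b: "\<And>\<mu> w. w \<in> carrier_vec n \<Longrightarrow> w \<noteq> 0\<^sub>v n \<Longrightarrow> A *\<^sub>v w = \<mu> \<cdot>\<^sub>v w \<Longrightarrow> u \<bullet> w = 0 \<Longrightarrow> \<bar>\<mu>\<bar> \<le> b"
    and k: "2 \<le> k" "k \<le> n"
  shows "\<bar>nth_eigenvalue A k\<bar> \<le> b"
proof -
  obtain q where q: "char_poly A = [:- e, 1:] * q"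
    "\<And>\<mu>. poly q \<mu> = 0 \<Longrightarrow> \<exists>w\<in>carrier_vec n. w \<noteq> 0\<^sub>v n \<and> A *\<^sub>v w = \<mu> \<cdot>\<^sub>v w \<and> u \<bullet> w = 0"
    using symmetric_deflation[OF A sym u(1-3)] by metis
  have "char_poly A \<noteq> 0" using degree_monic_char_poly[OF A] by auto
  then have q0: "q \<noteq> 0" using q(1) by auto
  have M: "proots (char_poly A) = add_mset e (proots q)"
    unfolding q(1) using q0 by (subst proots_mult) auto
  show ?thesis
    unfolding nth_eigenvalue_def
  proof (rule abs_nth_sorted_le[OF M u(4)])
    fix x assume "x \<in># proots q"
    then show "\<bar>x\<bar> \<le> b" using q0 q(2)[of x] b by auto
  qed (use k size_proots_char_poly_symmetric[OF A sym] in auto)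
qed

lemma normalized_adj_mat_index:
  assumes "i < n" "j < n"
  shows "normalized_adj_mat n G $$ (i, j)
    = real (card (G `` {i})) powr (- 1 / 2) * of_bool ((i, j) \<in> G) * real (card (G `` {j})) powr (- 1 / 2)"
proof -
  have A: "adj_mat n G \<in> carrier_mat n n" by (simp add: adj_mat_def)
  show ?thesis
    unfolding normalized_adj_mat_def inv_sqrt_deg_mat_def mat_diag_mult_left[OF A]
    using assms by (subst mat_diag_mult_right) (auto simp: adj_mat_def)
qed

lemma normalized_adj_mat_carrier: "normalized_adj_mat n G \<in> carrier_mat n n"
  unfolding normalized_adj_mat_def inv_sqrt_deg_mat_def
  by (intro mult_carrier_mat[where n=n]) (simp_all add: adj_mat_def mat_diag_def)

text \<open>If \<open>w\<close> is an eigenvector orthogonal to the top one, then \<open>z = D\<^sup>-\<^sup>1\<^sup>/\<^sup>2 w\<close> satisfies \<open>\<Sum> d\<^sub>i z\<^sub>i = 0\<close>,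
  so the all-ones part of the adjacency matrix sees only the degree fluctuations.\<close>

lemma normalized_adj_mat_eigenvalue_bound:
  fixes G :: "nat rel" and K :: "nat \<Rightarrow> nat \<Rightarrow> real" and p \<theta> t :: real
  assumes G: "G \<subseteq> {..<n} \<times> {..<n}" "sym G"
    and K: "\<And>i j. i < n \<Longrightarrow> j < n \<Longrightarrow> of_bool ((i, j) \<in> G) = p * K i j + p * of_bool (i \<noteq> j)"
    and norm: "norm_le K {..<n} t" "0 \<le> t"
    and p: "0 < p" and \<theta>: "0 \<le> \<theta>" "\<theta> < 1"
    and deg: "\<And>i. i < n \<Longrightarrow> \<bar>real (card (G `` {i})) - n * p\<bar> \<le> \<theta> * (n * p)"
    and k: "2 \<le> k" "k \<le> n"
  shows "\<bar>nth_eigenvalue (normalized_adj_mat n G) k\<bar> \<le> (t / n + \<theta>\<^sup>2 + 1 / n) / (1 - \<theta>)"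
proof -
  let ?A = "normalized_adj_mat n G" and ?I = "{..<n}"
  define a where "a i j = (of_bool ((i, j) \<in> G) :: real)" for i j
  define d where "d i = real (card (G `` {i}))" for i
  define r where "r i = d i powr (- 1 / 2)" for i
  have n: "0 < n" using k by simp
  have np: "0 < n * p" using n p by simp
  have d_lower: "(1 - \<theta>) * (n * p) \<le> d i" if "i < n" for i
    using deg[OF that] by (simp add: d_def abs_le_iff algebra_simps)
  have d_pos: "0 < d i" if "i < n" for i
    using d_lower[OF that] np \<theta> by (meson diff_gt_0_iff_gt less_le_trans mult_pos_pos)
  have d_sum: "d i = (\<Sum>j<n. a i j)" if "i < n" for i
  proof -
    have "G `` {i} = {j \<in> ?I. (i, j) \<in> G}" using G(1) by auto
    then show ?thesis by (simp add: d_def a_def of_bool_def sum.If_cases Int_def)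
  qed
  have r_sqrt: "r i * sqrt (d i) = 1" "r i * r i * d i = 1" if "i < n" for i
  proof -
    have "r i = 1 / sqrt (d i)"
      using d_pos[OF that] by (simp add: r_def powr_minus_divide powr_half_sqrt)
    then show "r i * sqrt (d i) = 1" "r i * r i * d i = 1" using d_pos[OF that] by simp_all
  qed
  have A: "?A \<in> carrier_mat n n" by (rule normalized_adj_mat_carrier)
  have Aij: "?A $$ (i, j) = r i * a i j * r j" if "i < n" "j < n" for i j
    using normalized_adj_mat_index[OF that] by (simp add: r_def d_def a_def)
  have a_sym: "a i j = a j i" for i j using G(2) by (auto simp: a_def sym_def)
  define u where "u = Matrix.vec n (\<lambda>i. sqrt (d i))"
  have u: "u \<in> carrier_vec n" by (simp add: u_def)
  show ?thesis
  proof (rule abs_nth_eigenvalue_le[OF A _ u])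
    show "?A $$ (i, j) = ?A $$ (j, i)" if "i < n" "j < n" for i j
      using that by (simp add: Aij a_sym[of i j])
    show "u \<noteq> 0\<^sub>v n"
    proof
      assume "u = 0\<^sub>v n"
      then have "u $ 0 = 0" using n by simp
      then show False using d_pos[OF n] n by (simp add: u_def)
    qed
    show "?A *\<^sub>v u = 1 \<cdot>\<^sub>v u"
    proof (rule eq_vecI)
      fix i assume "i < dim_vec (1 \<cdot>\<^sub>v u)"
      then have i: "i < n" by (simp add: u_def)
      have "(?A *\<^sub>v u) $ i = (\<Sum>j<n. r i * a i j * (r j * sqrt (d j)))"
        unfolding index_mult_mat_vec_sum[OF A u i]
        by (intro sum.cong refl) (simp add: Aij[OF i] u_def)
      also have "\<dots> = (\<Sum>j<n. r i * a i j)" by (intro sum.cong refl) (simp add: r_sqrt)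
      also have "\<dots> = r i * d i" by (simp only: d_sum[OF i] sum_distrib_left)
      also have "\<dots> = (r i * sqrt (d i)) * sqrt (d i)" using d_pos[OF i] by simp
      finally show "(?A *\<^sub>v u) $ i = (1 \<cdot>\<^sub>v u) $ i" using i by (simp add: r_sqrt u_def)
    qed (use A u in auto)
    fix \<mu> w assume w: "w \<in> carrier_vec n" "w \<noteq> 0\<^sub>v n" "?A *\<^sub>v w = \<mu> \<cdot>\<^sub>v w" "u \<bullet> w = 0"
    define z where "z i = r i * w $ i" for i
    define Z where "Z = (\<Sum>i<n. (z i)\<^sup>2)"
    have wz: "w $ i = sqrt (d i) * z i" if "i < n" for i
      using r_sqrt(1)[OF that] by (simp add: z_def mult.assoc[symmetric]) (simp add: mult.commute)
    have Z: "0 < Z"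
    proof -
      have "Z \<noteq> 0"
      proof
        assume "Z = 0"
        then have "\<forall>i<n. z i = 0" by (simp add: Z_def sum_nonneg_eq_0_iff)
        then have "w = 0\<^sub>v n" using w(1) wz by (intro eq_vecI) auto
        then show False using w(2) by simp
      qed
      moreover have "0 \<le> Z" by (simp add: Z_def sum_nonneg)
      ultimately show ?thesis by simp
    qed
    have "u \<bullet> w = (\<Sum>i<n. d i * z i)"
      using w(1) d_pos by (auto simp: scalar_prod_def atLeast0LessThan u_def wz less_imp_le intro!: sum.cong)
    then have dz: "(\<Sum>i<n. d i * z i) = 0" using w(4) by simp
    have form: "\<mu> * (\<Sum>i<n. d i * (z i)\<^sup>2) = (\<Sum>i<n. \<Sum>j<n. a i j * (z i * z j))"
    proof -
      have "\<mu> * (\<Sum>i<n. d i * (z i)\<^sup>2) = (\<Sum>i<n. w $ i * (\<mu> \<cdot>\<^sub>v w) $ i)"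
        unfolding sum_distrib_left using w(1) d_pos
        by (intro sum.cong refl) (auto simp: wz power2_eq_square less_imp_le)
      also have "\<dots> = (\<Sum>i<n. w $ i * (\<Sum>j<n. r i * a i j * r j * w $ j))"
        unfolding w(3)[symmetric]
        by (intro sum.cong refl) (simp add: index_mult_mat_vec_sum[OF A w(1)] Aij del: index_mult_mat_vec)
      also have "\<dots> = (\<Sum>i<n. \<Sum>j<n. a i j * (z i * z j))"
        by (simp add: sum_distrib_left z_def mult_ac)
      finally show ?thesis .
    qed
    define s where "s = (\<Sum>i<n. z i)"
    \<comment> \<open>The adjacency matrix is \<open>p\<close> times the sum of \<open>K\<close>,
      the all-ones matrix and minus the identity; these produce the terms \<open>t / n\<close>,
      \<open>\<theta>\<^sup>2\<close> and \<open>1 / n\<close> of the bound.\<close>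
    have "(\<Sum>i<n. \<Sum>j<n. a i j * (z i * z j))
        = (\<Sum>i<n. \<Sum>j<n. p * (K i j * (z i * z j)) + p * (z i * z j) - p * (of_bool (i = j) * (z i * z j)))"
    proof (intro sum.cong refl)
      fix i j assume "i \<in> ?I" "j \<in> ?I"
      then have "a i j = p * K i j + p * of_bool (i \<noteq> j)" using K by (simp add: a_def)
      then show "a i j * (z i * z j) = p * (K i j * (z i * z j)) + p * (z i * z j) - p * (of_bool (i = j) * (z i * z j))"
        by (cases "i = j") (simp_all add: algebra_simps)
    qed
    also have "\<dots> = p * ip ?I z (app K ?I z) + p * s\<^sup>2 - p * (\<Sum>i<n. \<Sum>j<n. of_bool (i = j) * (z i * z j))"
    proof -
      have "s\<^sup>2 = (\<Sum>i<n. \<Sum>j<n. z i * z j)" by (simp only: s_def power2_eq_square sum_product)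
      then show ?thesis
        by (simp only: sum.distrib sum_subtractf sum_distrib_left[symmetric] ip_app)
    qed
    also have "(\<Sum>i<n. \<Sum>j<n. of_bool (i = j) * (z i * z j)) = ip ?I z (app (\<lambda>i j. of_bool (i = j)) ?I z)"
      by (simp only: ip_app)
    also have "\<dots> = Z" by (simp only: ip_app_delta[OF finite_lessThan] ip_def[of _ z z] Z_def power2_eq_square)
    finally have form': "(\<Sum>i<n. \<Sum>j<n. a i j * (z i * z j)) = p * ip ?I z (app K ?I z) + p * s\<^sup>2 - p * Z" .
    \<comment> \<open>Orthogonality replaces \<open>n * p\<close> by its deviation from the degrees.
      Since \<open>s\<close> enters squared, the deviation costs \<open>\<theta>\<^sup>2\<close> and
      not \<open>\<theta>\<close>.\<close>
    have "(n * p) * s = (\<Sum>i<n. (n * p - d i) * z i)"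
      using dz by (simp add: s_def left_diff_distrib sum_subtractf sum_distrib_left)
    then have "((n * p) * s)\<^sup>2 = (ip ?I (\<lambda>i. n * p - d i) z)\<^sup>2" by (simp add: ip_def)
    also have "\<dots> \<le> ip ?I (\<lambda>i. n * p - d i) (\<lambda>i. n * p - d i) * ip ?I z z" by (rule ip_CS)
    also have "\<dots> \<le> (\<Sum>i<n. (\<theta> * (n * p))\<^sup>2) * Z"
    proof (rule mult_mono)
      show "ip ?I (\<lambda>i. n * p - d i) (\<lambda>i. n * p - d i) \<le> (\<Sum>i<n. (\<theta> * (n * p))\<^sup>2)"
        unfolding ip_def power2_eq_square[symmetric]
      proof (rule sum_mono)
        fix i assume "i \<in> ?I"
        then have "\<bar>n * p - d i\<bar> \<le> \<bar>\<theta> * (n * p)\<bar>" using deg[of i] by (simp add: d_def abs_minus_commute)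
        then show "(n * p - d i)\<^sup>2 \<le> (\<theta> * (n * p))\<^sup>2" by (simp add: abs_le_square_iff)
      qed
    qed (auto simp: ip_def Z_def power2_eq_square sum_nonneg)
    finally have "(n * p)\<^sup>2 * s\<^sup>2 \<le> (n * p)\<^sup>2 * (n * \<theta>\<^sup>2 * Z)" by (simp add: power_mult_distrib mult_ac)
    then have s: "s\<^sup>2 \<le> n * \<theta>\<^sup>2 * Z"
      using mult_le_cancel_left_pos[OF zero_less_power[OF np, of 2]] by blast
    have quad: "\<bar>ip ?I z (app K ?I z)\<bar> \<le> t * Z"
      using norm_le_quadratic[OF norm, of z] by (simp only: ip_def[of _ z z] Z_def power2_eq_square)
    have "(1 - \<theta>) * (n * p) * Z = (\<Sum>i<n. ((1 - \<theta>) * (n * p)) * (z i)\<^sup>2)"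
      by (simp add: Z_def sum_distrib_left)
    also have "\<dots> \<le> (\<Sum>i<n. d i * (z i)\<^sup>2)"
      using d_lower by (intro sum_mono mult_right_mono) auto
    finally have low: "(1 - \<theta>) * (n * p) * Z \<le> (\<Sum>i<n. d i * (z i)\<^sup>2)" .
    have "\<bar>\<mu>\<bar> * ((1 - \<theta>) * (n * p) * Z) \<le> \<bar>\<mu>\<bar> * (\<Sum>i<n. d i * (z i)\<^sup>2)"
      using low by (intro mult_left_mono) auto
    also have "\<dots> = \<bar>\<mu> * (\<Sum>i<n. d i * (z i)\<^sup>2)\<bar>"
    proof -
      have "0 \<le> (\<Sum>i<n. d i * (z i)\<^sup>2)" by (intro sum_nonneg) (simp add: d_def)
      then show ?thesis by (simp add: abs_mult)
    qed
    also have "\<dots> = \<bar>p * ip ?I z (app K ?I z) + p * s\<^sup>2 - p * Z\<bar>" unfolding form form' ..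
    also have "\<dots> \<le> p * (t * Z) + p * (n * \<theta>\<^sup>2 * Z) + p * Z"
    proof -
      have "p * \<bar>ip ?I z (app K ?I z)\<bar> \<le> p * (t * Z)" "p * s\<^sup>2 \<le> p * (n * \<theta>\<^sup>2 * Z)"
        using quad s p by (intro mult_left_mono; simp)+
      moreover have "0 \<le> p * s\<^sup>2" "0 \<le> p * Z" using p Z by auto
      moreover have "\<bar>p * ip ?I z (app K ?I z)\<bar> = p * \<bar>ip ?I z (app K ?I z)\<bar>" using p by (simp add: abs_mult)
      ultimately show ?thesis by linarith
    qed
    also have "\<dots> = (n * p * Z) * (t / n + \<theta>\<^sup>2 + 1 / n)" using n by (simp add: field_simps)
    finally have "(n * p * Z) * (\<bar>\<mu>\<bar> * (1 - \<theta>)) \<le> (n * p * Z) * (t / n + \<theta>\<^sup>2 + 1 / n)"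
      by (simp add: mult_ac)
    then have "\<bar>\<mu>\<bar> * (1 - \<theta>) \<le> t / n + \<theta>\<^sup>2 + 1 / n"
      using np Z by (subst (asm) mult_le_cancel_left_pos) auto
    then show "\<bar>\<mu>\<bar> \<le> (t / n + \<theta>\<^sup>2 + 1 / n) / (1 - \<theta>)"
      using \<theta> by (simp add: pos_le_divide_eq)
  qed (use k in auto)
qed

context regular_graph
begin

lemma sample_graph_measurable:
  "sample_graph n E \<in> (\<Pi>\<^sub>M i\<in>{..<n}. \<rho>) \<rightarrow>\<^sub>M count_space (Pow ({..<n} \<times> {..<n}))"
proof (subst measurable_count_space_eq2, simp, intro conjI ballI)
  let ?P = "\<Pi>\<^sub>M i\<in>{..<n}. \<rho>"
  show "sample_graph n E \<in> space ?P \<rightarrow> Pow ({..<n} \<times> {..<n})"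
    by (auto simp: sample_graph_def)
  fix H :: "nat rel" assume H: "H \<in> Pow ({..<n} \<times> {..<n})"
  have meas: "{X \<in> space ?P. (i \<noteq> j \<and> (X i, X j) \<in> E) = ((i, j) \<in> H)} \<in> sets ?P" if "i < n" "j < n" for i j
  proof -
    have [measurable]: "(\<lambda>X. adj (X i) (X j)) \<in> borel_measurable ?P"
      using that by (intro bm_measurable adj_component_bm) auto
    have "{X \<in> space ?P. (i \<noteq> j \<and> adj (X i) (X j) = 1) = ((i, j) \<in> H)} \<in> sets ?P" by measurable
    moreover have "adj x y = 1 \<longleftrightarrow> (x, y) \<in> E" for x y by (simp add: adj_def)
    ultimately show ?thesis by (simp only:)
  qed
  have eq: "(\<forall>i\<in>{..<n}. \<forall>j\<in>{..<n}. (i \<noteq> j \<and> (X i, X j) \<in> E) = ((i, j) \<in> H)) \<longleftrightarrow> sample_graph n E X = H"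
    (is "?R \<longleftrightarrow> _") for X
  proof
    assume R: ?R
    show "sample_graph n E X = H"
    proof (rule Set.set_eqI)
      fix e :: "nat \<times> nat"
      obtain i j where e: "e = (i, j)" by (cases e)
      show "e \<in> sample_graph n E X \<longleftrightarrow> e \<in> H"
      proof (cases "i < n \<and> j < n")
        case True
        then have "(i \<noteq> j \<and> (X i, X j) \<in> E) = ((i, j) \<in> H)" using R by simp
        then show ?thesis using True by (simp add: sample_graph_def e)
      qed (use H in \<open>auto simp: sample_graph_def e\<close>)
    qed
  next
    assume "sample_graph n E X = H"
    then show ?R by (auto simp: sample_graph_def)
  qed
  have "sample_graph n E -` {H} \<inter> space ?P
      = {X \<in> space ?P. \<forall>i\<in>{..<n}. \<forall>j\<in>{..<n}. (i \<noteq> j \<and> (X i, X j) \<in> E) = ((i, j) \<in> H)}"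
    unfolding eq by blast
  also have "\<dots> \<in> sets ?P"
    by (intro sets.sets_Collect_finite_All finite_lessThan meas) (simp_all only: lessThan_iff)
  finally show "sample_graph n E -` {H} \<inter> space ?P \<in> sets ?P" .
qed

lemma measure_random_restriction:
  "measure (random_restriction n E \<rho>) {H \<in> space (random_restriction n E \<rho>). Q H}
    = measure (\<Pi>\<^sub>M i\<in>{..<n}. \<rho>) {X \<in> space (\<Pi>\<^sub>M i\<in>{..<n}. \<rho>). Q (sample_graph n E X)}"
  unfolding random_restriction_def
  by (subst measure_distr[OF sample_graph_measurable])
    (auto intro!: arg_cong[where f="measure _"] simp: sample_graph_def)

text \<open>Averaging over one endpoint leaves the degree of the other, which does not vary; this
  identifies the degree with the marginal edge probability.\<close>

lemma random_restriction_edge: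
  assumes "i < n" "j < n" "i \<noteq> j"
  shows "measure (random_restriction n E \<rho>) {H \<in> space (random_restriction n E \<rho>). (i, j) \<in> H} = p"
proof -
  let ?P = "\<Pi>\<^sub>M i\<in>{..<n}. \<rho>"
  interpret P: prob_space ?P by (rule prob_space_PiM_const)
  have bm: "(\<lambda>X. adj (X i) (X j)) \<in> bm ?P" using assms by (intro adj_component_bm) auto
  have [measurable]: "(\<lambda>X. adj (X i) (X j)) \<in> borel_measurable ?P" by (rule bm_measurable[OF bm])
  have eq: "{X \<in> space ?P. (i, j) \<in> sample_graph n E X} = {X \<in> space ?P. adj (X i) (X j) = 1}"
    using assms by (auto simp: sample_graph_def adj_def)
  have "measure ?P {X \<in> space ?P. adj (X i) (X j) = 1} = (\<integral>X. indicator {X \<in> space ?P. adj (X i) (X j) = 1} X \<partial>?P)"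
    by simp
  also have "\<dots> = (\<integral>X. adj (X i) (X j) \<partial>?P)"
    by (intro lint_cong) (auto simp: indicator_def adj_def)
  also have "\<dots> = (\<integral>X. (\<integral>x. adj ((X(j := x)) i) ((X(j := x)) j) \<partial>\<rho>) \<partial>?P)"
    using assms by (intro integral_resample bm) auto
  also have "\<dots> = (\<integral>X. p \<partial>?P)"
    using assms space_PiM_component[of _ "{..<n}" i]
    by (intro lint_cong) (simp add: integral_adj)
  also have "\<dots> = p" by (simp add: P.prob_space)
  finally show ?thesis unfolding measure_random_restriction eq .
qed

lemma sample_eigenvalue_bound:
  fixes n k :: nat and \<delta> \<eta> C lam b :: real
  assumes decay: "\<And>m x y. x \<in> space \<rho> \<Longrightarrow> y \<in> space \<rho> \<Longrightarrow> \<bar>(avg ^^ m) (adj y) x - p\<bar> \<le> C * lam ^ m"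
    and lam: "0 \<le> lam" "1 \<le> lam\<^sup>2 * n * p" and n: "2 \<le> n" and k: "1 \<le> k"
    and \<delta>: "0 < \<delta>" and \<eta>: "0 < \<eta>" "2 * \<eta> < 1" "1 \<le> \<eta> * n"
    and b: "(exp (2 * \<delta>) * max lam (sqrt (8 * k / (n * p * \<delta>))) + (2 * \<eta>)\<^sup>2 + 1 / n) / (1 - 2 * \<eta>) \<le> b"
  shows "measure (random_restriction n E \<rho>) {H \<in> space (random_restriction n E \<rho>).
      \<bar>nth_eigenvalue (normalized_adj_mat n H) 2\<bar> \<le> b \<and> \<bar>nth_eigenvalue (normalized_adj_mat n H) n\<bar> \<le> b}
    \<ge> 1 - (2 * n * exp (- (k * \<delta>)) + 2 * n * exp (- (real (n - 1) * p) * \<eta>\<^sup>2 / 4))"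
proof -
  let ?P = "\<Pi>\<^sub>M i\<in>{..<n}. \<rho>" and ?I = "{..<n}"
  interpret P: prob_space ?P by (rule prob_space_PiM_const)
  define \<mu> where "\<mu> = real (n - 1) * p"
  define t where "t = n * exp (2 * \<delta>) * max lam (sqrt (8 * k / (n * p * \<delta>)))"
  obtain A where A: "A \<in> sets ?P"
    "measure ?P A \<ge> 1 - (2 * n * exp (- (k * \<delta>)) + 2 * n * exp (- \<mu> * \<eta>\<^sup>2 / 4))"
    and deg: "\<And>X i. X \<in> A \<Longrightarrow> i \<in> ?I \<Longrightarrow> \<bar>deg ?I X i - \<mu>\<bar> \<le> \<eta> * \<mu>"
    and norm: "\<And>X. X \<in> A \<Longrightarrow> norm_le (\<lambda>a b. if a = b then 0 else kern (X a) (X b)) ?I t"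
  proof (rule sample_norm_bound[OF decay lam _ k \<delta> \<eta>(1)])
    show "1 \<le> n" "\<eta> \<le> 1" using n \<eta> by auto
  qed (auto simp: \<mu>_def t_def intro: that)
  have t0: "0 \<le> t" using lam by (simp add: t_def le_max_iff_disj)
  let ?Q = "\<lambda>H. \<bar>nth_eigenvalue (normalized_adj_mat n H) 2\<bar> \<le> b \<and> \<bar>nth_eigenvalue (normalized_adj_mat n H) n\<bar> \<le> b"
  have bound: "\<bar>nth_eigenvalue (normalized_adj_mat n (sample_graph n E X)) m\<bar> \<le> b"
    if X: "X \<in> A" and m: "2 \<le> m" "m \<le> n" for X m
  proof -
    let ?G = "sample_graph n E X" and ?K = "\<lambda>a b. if a = b then 0 else kern (X a) (X b)"
    have "\<bar>nth_eigenvalue (normalized_adj_mat n ?G) m\<bar> \<le> (t / n + (2 * \<eta>)\<^sup>2 + 1 / n) / (1 - 2 * \<eta>)"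
    proof (rule normalized_adj_mat_eigenvalue_bound[where K="?K", OF _ _ _ norm[OF X] t0 p_pos])
      show "?G \<subseteq> ?I \<times> ?I" "sym ?G"
        using E_sym by (auto simp: sample_graph_def sym_def)
      show "of_bool ((i, j) \<in> ?G) = p * ?K i j + p * of_bool (i \<noteq> j)" if "i < n" "j < n" for i j
        using that p_pos by (auto simp: sample_graph_def kern_def adj_def field_simps)
      fix i assume i: "i < n"
      have "real (card (?G `` {i})) = deg ?I X i"
      proof -
        have "?G `` {i} = {j \<in> ?I - {i}. (X i, X j) \<in> E}" using i by (auto simp: sample_graph_def)
        then show ?thesis by (simp add: deg_def adj_def of_bool_def sum.If_cases Int_def)
      qed
      \<comment> \<open>Degrees concentrate around \<open>(n - 1) * p\<close>, while the spectral
        bound is centred at \<open>n * p\<close>. The difference \<open>p\<close> is absorbed by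
        doubling \<open>\<eta>\<close>, thanks to \<open>1 \<le> \<eta> * n\<close>.\<close>
      moreover define Y where "Y = \<eta> * (n * p)"
      moreover have "\<bar>deg ?I X i - \<mu>\<bar> \<le> \<eta> * \<mu>" using deg[OF X] i by simp
      moreover have \<mu>: "\<mu> = n * p - p" using n by (simp add: \<mu>_def of_nat_diff left_diff_distrib)
      moreover have "\<eta> * \<mu> \<le> Y" unfolding Y_def using \<eta> p_pos by (intro mult_left_mono) (auto simp: \<mu>)
      moreover have "1 * p \<le> (\<eta> * n) * p" using \<eta> p_pos by (intro mult_right_mono) auto
      then have "p \<le> Y" by (simp add: Y_def)
      moreover have "2 * \<eta> * (n * p) = 2 * Y" by (simp add: Y_def)
      ultimately show "\<bar>real (card (?G `` {i})) - n * p\<bar> \<le> 2 * \<eta> * (n * p)"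
        using p_pos by linarith
    qed (use \<eta> m in auto)
    also have "t / n = exp (2 * \<delta>) * max lam (sqrt (8 * k / (n * p * \<delta>)))" using n by (simp add: t_def)
    finally show ?thesis using b by simp
  qed
  \<comment> \<open>The set \<open>A\<close> is only contained in the eigenvalue event, so
    monotonicity needs that event to be measurable; it is, as the preimage of a set in the discrete
    space of graphs.\<close>
  have "sample_graph n E X \<in> Pow (?I \<times> ?I)" for X by (auto simp: sample_graph_def)
  then have "{X \<in> space ?P. ?Q (sample_graph n E X)}
      = sample_graph n E -` {H \<in> Pow (?I \<times> ?I). ?Q H} \<inter> space ?P" by blast
  moreover have "sample_graph n E -` {H \<in> Pow (?I \<times> ?I). ?Q H} \<inter> space ?P \<in> sets ?P"
    by (rule measurable_sets[OF sample_graph_measurable]) (simp, blast)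
  ultimately have "{X \<in> space ?P. ?Q (sample_graph n E X)} \<in> sets ?P" by simp
  moreover have "A \<subseteq> {X \<in> space ?P. ?Q (sample_graph n E X)}"
    using bound n sets.sets_into_space[OF A(1)] by auto
  ultimately have "measure ?P A \<le> measure ?P {X \<in> space ?P. ?Q (sample_graph n E X)}"
    by (intro P.finite_measure_mono)
  then show ?thesis unfolding measure_random_restriction using A(2) by (simp add: \<mu>_def)
qed

end

text \<open>Graph, edge probability and decay constants may vary with \<open>n\<close>, which is
  what lets \<open>p\<close> tend to 0; the factor \<open>1 + o(1)\<close> becomes a null sequence
  \<open>\<epsilon>\<close>. The sequence constructed does not depend on \<open>\<gamma>\<close>;
  only the threshold for \<open>n\<close> does.\<close>

theorem theorem1p10:
  fixes M :: "nat \<Rightarrow> 'v measure" and E :: "nat \<Rightarrow> 'v rel" and \<rho> :: "nat \<Rightarrow> 'v measure"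
    and p C lam :: "nat \<Rightarrow> real" and \<gamma> :: real
  assumes "\<And>n. measured_graph (M n) (E n)"
    and "\<And>n. vertex_transitive (M n) (E n)"
    and "\<And>n. unique_stationary (M n) (E n) (\<rho> n)"
    and "\<And>n i j. i < n \<Longrightarrow> j < n \<Longrightarrow> i \<noteq> j \<Longrightarrow>
           p n = \<P>(G in random_restriction n (E n) (\<rho> n). (i, j) \<in> G)"
    and "\<forall>\<^sub>F n in sequentially. C n \<ge> 1"
    and "\<forall>\<^sub>F n in sequentially. lam n \<in> {(real n * p n) powr (- 1 / 2)..1}"
    and "\<forall>\<^sub>F n in sequentially. \<forall>k. \<forall>\<alpha>\<in>space (prob_algebra (M n)).
           tv_dist ((walk (M n) (E n) ^^ k) \<alpha>) (\<rho> n) \<le> C n * lam n ^ k"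
    and "(\<lambda>n. C n ^ 6 * ln (real n) ^ 4) \<in> o(\<lambda>n. p n * real n)"
    and "\<gamma> > 0"
  shows "\<exists>\<epsilon> :: nat \<Rightarrow> real. \<epsilon> \<longlonglongrightarrow> 0 \<and> (\<forall>\<^sub>F n in sequentially.
           \<P>(G in random_restriction n (E n) (\<rho> n).
              \<bar>nth_eigenvalue (normalized_adj_mat n G) 2\<bar>
                \<le> (1 + \<epsilon> n) * max (lam n) (ln (real n) ^ 4 / sqrt (p n * real n)) \<and>
              \<bar>nth_eigenvalue (normalized_adj_mat n G) n\<bar>
                \<le> (1 + \<epsilon> n) * max (lam n) (ln (real n) ^ 4 / sqrt (p n * real n)))
           \<ge> 1 - real n powr - \<gamma>)"
proof -
  define L where "L n = ln (real n)" for n :: nat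
  define P where "P n = p n * real n" for n
  \<comment> \<open>Chosen so that the Chernoff exponent, about
    \<open>P n * (\<eta> n)\<^sup>2 / 4\<close>, is a multiple of \<open>(L n)\<^sup>2\<close> and
    the degree failures stay below any power of \<open>1 / n\<close>.\<close>
  define \<eta> where "\<eta> n = 4 * L n / sqrt (P n)" for n
  \<comment> \<open>\<open>exp (2 / L n)\<close> is the norm loss at
    \<open>\<delta> = 1 / L n\<close>; 65 is 64 from the square of \<open>2 * \<eta> n\<close> plus
    1 from the missing diagonal.\<close>
  define \<epsilon> where "\<epsilon> n = (exp (2 / L n) + 65 / sqrt (P n)) / (1 - 2 * \<eta> n) - 1" for n

  have L_large: "\<forall>\<^sub>F n in sequentially. c \<le> L n" for c
    unfolding L_def by real_asymp
  have inv_L: "(\<lambda>n. 1 / L n) \<longlonglongrightarrow> 0"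
    unfolding L_def by real_asymp
  have L_o: "(\<lambda>n. L n ^ 4) \<in> o(P)"
  proof (rule landau_o.big_small_trans)
    show "(\<lambda>n. L n ^ 4) \<in> O(\<lambda>n. C n ^ 6 * ln (real n) ^ 4)"
    proof (rule bigoI[where c=1])
      show "\<forall>\<^sub>F n in sequentially. norm (L n ^ 4) \<le> 1 * norm (C n ^ 6 * ln (real n) ^ 4)"
        using assms(5)
      proof eventually_elim
        case (elim n)
        then have "1 \<le> C n ^ 6" by simp
        then have "1 * L n ^ 4 \<le> C n ^ 6 * L n ^ 4" by (intro mult_right_mono) auto
        then show ?case by (simp add: L_def)
      qed
    qed
    show "(\<lambda>n. C n ^ 6 * ln (real n) ^ 4) \<in> o(P)"
      using assms(8) by (simp add: P_def[abs_def])
  qed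
  \<comment> \<open>A marginal edge probability needs two distinct vertices, hence
    \<open>2 \<le> n\<close>.\<close>
  have p_nonneg: "0 \<le> p n" if "2 \<le> n" for n
    using assms(4)[of 0 n 1] that by (simp add: measure_nonneg)
  have "\<forall>\<^sub>F n in sequentially. norm (L n ^ 4) \<le> 1 * norm (P n)"
    by (rule landau_o.smallD[OF L_o]) simp
  then have P_ge: "\<forall>\<^sub>F n in sequentially. L n ^ 4 \<le> P n"
    using eventually_ge_at_top[of 2]
  proof eventually_elim
    case (elim n)
    then show ?case using p_nonneg[of n] by (simp add: P_def)
  qed
  have q: "(\<lambda>n. L n ^ 2 / sqrt (P n)) \<longlonglongrightarrow> 0"
  proof -
    have "(\<lambda>n. L n ^ 4 / P n) \<longlonglongrightarrow> 0" by (rule smalloD_tendsto[OF L_o])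
    then have "(\<lambda>n. sqrt (L n ^ 4 / P n)) \<longlonglongrightarrow> sqrt 0" by (rule tendsto_real_sqrt)
    moreover have "sqrt (L n ^ 4 / P n) = L n ^ 2 / sqrt (P n)" for n
    proof -
      have "L n ^ 4 = (L n ^ 2)\<^sup>2" by simp
      then show ?thesis by (simp only: real_sqrt_divide real_sqrt_abs) simp
    qed
    ultimately show ?thesis by simp
  qed
  have \<eta>0: "\<eta> \<longlonglongrightarrow> 0"
  proof -
    have "(\<lambda>n. 4 * (L n ^ 2 / sqrt (P n)) * (1 / L n)) \<longlonglongrightarrow> 4 * 0 * 0"
      by (intro tendsto_intros q inv_L)
    moreover have "4 * (L n ^ 2 / sqrt (P n)) * (1 / L n) = \<eta> n" for n
      by (cases "L n = 0") (simp_all add: \<eta>_def power2_eq_square)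
    ultimately show ?thesis by simp
  qed
  have sqrtP: "(\<lambda>n. 65 / sqrt (P n)) \<longlonglongrightarrow> 0"
  proof -
    have "(\<lambda>n. 65 * (L n ^ 2 / sqrt (P n)) * (1 / L n) * (1 / L n)) \<longlonglongrightarrow> 65 * 0 * 0 * 0"
      by (intro tendsto_intros q inv_L)
    then have "(\<lambda>n. 65 * (L n ^ 2 / sqrt (P n)) * (1 / L n) * (1 / L n)) \<longlonglongrightarrow> 0" by simp
    then show ?thesis
    proof (rule Lim_transform_eventually)
      show "\<forall>\<^sub>F n in sequentially. 65 * (L n ^ 2 / sqrt (P n)) * (1 / L n) * (1 / L n) = 65 / sqrt (P n)"
        using L_large[of 1] by eventually_elim (simp add: power2_eq_square)
    qed
  qed
  have "\<epsilon> \<longlonglongrightarrow> (exp (2 * 0) + 0) / (1 - 2 * 0) - 1"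
  proof -
    have "(\<lambda>n. (exp (2 * (1 / L n)) + 65 / sqrt (P n)) / (1 - 2 * \<eta> n) - 1) \<longlonglongrightarrow> (exp (2 * 0) + 0) / (1 - 2 * 0) - 1"
      by (intro tendsto_intros inv_L sqrtP \<eta>0) auto
    then show ?thesis by (simp add: \<epsilon>_def[abs_def])
  qed
  then have \<epsilon>0: "\<epsilon> \<longlonglongrightarrow> 0" by simp

  let ?Pr = "\<lambda>n b. \<P>(G in random_restriction n (E n) (\<rho> n).
    \<bar>nth_eigenvalue (normalized_adj_mat n G) 2\<bar> \<le> b \<and> \<bar>nth_eigenvalue (normalized_adj_mat n G) n\<bar> \<le> b)"
  have main: "\<forall>\<^sub>F n in sequentially.
      ?Pr n ((1 + \<epsilon> n) * max (lam n) (ln (real n) ^ 4 / sqrt (p n * real n))) \<ge> 1 - real n powr - \<gamma>"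
    using assms(6,7) L_large[of "4 + \<gamma>"] P_ge eventually_ge_at_top[of 4]
      order_tendstoD(2)[OF \<eta>0, of "1/2", simplified]
  proof eventually_elim
    case (elim n)
    interpret G: measured_graph "M n" "E n" by (rule assms(1))
    obtain c where reg: "regular_graph (\<rho> n) (E n) c"
      and dec: "\<And>m x y. x \<in> space (\<rho> n) \<Longrightarrow> y \<in> space (\<rho> n) \<Longrightarrow>
        \<bar>(regular_graph.avg (\<rho> n) (E n) c ^^ m) (regular_graph.adj (E n) y) x - c\<bar> \<le> C n * lam n ^ m"
      using G.transitive_regular_graph[OF assms(2,3), of "C n" "lam n"] elim(2) by metis
    have c: "c = p n"
      using regular_graph.random_restriction_edge[OF reg, of 0 n 1] assms(4)[of 0 n 1] elim(5) by simp
    interpret R: regular_graph "\<rho> n" "E n" "p n" using reg c by simp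
    define l where "l = L n"
    define s where "s = sqrt (P n)"
    \<comment> \<open>With \<open>\<delta> = 1 / l\<close> this makes \<open>k * \<delta>\<close> at
      least \<open>l\<^sup>2\<close>, so that \<open>exp (- (k * \<delta>))\<close> beats every
      power of \<open>n\<close>.\<close>
    define k where "k = nat \<lceil>l ^ 3\<rceil>"
    define m where "m = max (lam n) (l ^ 4 / s)"
    have n: "4 \<le> n" by (rule elim(5))
    have l: "4 \<le> l" "\<gamma> + 2 \<le> l" using elim(3) assms(9) by (auto simp: l_def)
    have l_pow: "1 \<le> l ^ i" for i using l by simp
    have P: "0 < P n" using elim(4) l_pow[of 4] by (simp add: l_def)
    have s: "0 < s" "s\<^sup>2 = P n" using P by (auto simp: s_def)
    have Pn: "P n \<le> n" using R.p_le_1 n by (simp add: P_def mult_left_le_one_le R.p_pos less_imp_le)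
    have \<eta>: "\<eta> n = 4 * l / s" by (simp add: \<eta>_def l_def s_def)
    have \<eta>_pos: "0 < \<eta> n" "2 * \<eta> n < 1" using l s elim(6) by (auto simp: \<eta>)
    have lam: "1 / s \<le> lam n"
    proof -
      have "(real n * p n) powr (- 1 / 2) = 1 / s"
        using P by (simp add: s_def P_def powr_minus_divide powr_half_sqrt mult.commute)
      then show ?thesis using elim(1) by simp
    qed
    have lam0: "0 < lam n" using lam s by (meson less_le_trans zero_less_divide_1_iff)
    have lam2: "1 \<le> (lam n)\<^sup>2 * n * p n"
    proof -
      have "1 \<le> lam n * s" using lam s by (simp add: pos_divide_le_eq)
      then have "1 \<le> (lam n * s)\<^sup>2" by simp
      then show ?thesis using s by (simp add: power_mult_distrib P_def mult_ac)
    qed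
    have k_ge: "l ^ 3 \<le> k" unfolding k_def by linarith
    have k_le: "k \<le> 2 * l ^ 3" unfolding k_def using l_pow[of 3] by linarith
    have "1 \<le> real k" using k_ge l_pow[of 3] by linarith
    then have k1: "1 \<le> k" by simp
    have m_ge: "1 / s \<le> m" "l\<^sup>2 / s \<le> m"
    proof -
      have "l\<^sup>2 \<le> l ^ 4" using l by (intro power_increasing) auto
      then have "l\<^sup>2 / s \<le> l ^ 4 / s" using s by (intro divide_right_mono) auto
      then show "l\<^sup>2 / s \<le> m" by (simp add: m_def)
      show "1 / s \<le> m" using lam by (simp add: m_def)
    qed
    \<comment> \<open>The quantity under the root is at most \<open>16 * l ^ 4 / P n\<close>, and
      \<open>16 \<le> l ^ 4\<close> brings it to the square of the target.\<close>
    have sq: "sqrt (8 * k / (n * p n * (1 / l))) \<le> l ^ 4 / s"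
    proof -
      have "8 * k / (n * p n * (1 / l)) = (8 * k * l) / P n" by (simp add: P_def mult_ac)
      also have "\<dots> \<le> (l ^ 4 * l ^ 4) / P n"
      proof (rule divide_right_mono)
        have "8 * k * l \<le> 8 * (2 * l ^ 3) * l" using k_le l by (intro mult_right_mono mult_left_mono) auto
        also have "\<dots> = 16 * l ^ 4" by (simp add: eval_nat_numeral)
        also have "16 \<le> l ^ 4" using power_mono[of 4 l 4] l by simp
        then have "16 * l ^ 4 \<le> l ^ 4 * l ^ 4" using l by (intro mult_right_mono) auto
        finally show "8 * k * l \<le> l ^ 4 * l ^ 4" by simp
      qed (use P in simp)
      also have "\<dots> = (l ^ 4 / s)\<^sup>2" using s(2) by (simp add: power_divide power2_eq_square)
      finally have "sqrt (8 * k / (n * p n * (1 / l))) \<le> sqrt ((l ^ 4 / s)\<^sup>2)" by (rule real_sqrt_le_mono)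
      then show ?thesis using s l by simp
    qed
    have bound: "(exp (2 * (1 / l)) * max (lam n) (sqrt (8 * k / (n * p n * (1 / l)))) + (2 * \<eta> n)\<^sup>2 + 1 / n) / (1 - 2 * \<eta> n)
        \<le> (1 + \<epsilon> n) * m"
    proof -
      let ?b = "exp (2 * (1 / l)) * max (lam n) (sqrt (8 * k / (n * p n * (1 / l)))) + (2 * \<eta> n)\<^sup>2 + 1 / n"
      have 1: "exp (2 * (1 / l)) * max (lam n) (sqrt (8 * k / (n * p n * (1 / l)))) \<le> exp (2 / l) * m"
        using sq by (auto simp: m_def intro!: mult_left_mono)
      have "(2 * \<eta> n)\<^sup>2 = 64 / s * (l\<^sup>2 / s)" by (simp add: \<eta> power2_eq_square)
      also have "\<dots> \<le> 64 / s * m" using m_ge s by (intro mult_left_mono) auto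
      finally have 2: "(2 * \<eta> n)\<^sup>2 \<le> 64 / s * m" .
      have "1 / n \<le> 1 / P n" using Pn P n by (intro divide_left_mono) auto
      also have "\<dots> = 1 / s * (1 / s)" using s(2) by (simp add: power2_eq_square)
      also have "\<dots> \<le> 1 / s * m" using m_ge s by (intro mult_left_mono) auto
      finally have 3: "1 / n \<le> 1 / s * m" .
      have "?b
          \<le> (exp (2 / l) + 65 / s) * m"
      proof -
        have "(exp (2 / l) + 65 / s) * m = exp (2 / l) * m + 64 / s * m + 1 / s * m"
          using s by (simp add: field_simps)
        then show ?thesis using 1 2 3 by linarith
      qed
      then have "(?b) / (1 - 2 * \<eta> n)
          \<le> (exp (2 / l) + 65 / s) * m / (1 - 2 * \<eta> n)"
        using \<eta>_pos by (intro divide_right_mono) auto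
      then show ?thesis by (simp add: \<epsilon>_def l_def s_def)
    qed
    have \<eta>n: "1 \<le> \<eta> n * n"
    proof -
      have "s \<le> n"
      proof -
        have "P n \<le> n * n" using Pn n by (meson le_square of_nat_mono order_trans of_nat_le_iff of_nat_mult)
        then show ?thesis unfolding s_def by (intro real_le_lsqrt) (auto simp: power2_eq_square)
      qed
      then have "1 * s \<le> (4 * l) * n" using l s by (intro mult_mono) auto
      then show ?thesis using s by (simp add: \<eta> pos_le_divide_eq)
    qed
    \<comment> \<open>All failures together are at most \<open>4 * n * exp (- l\<^sup>2)\<close>,
      and \<open>4 \<le> n\<close> bounds this by \<open>exp (2 * l - l\<^sup>2)\<close>; the
      threshold \<open>\<gamma> + 2 \<le> l\<close> is what the last comparison requires.\<close>
    have "1 - real n powr - \<gamma> \<le> 1 - (2 * n * exp (- (k * (1 / l))) + 2 * n * exp (- (real (n - 1) * p n) * (\<eta> n)\<^sup>2 / 4))"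
    proof -
      have "l\<^sup>2 = l ^ 3 * (1 / l)" using l by (simp add: power2_eq_square power3_eq_cube)
      also have "\<dots> \<le> k * (1 / l)" using k_ge l by (intro mult_right_mono) auto
      finally have e1: "exp (- (k * (1 / l))) \<le> exp (- l\<^sup>2)" by simp
      have "l\<^sup>2 \<le> 2 * l\<^sup>2" by simp
      also have "\<dots> = (n / 2 * p n) * (\<eta> n)\<^sup>2 / 4"
      proof -
        have "(\<eta> n)\<^sup>2 = 16 * l\<^sup>2 / P n" using s(2) by (simp add: \<eta> power_divide power_mult_distrib)
        then show ?thesis using R.p_pos n by (simp add: P_def field_simps)
      qed
      also have "\<dots> \<le> (real (n - 1) * p n) * (\<eta> n)\<^sup>2 / 4"
        using n R.p_pos by (intro divide_right_mono mult_right_mono) auto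
      finally have e2: "exp (- (real (n - 1) * p n) * (\<eta> n)\<^sup>2 / 4) \<le> exp (- l\<^sup>2)" by simp
      have exp_l: "exp l = n" using n by (simp add: l_def L_def)
      have "2 * n * exp (- (k * (1 / l))) + 2 * n * exp (- (real (n - 1) * p n) * (\<eta> n)\<^sup>2 / 4)
          \<le> 2 * n * exp (- l\<^sup>2) + 2 * n * exp (- l\<^sup>2)"
        using e1 e2 by (intro add_mono mult_left_mono) auto
      also have "\<dots> = 4 * n * exp (- l\<^sup>2)" by simp
      also have "\<dots> \<le> (exp l * exp l) * exp (- l\<^sup>2)"
        unfolding exp_l using n by (intro mult_right_mono) auto
      also have "\<dots> = exp (2 * l - l\<^sup>2)" by (simp add: exp_add[symmetric])
      also have "\<dots> \<le> exp (- \<gamma> * l)"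
      proof -
        have "(\<gamma> + 2) * l \<le> l * l" using l by (intro mult_right_mono) auto
        then show ?thesis by (simp add: power2_eq_square algebra_simps)
      qed
      also have "\<dots> = real n powr - \<gamma>" using n by (simp add: powr_def l_def L_def)
      finally show ?thesis by simp
    qed
    also have "\<dots> \<le> ?Pr n ((1 + \<epsilon> n) * m)"
    proof (rule R.sample_eigenvalue_bound[OF _ _ lam2 _ k1 _ \<eta>_pos \<eta>n bound])
      show "\<bar>(R.avg ^^ i) (R.adj y) x - p n\<bar> \<le> C n * lam n ^ i" if "x \<in> space (\<rho> n)" "y \<in> space (\<rho> n)" for i x y
        using dec[OF that, of i] by (simp add: c)
    qed (use lam0 n l in auto)
    finally show ?case by (simp add: m_def l_def s_def L_def P_def)
  qed
  show ?thesis using \<epsilon>0 main by blast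
qed

end
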